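(* Let $T>0$ and let $b:[0,T]\times\mathbb{R}^d\to\mathbb{R}^d$ be a measurable vector field for which there exist nonnegative $C_0,C_1\in L^1([0,T])$ such that $|b(t,y)|\le C_0(t)(1+|y|)$ for a.e. $(t,y)$, and $x\mapsto b(t,x)+C_1(t)x$ is increasing for a.e. $t\in[0,T]$. Let $\phi$ be the regular Lagrangian flow of $b$. Assume $(b^\varepsilon)_{\varepsilon>0}$ is a family of vector fields satisfying the same conditions uniformly in $\varepsilon$ (i.e. with $C_0,C_1$ independent of $\varepsilon$), such that $b^\varepsilon\to b$ a.e. in $[0,T]\times\mathbb{R}^d$ as $\varepsilon\to0$, and, for every $\varepsilon>0$, $$\int_0^T\|\nabla b^\varepsilon(t,\cdot)\|_\infty\,dt<\infty.$$ If $\phi^\varepsilon$ is the unique flow corresponding to $b^\varepsilon$, i.e. $\partial_t\phi^\varepsilon_{t,s}(x)=b^\varepsilon(t,\phi^\varepsilon_{t,s}(x))$ for $t\in[s,T]$, $\phi^\varepsilon_{s,s}(x)=x$, then, for all $s\in[0,T]$ and $p\in[1,\infty)$, as $\varepsilon\to0$, $\phi^\varepsilon_{\cdot,s}\to\phi_{\cdot,s}$ in $C([s,T],L^p_{\mathrm{loc}}(\mathbb{R}^d))$ and in $L^p_{\mathrm{loc}}(\mathbb{R}^d,W^{1,1}([s,T]))$.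
   Context: For $x,y\in\mathbb{R}^n$, $x\le y$ means $x_i\le y_i$ for all $i$; a map $\psi:\mathbb{R}^d\to\mathbb{R}^m$ is increasing if $x\le y$ implies $\psi(x)\le\psi(y)$. $b_*(t,\cdot)$ and $b^*(t,\cdot)$ denote the coordinate-by-coordinate lower and upper semicontinuous envelopes of $b(t,\cdot)$ in the space variable. Regular Lagrangian flow of $b$: for every $s\in[0,T]$ and a.e. $x\in\mathbb{R}^d$, $[s,T]\ni t\mapsto\phi_{t,s}(x)$ is the unique absolutely continuous solution of the differential inclusion $\partial_t\phi_{t,s}(x)\in\prod_{i=1}^d[b^i_*(t,\phi_{t,s}(x)),b^{i,*}(t,\phi_{t,s}(x))]$ for a.e. $t\in[s,T]$, $\phi_{s,s}(x)=x$ (existence and uniqueness for a.e. $x$ is known under the stated assumptions on $b$). *)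

theory Defs
  imports "HOL-Analysis.Analysis" "HOL-Probability.Essential_Supremum"
begin

definition abs_continuous_on :: "real \<Rightarrow> real \<Rightarrow> (real \<Rightarrow> 'b::real_normed_vector) \<Rightarrow> bool" where
  "abs_continuous_on a b \<gamma> \<longleftrightarrow>
     (\<forall>e>0. \<exists>\<delta>>0. \<forall>D :: (real \<times> real) set.
        finite D \<longrightarrow>
        (\<forall>(u, v)\<in>D. a \<le> u \<and> u \<le> v \<and> v \<le> b) \<longrightarrow>
        disjoint_family_on (\<lambda>(u, v). {u<..<v}) D \<longrightarrow>
        (\<Sum>(u, v)\<in>D. v - u) < \<delta> \<longrightarrow>
        (\<Sum>(u, v)\<in>D. norm (\<gamma> v - \<gamma> u)) < e)"

text \<open>Since \<^term>\<open>nhds x\<close>, unlike \<^term>\<open>at x\<close>, does not exclude \<^term>\<open>x\<close>,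
  the lower and upper limits along it are the semicontinuous envelopes.\<close>

definition lower_envelope :: "('a::topological_space \<Rightarrow> real) \<Rightarrow> 'a \<Rightarrow> ereal" where
  "lower_envelope f x = Liminf (nhds x) (\<lambda>y. ereal (f y))"

definition upper_envelope :: "('a::topological_space \<Rightarrow> real) \<Rightarrow> 'a \<Rightarrow> ereal" where
  "upper_envelope f x = Limsup (nhds x) (\<lambda>y. ereal (f y))"

definition admissible_field ::
    "real \<Rightarrow> (real \<Rightarrow> real) \<Rightarrow> (real \<Rightarrow> real) \<Rightarrow> (real \<Rightarrow> real^'d \<Rightarrow> real^'d) \<Rightarrow> bool" where
  "admissible_field T C\<^sub>0 C\<^sub>1 b \<longleftrightarrow>
     (\<lambda>(t, x). b t x) \<in> borel_measurable (lebesgue_on ({0..T} \<times> UNIV)) \<and>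
     (AE (t, y) in lebesgue_on ({0..T} \<times> UNIV). norm (b t y) \<le> C\<^sub>0 t * (1 + norm y)) \<and>
     (AE t in lebesgue_on {0..T}. mono (\<lambda>x. b t x + C\<^sub>1 t *\<^sub>R x))"

definition solves_inclusion ::
    "real \<Rightarrow> (real \<Rightarrow> real^'d \<Rightarrow> real^'d) \<Rightarrow> real \<Rightarrow> real^'d \<Rightarrow> (real \<Rightarrow> real^'d) \<Rightarrow> bool" where
  "solves_inclusion T b s x \<gamma> \<longleftrightarrow>
     abs_continuous_on s T \<gamma> \<and> \<gamma> s = x \<and>
     (AE t in lebesgue_on {s..T}.
        \<exists>v. (\<gamma> has_vector_derivative v) (at t within {s..T}) \<and>
            (\<forall>i. lower_envelope (\<lambda>y. b t y $ i) (\<gamma> t) \<le> ereal (v $ i) \<and>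
                 ereal (v $ i) \<le> upper_envelope (\<lambda>y. b t y $ i) (\<gamma> t)))"

text \<open>Flows are written \<^term>\<open>\<phi> t s x\<close> for $\phi_{t,s}(x)$.\<close>

definition regular_Lagrangian_flow ::
    "real \<Rightarrow> (real \<Rightarrow> real^'d \<Rightarrow> real^'d) \<Rightarrow> (real \<Rightarrow> real \<Rightarrow> real^'d \<Rightarrow> real^'d) \<Rightarrow> bool" where
  "regular_Lagrangian_flow T b \<phi> \<longleftrightarrow>
     (\<forall>s\<in>{0..T}. AE x in lebesgue.
        solves_inclusion T b s x (\<lambda>t. \<phi> t s x) \<and>
        (\<forall>\<gamma>. solves_inclusion T b s x \<gamma> \<longrightarrow> (\<forall>t\<in>{s..T}. \<gamma> t = \<phi> t s x)))"

definition flow_of ::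
    "real \<Rightarrow> (real \<Rightarrow> real^'d \<Rightarrow> real^'d) \<Rightarrow> (real \<Rightarrow> real \<Rightarrow> real^'d \<Rightarrow> real^'d) \<Rightarrow> bool" where
  "flow_of T b \<phi> \<longleftrightarrow>
     (\<forall>s\<in>{0..T}. \<forall>x.
        abs_continuous_on s T (\<lambda>t. \<phi> t s x) \<and> \<phi> s s x = x \<and>
        (AE t in lebesgue_on {s..T}.
           ((\<lambda>t. \<phi> t s x) has_vector_derivative b t (\<phi> t s x)) (at t within {s..T})))"

text \<open>Test functions are taken in \<open>C\<^sup>1\<^sub>c\<close>; by mollification this gives the same weak derivatives as
  smooth ones.\<close>

definition test_function :: "'a::euclidean_space set \<Rightarrow> ('a \<Rightarrow> real) \<Rightarrow> bool" where
  "test_function \<Omega> \<psi> \<longleftrightarrow>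
     (\<forall>x. \<psi> differentiable (at x)) \<and>
     (\<forall>h. continuous_on UNIV (\<lambda>x. frechet_derivative \<psi> (at x) h)) \<and>
     compact (closure {x. \<psi> x \<noteq> 0}) \<and> closure {x. \<psi> x \<noteq> 0} \<subseteq> \<Omega>"

definition locally_integrable_on ::
    "'a::euclidean_space set \<Rightarrow> ('a \<Rightarrow> 'b::euclidean_space) \<Rightarrow> bool" where
  "locally_integrable_on \<Omega> f \<longleftrightarrow> (\<forall>K\<subseteq>\<Omega>. compact K \<longrightarrow> f absolutely_integrable_on K)"

definition weak_derivative ::
    "'a::euclidean_space set \<Rightarrow> 'a \<Rightarrow> ('a \<Rightarrow> 'b::euclidean_space) \<Rightarrow> ('a \<Rightarrow> 'b) \<Rightarrow> bool" where
  "weak_derivative \<Omega> e f g \<longleftrightarrow>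
     locally_integrable_on \<Omega> f \<and> locally_integrable_on \<Omega> g \<and>
     (\<forall>\<psi>. test_function \<Omega> \<psi> \<longrightarrow>
        (LINT x:\<Omega>|lebesgue. frechet_derivative \<psi> (at x) e *\<^sub>R f x)
          = - (LINT x:\<Omega>|lebesgue. \<psi> x *\<^sub>R g x))"

definition weak_gradient :: "(real^'d \<Rightarrow> real^'d) \<Rightarrow> (real^'d \<Rightarrow> real^'d^'d) \<Rightarrow> bool" where
  "weak_gradient f G \<longleftrightarrow> (\<forall>j. weak_derivative UNIV (axis j 1) f (\<lambda>x. column j (G x)))"

text \<open>Weak derivatives are unique up to null sets, so the infima below only serve to
  select the weak derivative, and to give the value \<open>\<infinity>\<close> when there is none.  The
  matrix norm is Frobenius, equivalent to the operator norm.\<close>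

definition gradient_sup_norm :: "(real^'d \<Rightarrow> real^'d) \<Rightarrow> ennreal" where
  "gradient_sup_norm f =
     (INF G\<in>{G. weak_gradient f G}. esssup lebesgue (\<lambda>x. ennreal (norm (G x))))"

definition W11_norm :: "real \<Rightarrow> real \<Rightarrow> (real \<Rightarrow> 'b::euclidean_space) \<Rightarrow> ennreal" where
  "W11_norm a b u =
     (INF g\<in>{g. weak_derivative {a<..<b} 1 u g}.
        (\<integral>\<^sup>+ t\<in>{a<..<b}. ennreal (norm (u t)) \<partial>lebesgue) +
        (\<integral>\<^sup>+ t\<in>{a<..<b}. ennreal (norm (g t)) \<partial>lebesgue))"

definition ennreal_powr :: "ennreal \<Rightarrow> real \<Rightarrow> ennreal" where
  "ennreal_powr a p = (if a = \<infinity> then \<infinity> else ennreal (enn2real a powr p))"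

definition Lp_norm_on :: "'a::euclidean_space set \<Rightarrow> real \<Rightarrow> ('a \<Rightarrow> ennreal) \<Rightarrow> ennreal" where
  "Lp_norm_on K p h = ennreal_powr (\<integral>\<^sup>+ x\<in>K. ennreal_powr (h x) p \<partial>lebesgue) (1 / p)"

definition in_Lp_loc :: "real \<Rightarrow> ('a::euclidean_space \<Rightarrow> 'b::euclidean_space) \<Rightarrow> bool" where
  "in_Lp_loc p f \<longleftrightarrow>
     f \<in> borel_measurable lebesgue \<and>
     (\<forall>K. compact K \<longrightarrow> Lp_norm_on K p (\<lambda>x. ennreal (norm (f x))) < \<infinity>)"

definition in_C_Lp_loc ::
    "real \<Rightarrow> real \<Rightarrow> real \<Rightarrow> (real \<Rightarrow> 'a::euclidean_space \<Rightarrow> 'b::euclidean_space) \<Rightarrow> bool" where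
  "in_C_Lp_loc s T p u \<longleftrightarrow>
     (\<forall>t\<in>{s..T}. in_Lp_loc p (u t)) \<and>
     (\<forall>K. compact K \<longrightarrow> (\<forall>t\<in>{s..T}.
        ((\<lambda>r. Lp_norm_on K p (\<lambda>x. ennreal (norm (u r x - u t x)))) \<longlongrightarrow> 0) (at t within {s..T})))"

definition converges_C_Lp_loc ::
    "real \<Rightarrow> real \<Rightarrow> real \<Rightarrow> (real \<Rightarrow> real \<Rightarrow> 'a::euclidean_space \<Rightarrow> 'b::euclidean_space) \<Rightarrow>
       (real \<Rightarrow> 'a \<Rightarrow> 'b) \<Rightarrow> bool" where
  "converges_C_Lp_loc s T p U u \<longleftrightarrow>
     (\<forall>\<epsilon>>0. in_C_Lp_loc s T p (U \<epsilon>)) \<and> in_C_Lp_loc s T p u \<and>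
     (\<forall>K. compact K \<longrightarrow>
        ((\<lambda>\<epsilon>. SUP t\<in>{s..T}. Lp_norm_on K p (\<lambda>x. ennreal (norm (U \<epsilon> t x - u t x)))) \<longlongrightarrow> 0)
          (at_right 0))"

text \<open>A map into \<open>W\<^sup>1\<^sup>,\<^sup>1([a,b])\<close> is strongly (Bochner) measurable if it is the a.e. limit of
  simple functions with values in that space.\<close>

definition W11_strongly_measurable ::
    "real \<Rightarrow> real \<Rightarrow> ('a::euclidean_space \<Rightarrow> real \<Rightarrow> 'b::euclidean_space) \<Rightarrow> bool" where
  "W11_strongly_measurable a b w \<longleftrightarrow>
     (\<exists>S :: nat \<Rightarrow> 'a \<Rightarrow> real \<Rightarrow> 'b.
        (\<forall>n. simple_function lebesgue (S n) \<and> (\<forall>x. W11_norm a b (S n x) < \<infinity>)) \<and>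
        (AE x in lebesgue. (\<lambda>n. W11_norm a b (\<lambda>t. w x t - S n x t)) \<longlonglongrightarrow> 0))"

definition in_Lp_loc_W11 ::
    "real \<Rightarrow> real \<Rightarrow> real \<Rightarrow> ('a::euclidean_space \<Rightarrow> real \<Rightarrow> 'b::euclidean_space) \<Rightarrow> bool" where
  "in_Lp_loc_W11 a b p w \<longleftrightarrow>
     W11_strongly_measurable a b w \<and>
     (\<forall>K. compact K \<longrightarrow> Lp_norm_on K p (\<lambda>x. W11_norm a b (w x)) < \<infinity>)"

definition converges_Lp_loc_W11 ::
    "real \<Rightarrow> real \<Rightarrow> real \<Rightarrow> (real \<Rightarrow> 'a::euclidean_space \<Rightarrow> real \<Rightarrow> 'b::euclidean_space) \<Rightarrow>
       ('a \<Rightarrow> real \<Rightarrow> 'b) \<Rightarrow> bool" where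
  "converges_Lp_loc_W11 a b p W w \<longleftrightarrow>
     (\<forall>\<epsilon>>0. in_Lp_loc_W11 a b p (W \<epsilon>)) \<and> in_Lp_loc_W11 a b p w \<and>
     (\<forall>K. compact K \<longrightarrow>
        ((\<lambda>\<epsilon>. Lp_norm_on K p (\<lambda>x. W11_norm a b (\<lambda>t. W \<epsilon> x t - w x t))) \<longlongrightarrow> 0) (at_right 0))"

end

theory Submission
  imports Defs "HOL-Complex_Analysis.Great_Picard"
begin

text \<open>Write \<open>\<phi>\<^sub>n\<close> for the flows of the fields \<open>b\<^sub>n = b\<epsilon> (e n)\<close> along a sequence \<open>e n \<longlonglongrightarrow> 0\<close>, started at
  time \<open>s\<close>.  The growth bound gives them a common modulus of continuity in time.  Because \<open>b\<^sub>n + C\<^sub>1 x\<close> is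
  increasing, they also preserve the componentwise order, and they expand it: \<open>x \<le> y\<close> implies
  \<open>\<phi>\<^sub>n t y - \<phi>\<^sub>n t x \<ge> exp (- \<integral> C\<^sub>1) (y - x)\<close> (\<open>order_expanding\<close>).  The Lipschitz constants of the \<open>b\<^sub>n\<close>
  may grow without bound along the sequence; they give uniqueness of trajectories and continuity in the starting point.

  The argument rests on one fact about increasing functions.  Suppose that the values of \<open>h\<^sub>n\<close> at any two points
  of a line in the direction \<open>(1, \<dots>, 1)\<close> are eventually separated by a convergent sequence.  Then the intervals
  between lower and upper limit of \<open>h\<^sub>n\<close> at different points of the line do not overlap, so at most countably many
  of them are nontrivial, and by Fubini \<open>h\<^sub>n\<close> converges almost everywhere (\<open>AE_convergent_separated_diagonals\<close>).

  It is applied to the positions first.  A diagonal subsequence makes \<open>\<phi>\<^sub>n t z\<close> converge for a dense countable set of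
  times \<open>t\<close> and points \<open>z\<close>; monotonicity in the starting point and equicontinuity in time extend the convergence to
  almost every starting point and all times (\<open>convergent_subsequence\<close>).

  It is then applied to the speeds \<open>b\<^sub>n t (\<phi>\<^sub>n t x)\<close> at almost every time \<open>t\<close>.  By the order expansion, the limit
  positions from two points of a diagonal line are ordered strictly in every component, so there is a point \<open>z\<close>
  between them at which \<open>b\<^sub>n t z\<close> converges.  Hence the speeds converge for almost every \<open>x\<close>
  (\<open>speeds_converge\<close>); in other words, almost no trajectory spends time in the discontinuities of \<open>b\<close>.

  The limit of the positions is therefore the primitive of the limit of the speeds.  By monotonicity the limit speed
  lies between the envelopes of \<open>b\<close>, so the limit solves the differential inclusion
  (\<open>limit_flow_solves_inclusion\<close>) and coincides with \<open>\<phi>\<close> by uniqueness.  By dominated convergence,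
  \<open>\<integral> norm (b\<^sub>n t (\<phi>\<^sub>n t x) - \<partial>\<^sub>t \<phi> t x) dt\<close> tends to \<open>0\<close> for almost every \<open>x\<close>, and this quantity dominates every distance
  in the conclusion (\<open>Lp_convergence\<close>).  Since a further subsequence of any sequence converges to the same limit, the
  whole family does.

  Two preparations are independent of this.  Absolutely continuous functions are identified with primitives, by the
  fundamental theorem of calculus for absolutely continuous functions and Lebesgue's differentiation theorem on an
  interval.  A bounded weak gradient of an increasing field is turned into a pointwise Lipschitz bound: the field is
  squeezed between averages, whose derivatives are controlled by integration by parts
  (\<open>weak_gradient_lipschitz\<close>).\<close>

section \<open>Absolutely continuous functions on an interval\<close>

lemma sum_length_disjoint_intervals_le:
  fixes D :: "(real \<times> real) set"
  assumes "finite D" "\<And>u v. (u, v) \<in> D \<Longrightarrow> u \<le> v"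
    and "disjoint_family_on (\<lambda>(u, v). {u<..<v}) D"
    and "\<And>u v. (u, v) \<in> D \<Longrightarrow> {u<..<v} \<subseteq> U" and "U \<in> lmeasurable"
  shows "(\<Sum>(u, v)\<in>D. v - u) \<le> measure lebesgue U"
proof -
  have "(\<Sum>(u, v)\<in>D. v - u) = (\<Sum>i\<in>D. measure lebesgue ((\<lambda>(u, v). {u<..<v}) i))"
    using assms(2) by (intro sum.cong) (auto simp: split_beta)
  also have "\<dots> = measure lebesgue (\<Union>i\<in>D. (\<lambda>(u, v). {u<..<v}) i)"
  proof (intro measure_finite_Union[symmetric])
    show "emeasure lebesgue ((\<lambda>(u, v). {u<..<v}) i) \<noteq> \<infinity>" if "i \<in> D" for i
      using assms(2)[of "fst i" "snd i"] that by (simp add: split_beta)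
  qed (use assms(1,3) in auto)
  also have "\<dots> \<le> measure lebesgue U"
    using assms(4,5) by (intro measure_mono_fmeasurable) (auto intro!: sets.finite_UN assms(1))
  finally show ?thesis .
qed

lemma straddle_bound:
  fixes F :: "real \<Rightarrow> 'b::real_normed_vector"
  assumes "\<And>y. y \<in> {u..v} \<Longrightarrow> norm (F y - F x - (y - x) *\<^sub>R f) \<le> e * \<bar>y - x\<bar>"
    and "u \<le> x" "x \<le> v"
  shows "norm ((v - u) *\<^sub>R f - (F v - F u)) \<le> e * (v - u)"
proof -
  have "(v - u) *\<^sub>R f - (F v - F u) = (F u - F x - (u - x) *\<^sub>R f) - (F v - F x - (v - x) *\<^sub>R f)"
    by (simp add: algebra_simps)
  also have "norm \<dots> \<le> e * \<bar>u - x\<bar> + e * \<bar>v - x\<bar>"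
    using assms(1)[of u] assms(1)[of v] assms(2,3)
    by (rule_tac order_trans[OF norm_triangle_ineq4 add_mono]) simp_all
  also have "\<dots> = e * (v - u)"
    using assms(2,3) by (simp add: algebra_simps)
  finally show ?thesis .
qed

text \<open>Off the null set the gauge makes \<open>F\<close> straddle its derivative.  On the null set it confines the intervals to an
  open set of small measure, where absolute continuity makes the increments of \<open>F\<close> small.\<close>

lemma abs_continuous_on_has_integral:
  fixes F :: "real \<Rightarrow> 'b::euclidean_space"
  assumes ac: "abs_continuous_on a b F" and ab: "a \<le> b" and N: "negligible N"
    and der: "\<And>t. t \<in> {a..b} - N \<Longrightarrow> (F has_vector_derivative f t) (at t within {a..b})"
  shows "(f has_integral F b - F a) {a..b}"
proof -
  \<comment> \<open>With the value \<open>0\<close> on \<open>N\<close>, the Riemann terms tagged in \<open>N\<close> vanish and only increments of \<open>F\<close> remain there.\<close>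
  define g where "g t = (if t \<in> N then 0 else f t)" for t
  have "(g has_integral F b - F a) {a..b}"
    unfolding has_integral_real
  proof (intro allI impI)
    fix e :: real assume "e > 0"
    define e' where "e' = e / (4 * (b - a + 1))"
    have e': "e' > 0" "e' * (b - a) < e / 2"
    proof -
      have "e * (b - a) < e * (2 * (b - a + 1))" using \<open>e > 0\<close> ab by (intro mult_strict_left_mono) auto
      then show "e' * (b - a) < e / 2" using ab by (simp add: e'_def field_simps add_pos_nonneg)
    qed (use \<open>e > 0\<close> ab in \<open>simp add: e'_def\<close>)
    have "e / 2 > 0" using \<open>e > 0\<close> by simp
    then obtain \<delta> where "\<delta> > 0" and \<delta>: "\<And>D. finite D \<Longrightarrow> \<forall>(u, v)\<in>D. a \<le> u \<and> u \<le> v \<and> v \<le> b \<Longrightarrow>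
        disjoint_family_on (\<lambda>(u, v). {u<..<v}) D \<Longrightarrow> (\<Sum>(u, v)\<in>D. v - u) < \<delta> \<Longrightarrow>
        (\<Sum>(u, v)\<in>D. norm (F v - F u)) < e / 2"
      using ac unfolding abs_continuous_on_def by meson
    obtain U where U: "open U" "N \<subseteq> U" "U - N \<in> lmeasurable" "emeasure lebesgue (U - N) < ennreal \<delta>"
      using sets_lebesgue_outer_open[OF negligible_imp_sets[OF N] \<open>\<delta> > 0\<close>] by metis
    have Nm: "N \<in> lmeasurable" "measure lebesgue N = 0"
      using N by (auto simp: negligible_iff_measure)
    have U': "U \<in> lmeasurable"
      using fmeasurable.Un[OF U(3) Nm(1)] U(2) by (simp add: Un_absorb2)
    have "measure lebesgue U \<le> measure lebesgue (U - N) + measure lebesgue N"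
      using measure_Un_le[of "U - N" lebesgue N] U(2,3) Nm(1) by (simp add: Un_absorb2 fmeasurableD)
    also have "\<dots> < \<delta>"
      using U(3,4) Nm(2) \<open>\<delta> > 0\<close> by (simp add: emeasure_eq_measure2 ennreal_less_iff)
    finally have mU: "measure lebesgue U < \<delta>" .
    have "\<exists>r>0. \<forall>y\<in>{a..b}. \<bar>y - t\<bar> < r \<longrightarrow> norm (F y - F t - (y - t) *\<^sub>R g t) \<le> e' * \<bar>y - t\<bar>"
      if "t \<in> {a..b} - N" for t
      using der[OF that] that e'(1) unfolding has_vector_derivative_def has_derivative_within_alt g_def by auto
    then obtain r where r: "\<And>t. t \<in> {a..b} - N \<Longrightarrow> r t > 0"
      "\<And>t y. t \<in> {a..b} - N \<Longrightarrow> y \<in> {a..b} \<Longrightarrow> \<bar>y - t\<bar> < r t \<Longrightarrow>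
        norm (F y - F t - (y - t) *\<^sub>R g t) \<le> e' * \<bar>y - t\<bar>" by metis
    define \<gamma> where "\<gamma> t = (if t \<in> N then U else if t \<in> {a..b} then ball t (r t) else ball t 1)" for t
    have "gauge \<gamma>"
      using U(1,2) r(1) unfolding gauge_def \<gamma>_def by auto
    moreover have "norm ((\<Sum>(x, k)\<in>\<D>. measure lborel k *\<^sub>R g x) - (F b - F a)) < e"
      if \<D>: "\<D> tagged_division_of {a..b}" and fine: "\<gamma> fine \<D>" for \<D>
    proof -
      have fin: "finite \<D>" using \<D> by blast
      have kform: "\<exists>u v. k = {u..v} \<and> u \<le> x \<and> x \<le> v \<and> a \<le> u \<and> v \<le> b \<and> {u..v} \<subseteq> \<gamma> x" if xk: "(x, k) \<in> \<D>" for x k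
      proof -
        obtain u v where "k = cbox u v" using tagged_division_ofD(4)[OF \<D> xk] by blast
        moreover have "x \<in> k" "k \<subseteq> {a..b}" using tagged_division_ofD(2,3)[OF \<D> xk] .
        moreover have "k \<subseteq> \<gamma> x" using fineD[OF fine xk] .
        ultimately show ?thesis by auto
      qed
      define P where "P = {p \<in> \<D>. fst p \<in> N}"
      have P: "finite P" "P \<subseteq> \<D>" unfolding P_def using fin by auto
      have Q: "finite (\<D> - P)" using fin by auto
      have eq: "(\<Sum>(x, k)\<in>\<D>. measure lborel k *\<^sub>R g x) - (F b - F a)
          = (\<Sum>(x, k)\<in>\<D>. measure lborel k *\<^sub>R g x - (F (Sup k) - F (Inf k)))"
        unfolding additive_tagged_division_1[OF ab \<D>, of F, symmetric] sum_subtractf[symmetric]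
        by (simp add: split_beta)
      have 1: "norm (\<Sum>(x, k)\<in>\<D> - P. measure lborel k *\<^sub>R g x - (F (Sup k) - F (Inf k))) \<le> e' * (b - a)"
      proof -
        have "norm (measure lborel k *\<^sub>R g x - (F (Sup k) - F (Inf k))) \<le> e' * measure lborel k"
          if xk: "(x, k) \<in> \<D> - P" for x k
        proof -
          obtain u v where uv: "k = {u..v}" "u \<le> x" "x \<le> v" "a \<le> u" "v \<le> b" "{u..v} \<subseteq> \<gamma> x"
            using kform[of x k] xk by blast
          have x: "x \<in> {a..b} - N" using uv xk by (auto simp: P_def)
          then have "{u..v} \<subseteq> ball x (r x)" using uv(6) by (auto simp: \<gamma>_def)
          then have "norm (F y - F x - (y - x) *\<^sub>R g x) \<le> e' * \<bar>y - x\<bar>" if "y \<in> {u..v}" for y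
          proof -
            have "y \<in> ball x (r x)" using \<open>{u..v} \<subseteq> ball x (r x)\<close> that by blast
            then show ?thesis
              using r(2)[OF x, of y] that uv by (simp add: dist_real_def abs_minus_commute)
          qed
          from straddle_bound[OF this uv(2,3)] show ?thesis using uv by simp
        qed
        then have "norm (\<Sum>(x, k)\<in>\<D> - P. measure lborel k *\<^sub>R g x - (F (Sup k) - F (Inf k)))
            \<le> (\<Sum>(x, k)\<in>\<D> - P. e' * measure lborel k)"
          by (intro sum_norm_le) auto
        also have "\<dots> \<le> (\<Sum>(x, k)\<in>\<D>. e' * measure lborel k)"
          using e'(1) fin by (intro sum_mono2) auto
        also have "\<dots> = e' * (\<Sum>(x, k)\<in>\<D>. measure lborel k)"
          by (simp add: sum_distrib_left split_beta)
        also have "\<dots> = e' * (b - a)"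
          using additive_content_tagged_division[of \<D> a b] \<D> ab by simp
        finally show ?thesis .
      qed
      have 2: "norm (\<Sum>(x, k)\<in>P. measure lborel k *\<^sub>R g x - (F (Sup k) - F (Inf k))) < e / 2"
      proof -
        \<comment> \<open>Degenerate intervals may occur with several tags; without them, intervals correspond to pairs of endpoints.\<close>
        define K where "K = {p \<in> P. measure lborel (snd p) \<noteq> 0}"
        define J where "J p = (Inf (snd p), Sup (snd p))" for p :: "real \<times> real set"
        have K: "finite K" "K \<subseteq> \<D>" "K \<subseteq> P" using P by (auto simp: K_def)
        have Kform: "\<exists>x u v. p = (x, {u..v}) \<and> u < v \<and> a \<le> u \<and> v \<le> b \<and> {u..v} \<subseteq> U \<and> J p = (u, v)"
          if p: "p \<in> K" for p
        proof -
          obtain u v where uv: "snd p = {u..v}" "u \<le> fst p" "fst p \<le> v" "a \<le> u" "v \<le> b" "{u..v} \<subseteq> \<gamma> (fst p)"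
            using kform[of "fst p" "snd p"] p K(2) by auto
          moreover have "u < v" using uv p by (auto simp: K_def)
          moreover have "fst p \<in> N" using p by (auto simp: K_def P_def)
          ultimately show ?thesis by (intro exI[of _ "fst p"] exI[of _ u] exI[of _ v]) (auto simp: J_def \<gamma>_def prod_eq_iff)
        qed
        have disj: "interior (snd p) \<inter> interior (snd q) = {}" if "p \<in> K" "q \<in> K" "p \<noteq> q" for p q
          using tagged_division_ofD(5)[OF \<D>, of "fst p" "snd p" "fst q" "snd q"] that K(2) by auto
        have inj: "inj_on J K"
        proof (rule inj_onI)
          fix p q assume pq: "p \<in> K" "q \<in> K" "J p = J q"
          then obtain x y u v where "p = (x, {u..v})" "q = (y, {u..v})" "u < v"
            using Kform[OF pq(1)] Kform[OF pq(2)] by auto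
          moreover from this have "interior (snd p) \<inter> interior (snd q) \<noteq> {}"
            by (simp add: interior_atLeastAtMost_real)
          ultimately show "p = q" using disj[OF pq(1,2)] by blast
        qed
        have dJ: "disjoint_family_on (\<lambda>(u, v). {u<..<v}) (J ` K)"
          unfolding disjoint_family_on_def
        proof (intro ballI impI)
          fix m n assume "m \<in> J ` K" "n \<in> J ` K" "m \<noteq> n"
          then obtain p q where pq: "p \<in> K" "q \<in> K" "p \<noteq> q" "m = J p" "n = J q" by blast
          from Kform[OF pq(1)] Kform[OF pq(2)] disj[OF pq(1-3)]
          show "(case m of (u, v) \<Rightarrow> {u<..<v}) \<inter> (case n of (u, v) \<Rightarrow> {u<..<v}) = {}"
            by (auto simp: pq interior_atLeastAtMost_real)
        qed
        have "(\<Sum>(u, v)\<in>J ` K. v - u) \<le> measure lebesgue U"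
        proof (rule sum_length_disjoint_intervals_le[OF _ _ dJ _ U'])
          fix u v assume "(u, v) \<in> J ` K"
          then obtain p where "p \<in> K" "J p = (u, v)" by force
          with Kform[of p] show "u \<le> v" "{u<..<v} \<subseteq> U" by (auto simp: subset_eq)
        qed (use K in auto)
        then have small: "(\<Sum>(u, v)\<in>J ` K. norm (F v - F u)) < e / 2"
        proof (intro \<delta>[OF _ _ dJ])
          show "\<forall>(u, v)\<in>J ` K. a \<le> u \<and> u \<le> v \<and> v \<le> b"
            using Kform by force
        qed (use K mU in auto)
        have "norm (measure lborel k *\<^sub>R g x - (F (Sup k) - F (Inf k))) = norm (F (Sup k) - F (Inf k))"
          if "(x, k) \<in> P" for x k
          using that by (simp add: P_def g_def norm_minus_commute)
        then have "norm (\<Sum>(x, k)\<in>P. measure lborel k *\<^sub>R g x - (F (Sup k) - F (Inf k)))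
            \<le> (\<Sum>(x, k)\<in>P. norm (F (Sup k) - F (Inf k)))"
          by (intro sum_norm_le) auto
        also have "\<dots> = (\<Sum>(x, k)\<in>K. norm (F (Sup k) - F (Inf k)))"
        proof (rule sum.mono_neutral_right)
          show "\<forall>i\<in>P - K. (case i of (x, k) \<Rightarrow> norm (F (Sup k) - F (Inf k))) = 0"
          proof
            fix i assume i: "i \<in> P - K"
            then obtain u v where "snd i = {u..v}" "u \<le> v"
              using kform[of "fst i" "snd i"] P(2) by (metis Diff_iff order_trans prod.collapse subsetD)
            with i show "(case i of (x, k) \<Rightarrow> norm (F (Sup k) - F (Inf k))) = 0"
              by (auto simp: K_def split_beta)
          qed
        qed (use P K in auto)
        also have "\<dots> = (\<Sum>(u, v)\<in>J ` K. norm (F v - F u))"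
          by (subst sum.reindex[OF inj]) (auto simp: J_def split_beta)
        finally show ?thesis using small by linarith
      qed
      have "(\<Sum>(x, k)\<in>\<D>. measure lborel k *\<^sub>R g x - (F (Sup k) - F (Inf k)))
          = (\<Sum>(x, k)\<in>\<D> - P. measure lborel k *\<^sub>R g x - (F (Sup k) - F (Inf k)))
            + (\<Sum>(x, k)\<in>P. measure lborel k *\<^sub>R g x - (F (Sup k) - F (Inf k)))"
        using sum.subset_diff[OF P(2) fin] .
      also have "norm \<dots> < e"
        using order.strict_trans1[OF norm_triangle_ineq add_le_less_mono[OF 1 2]] e'(2) by linarith
      finally show ?thesis unfolding eq .
    qed
    ultimately show "\<exists>\<gamma>. gauge \<gamma> \<and> (\<forall>\<D>. \<D> tagged_division_of {a..b} \<and> \<gamma> fine \<D> \<longrightarrow>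
        norm ((\<Sum>(x, k)\<in>\<D>. measure lborel k *\<^sub>R g x) - (F b - F a)) < e)"
      by (intro exI[of _ \<gamma>] conjI allI impI) simp_all
  qed
  then show ?thesis
    by (rule has_integral_spike[OF N, rotated]) (auto simp: g_def)
qed

lemma abs_continuous_on_subset:
  assumes "abs_continuous_on a b F" "a \<le> a'" "b' \<le> b"
  shows "abs_continuous_on a' b' F"
  unfolding abs_continuous_on_def
proof (intro allI impI)
  fix e :: real assume "e > 0"
  then obtain \<delta> where "\<delta> > 0" and \<delta>: "\<And>D. finite D \<Longrightarrow> \<forall>(u, v)\<in>D. a \<le> u \<and> u \<le> v \<and> v \<le> b \<Longrightarrow>
        disjoint_family_on (\<lambda>(u, v). {u<..<v}) D \<Longrightarrow> (\<Sum>(u, v)\<in>D. v - u) < \<delta> \<Longrightarrow>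
        (\<Sum>(u, v)\<in>D. norm (F v - F u)) < e"
    using assms(1) unfolding abs_continuous_on_def by meson
  moreover have "\<forall>(u, v)\<in>D. a \<le> u \<and> u \<le> v \<and> v \<le> b" if "\<forall>(u, v)\<in>D. a' \<le> u \<and> u \<le> v \<and> v \<le> b'" for D
    using that assms(2,3) by force
  ultimately show "\<exists>\<delta>>0. \<forall>D. finite D \<longrightarrow> (\<forall>(u, v)\<in>D. a' \<le> u \<and> u \<le> v \<and> v \<le> b') \<longrightarrow>
      disjoint_family_on (\<lambda>(u, v). {u<..<v}) D \<longrightarrow> (\<Sum>(u, v)\<in>D. v - u) < \<delta> \<longrightarrow>
      (\<Sum>(u, v)\<in>D. norm (F v - F u)) < e"
    by (intro exI[of _ \<delta>] conjI allI impI \<delta>) simp_all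
qed

lemma abs_continuous_on_imp_continuous_on:
  assumes "abs_continuous_on a b F"
  shows "continuous_on {a..b} F"
  unfolding continuous_on_iff
proof (intro ballI allI impI)
  fix x e :: real assume x: "x \<in> {a..b}" and "e > 0"
  then obtain \<delta> where "\<delta> > 0" and \<delta>: "\<And>D. finite D \<Longrightarrow> \<forall>(u, v)\<in>D. a \<le> u \<and> u \<le> v \<and> v \<le> b \<Longrightarrow>
        disjoint_family_on (\<lambda>(u, v). {u<..<v}) D \<Longrightarrow> (\<Sum>(u, v)\<in>D. v - u) < \<delta> \<Longrightarrow>
        (\<Sum>(u, v)\<in>D. norm (F v - F u)) < e"
    using assms unfolding abs_continuous_on_def by meson
  have "dist (F y) (F x) < e" if y: "y \<in> {a..b}" "dist y x < \<delta>" for y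
  proof (cases "x \<le> y")
    case True
    then show ?thesis
      using \<delta>[of "{(x, y)}"] x y by (auto simp: disjoint_family_on_def dist_norm)
  next
    case False
    then show ?thesis
      using \<delta>[of "{(y, x)}"] x y by (auto simp: disjoint_family_on_def dist_norm norm_minus_commute)
  qed
  then show "\<exists>d>0. \<forall>x'\<in>{a..b}. dist x' x < d \<longrightarrow> dist (F x') (F x) < e" using \<open>\<delta> > 0\<close> by blast
qed

text \<open>The truncation \<open>h = min h n + max (h - n) 0\<close> splits the integral of \<open>h\<close> over a set \<open>S\<close> into a part
  bounded by \<open>n\<close> times the measure of \<open>S\<close> and a remainder that is small uniformly in \<open>S\<close>.\<close>

lemma integral_small_on_small_sets:
  fixes h :: "'a \<Rightarrow> real"
  assumes h: "integrable M h" and "e > 0"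
  obtains \<delta> where "\<delta> > 0"
    "\<And>S. S \<in> fmeasurable M \<Longrightarrow> measure M S < \<delta> \<Longrightarrow> (\<integral>x. indicator S x * h x \<partial>M) < e"
proof -
  have "(\<lambda>n. \<integral>x. max (h x - real n) 0 \<partial>M) \<longlonglongrightarrow> (\<integral>x. 0 \<partial>M)"
  proof (rule integral_dominated_convergence[where w = "\<lambda>x. norm (h x)"])
    show "AE x in M. (\<lambda>n. max (h x - real n) 0) \<longlonglongrightarrow> 0"
    proof (rule AE_I2, rule tendsto_eventually)
      fix x
      obtain m :: nat where "h x \<le> real m" using real_arch_simple by blast
      then show "\<forall>\<^sub>F n in sequentially. max (h x - real n) 0 = 0"
        by (intro eventually_sequentiallyI[of m]) auto
    qed
  qed (use h in \<open>auto intro!: AE_I2 borel_measurable_max borel_measurable_diff borel_measurable_integrable\<close>)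
  then have "\<forall>\<^sub>F n in sequentially. (\<integral>x. max (h x - real n) 0 \<partial>M) < e / 2"
    using \<open>e > 0\<close> by (intro order_tendstoD(2)[where y = 0]) simp_all
  then obtain n where n: "(\<integral>x. max (h x - real n) 0 \<partial>M) < e / 2"
    by (auto dest: eventually_happens)
  have int: "integrable M (\<lambda>x. max (h x - real n) 0)"
    by (rule Bochner_Integration.integrable_bound[OF h]) (use h in auto)
  define \<delta> where "\<delta> = e / (2 * (real n + 1))"
  show ?thesis
  proof
    show "\<delta> > 0" using \<open>e > 0\<close> by (simp add: \<delta>_def)
    fix S assume S: "S \<in> fmeasurable M" "measure M S < \<delta>"
    then have intS: "integrable M (\<lambda>x. indicator S x * real n)"
      by (auto intro!: integrable_mult_left integrable_real_indicator simp: fmeasurable_def)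
    have "(\<integral>x. indicator S x * h x \<partial>M) \<le> (\<integral>x. indicator S x * real n + max (h x - real n) 0 \<partial>M)"
    proof (rule integral_mono)
      show "integrable M (\<lambda>x. indicator S x * h x)"
        using integrable_mult_indicator[OF _ h, of S] S(1) by auto
    qed (use int intS in \<open>auto simp: indicator_def\<close>)
    also have "\<dots> = measure M S * real n + (\<integral>x. max (h x - real n) 0 \<partial>M)"
      using int intS S(1) by (simp add: fmeasurable_def Int_absorb1 sets.sets_into_space)
    also have "\<dots> < \<delta> * (real n + 1) + e / 2"
    proof -
      have "measure M S * real n \<le> \<delta> * (real n + 1)"
        using S(2) \<open>\<delta> > 0\<close> by (intro mult_mono) auto
      with n show ?thesis by linarith
    qed
    also have "\<dots> = e" by (simp add: \<delta>_def field_simps)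
    finally show "(\<integral>x. indicator S x * h x \<partial>M) < e" .
  qed
qed

text \<open>The sum of the integrals over disjoint intervals is the integral over their union, a set of small measure.\<close>

lemma abs_continuous_on_integral_bound:
  fixes F :: "real \<Rightarrow> 'b::real_normed_vector" and h :: "real \<Rightarrow> real"
  assumes h: "h absolutely_integrable_on {a..b}"
    and F: "\<And>u v. a \<le> u \<Longrightarrow> u \<le> v \<Longrightarrow> v \<le> b \<Longrightarrow> norm (F v - F u) \<le> integral {u..v} h"
  shows "abs_continuous_on a b F"
  unfolding abs_continuous_on_def
proof (intro allI impI)
  fix e :: real assume "e > 0"
  define H where "H x = indicator {a..b} x * h x" for x
  have H: "integrable lebesgue H"
    using h unfolding set_integrable_def H_def by simp
  obtain \<delta> where "\<delta> > 0" and
    \<delta>: "\<And>S. S \<in> lmeasurable \<Longrightarrow> measure lebesgue S < \<delta> \<Longrightarrow> (\<integral>x. indicator S x * H x \<partial>lebesgue) < e"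
    using integral_small_on_small_sets[OF H \<open>e > 0\<close>] by metis
  have "(\<Sum>(u, v)\<in>D. norm (F v - F u)) < e"
    if D: "finite D" "\<forall>(u, v)\<in>D. a \<le> u \<and> u \<le> v \<and> v \<le> b"
      "disjoint_family_on (\<lambda>(u, v). {u<..<v}) D" "(\<Sum>(u, v)\<in>D. v - u) < \<delta>" for D
  proof -
    define S where "S = (\<Union>i\<in>D. (\<lambda>(u, v). {u<..<v}) i)"
    have S: "S \<in> lmeasurable" unfolding S_def using D(1) by (intro fmeasurable.finite_UN) auto
    have "measure lebesgue S \<le> (\<Sum>i\<in>D. measure lebesgue ((\<lambda>(u, v). {u<..<v}) i))"
      unfolding S_def using D(1) by (intro measure_UNION_le) auto
    also have "\<dots> = (\<Sum>(u, v)\<in>D. v - u)"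
      using D(2) by (intro sum.cong) (auto simp: split_beta)
    finally have "(\<integral>x. indicator S x * H x \<partial>lebesgue) < e"
      using \<delta>[OF S] D(4) by linarith
    moreover have "(\<Sum>(u, v)\<in>D. norm (F v - F u)) \<le> (\<Sum>(u, v)\<in>D. \<integral>x. indicator {u<..<v} x * H x \<partial>lebesgue)"
    proof (rule sum_mono, clarify)
      fix u v assume "(u, v) \<in> D"
      then have uv: "a \<le> u" "u \<le> v" "v \<le> b" using D(2) by auto
      have "h absolutely_integrable_on {u<..<v}"
        using h by (rule set_integrable_subset) (use uv in auto)
      then have "(\<integral>x. indicator {u<..<v} x *\<^sub>R h x \<partial>lebesgue) = integral {u<..<v} h"
        using set_lebesgue_integral_eq_integral(2) by (metis (no_types) set_lebesgue_integral_def)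
      moreover have "indicator {u<..<v} x * H x = indicator {u<..<v} x *\<^sub>R h x" for x
        using uv by (auto simp: H_def indicator_def)
      moreover have "integral {u<..<v} h = integral {u..v} h"
        using integral_open_interval_real[of u v h] by simp
      ultimately show "norm (F v - F u) \<le> (\<integral>x. indicator {u<..<v} x * H x \<partial>lebesgue)"
        using F[OF uv] by presburger
    qed
    moreover have "(\<Sum>(u, v)\<in>D. \<integral>x. indicator {u<..<v} x * H x \<partial>lebesgue)
        = (\<integral>x. indicator S x * H x \<partial>lebesgue)"
    proof -
      have "(\<Sum>i\<in>D. indicator ((\<lambda>(u, v). {u<..<v}) i) x * H x) = indicator S x * H x" for x
        unfolding S_def sum_distrib_right[symmetric] indicator_UN_disjoint[OF D(1,3)] ..
      moreover have "integrable lebesgue (\<lambda>x. indicator {u<..<v} x * H x)" for u v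
        using integrable_mult_indicator[OF _ H, of "{u<..<v}"] by auto
      ultimately show ?thesis
        unfolding split_beta by (subst Bochner_Integration.integral_sum[symmetric]) simp_all
    qed
    ultimately show ?thesis by linarith
  qed
  then show "\<exists>\<delta>>0. \<forall>D. finite D \<longrightarrow> (\<forall>(u, v)\<in>D. a \<le> u \<and> u \<le> v \<and> v \<le> b) \<longrightarrow>
      disjoint_family_on (\<lambda>(u, v). {u<..<v}) D \<longrightarrow> (\<Sum>(u, v)\<in>D. v - u) < \<delta> \<longrightarrow>
      (\<Sum>(u, v)\<in>D. norm (F v - F u)) < e"
    using \<open>\<delta> > 0\<close> by (intro exI[of _ \<delta>] conjI allI impI) simp_all
qed

lemma integral_adjacent:
  fixes h :: "real \<Rightarrow> 'b::euclidean_space"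
  assumes "h integrable_on {a..b}" "a \<le> r" "r \<le> t" "t \<le> b"
  shows "integral {r..t} h = integral {a..t} h - integral {a..r} h"
  using Henstock_Kurzweil_Integration.integral_combine[of a r t h] integrable_subinterval_real[OF assms(1), of a t] assms(2-4)
  by (simp add: eq_diff_eq add.commute)

section \<open>Lebesgue's differentiation theorem on an interval\<close>

text \<open>The set where the difference quotients of the primitive stay \<open>\<eta>\<close>-away from \<open>f x\<close> along a
  sequence is covered, up to a null set, by disjoint intervals with an endpoint as tag (Vitali); on
  those the Henstock lemma bounds the total error, hence the total length.\<close>

lemma negligible_primitive_error:
  fixes f :: "real \<Rightarrow> 'b::euclidean_space"
  assumes f: "f integrable_on {a..b}" and "\<eta> > 0"
  defines "F \<equiv> \<lambda>t. integral {a..t} f"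
  shows "negligible {x\<in>{a..b}. \<forall>d>0. \<exists>y\<in>{a..b}. y \<noteq> x \<and> \<bar>y - x\<bar> < d \<and>
            norm (F y - F x - (y - x) *\<^sub>R f x) > \<eta> * \<bar>y - x\<bar>}" (is "negligible ?B")
  unfolding negligible_outer_le
proof (intro allI impI)
  fix e :: real assume "e > 0"
  define bad where "bad x y \<longleftrightarrow> y \<in> {a..b} \<and> y \<noteq> x \<and> norm (F y - F x - (y - x) *\<^sub>R f x) > \<eta> * \<bar>y - x\<bar>" for x y
  have "\<eta> * e > 0" using \<open>\<eta> > 0\<close> \<open>e > 0\<close> by simp
  from Henstock_lemma[of f a b, OF _ this] f
  obtain \<gamma> where "gauge \<gamma>" and \<gamma>: "\<And>p. p tagged_partial_division_of {a..b} \<Longrightarrow> \<gamma> fine p \<Longrightarrow>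
      (\<Sum>(x, k)\<in>p. norm (measure lborel k *\<^sub>R f x - integral k f)) < \<eta> * e"
    by auto
  define K where "K = {(x, y). x \<in> ?B \<and> bad x y \<and> {min x y..max x y} \<subseteq> \<gamma> x}"
  define c where "c p = (fst p + snd p) / 2" for p :: "real \<times> real"
  define r where "r p = \<bar>snd p - fst p\<bar> / 2" for p :: "real \<times> real"
  have cb: "cball (c p) (r p) = {min (fst p) (snd p)..max (fst p) (snd p)}" for p
    by (auto simp: c_def r_def cball_eq_atLeastAtMost min_def max_def field_simps abs_if)
  obtain C where C: "countable C" "C \<subseteq> K" "pairwise (\<lambda>i j. disjnt (cball (c i) (r i)) (cball (c j) (r j))) C"
    "negligible (?B - (\<Union>i\<in>C. cball (c i) (r i)))"
  proof (rule Vitali_covering_theorem_cballs[of K r ?B c])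
    show "0 < r i" if "i \<in> K" for i using that by (auto simp: K_def bad_def r_def)
    fix x d :: real assume x: "x \<in> ?B" and "d > 0"
    have "open (\<gamma> x)" "x \<in> \<gamma> x" using \<open>gauge \<gamma>\<close> by (auto simp: gauge_def)
    then obtain \<rho> where \<rho>: "\<rho> > 0" "ball x \<rho> \<subseteq> \<gamma> x" by (auto simp: open_contains_ball)
    then have "min \<rho> d > 0" using \<open>d > 0\<close> by simp
    with x obtain y where y: "bad x y" "\<bar>y - x\<bar> < min \<rho> d" unfolding bad_def by blast
    have "{min x y..max x y} \<subseteq> ball x \<rho>" using y(2) by (auto simp: dist_real_def min_def max_def split: if_splits)
    then have "(x, y) \<in> K" using x y(1) \<rho>(2) by (auto simp: K_def)
    moreover have "x \<in> cball (c (x, y)) (r (x, y))" unfolding cb by simp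
    moreover have "r (x, y) < d" using y(2) \<open>d > 0\<close> by (simp add: r_def)
    ultimately show "\<exists>i. i \<in> K \<and> x \<in> cball (c i) (r i) \<and> r i < d" by blast
  qed
  have fin: "(\<Sum>i\<in>G. \<bar>snd i - fst i\<bar>) \<le> e" if G: "G \<subseteq> C" "finite G" for G
  proof -
    define J where "J i = (fst i, cball (c i) (r i))" for i
    have GK: "fst i \<in> {a..b}" "bad (fst i) (snd i)" "cball (c i) (r i) \<subseteq> \<gamma> (fst i)" if "i \<in> G" for i
    proof -
      have "(fst i, snd i) \<in> K" using that G(1) C(2) by auto
      then show "fst i \<in> {a..b}" "bad (fst i) (snd i)" "cball (c i) (r i) \<subseteq> \<gamma> (fst i)"
        unfolding cb K_def by blast+
    qed
    have disj: "cball (c i) (r i) \<inter> cball (c j) (r j) = {}" if "i \<in> G" "j \<in> G" "i \<noteq> j" for i j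
      using C(3) that G(1) by (auto simp: pairwise_def disjnt_def)
    have ne: "fst i \<in> cball (c i) (r i)" for i unfolding cb by simp
    have inj: "inj_on J G"
    proof (rule inj_onI)
      fix i j assume ij: "i \<in> G" "j \<in> G" "J i = J j"
      then have "fst i \<in> cball (c i) (r i) \<inter> cball (c j) (r j)" using ne[of i] by (simp add: J_def)
      then show "i = j" using disj[OF ij(1,2)] by blast
    qed
    have "J ` G tagged_partial_division_of {a..b}"
      unfolding tagged_partial_division_of_def
    proof (intro conjI allI impI)
      show "finite (J ` G)" using G by simp
      fix x k assume "(x, k) \<in> J ` G"
      then obtain i where i: "i \<in> G" "x = fst i" "k = cball (c i) (r i)" by (auto simp: J_def)
      show "x \<in> k" "k \<subseteq> {a..b}" using ne[of i] GK[OF i(1)] i(2,3) by (auto simp: cb bad_def)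
      show "\<exists>u v. k = cbox u v" unfolding i(3) cb cbox_interval by blast
    next
      fix x k y l assume H: "(x, k) \<in> J ` G \<and> (y, l) \<in> J ` G \<and> (x, k) \<noteq> (y, l)"
      then obtain i j where "i \<in> G" "j \<in> G" "(x, k) = J i" "(y, l) = J j" "i \<noteq> j" by (metis imageE)
      then have "k \<inter> l = {}" using disj[of i j] by (simp add: J_def)
      then show "interior k \<inter> interior l = {}"
        using interior_subset[of k] interior_subset[of l] by blast
    qed
    moreover have "\<gamma> fine J ` G" using GK(3) by (auto simp: fine_def J_def)
    ultimately have "(\<Sum>(x, k)\<in>J ` G. norm (measure lborel k *\<^sub>R f x - integral k f)) < \<eta> * e" by (rule \<gamma>)
    moreover have "(\<Sum>(x, k)\<in>J ` G. norm (measure lborel k *\<^sub>R f x - integral k f))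
        = (\<Sum>i\<in>G. norm (measure lborel (cball (c i) (r i)) *\<^sub>R f (fst i) - integral (cball (c i) (r i)) f))"
      by (subst sum.reindex[OF inj]) (simp add: J_def)
    moreover have "\<eta> * \<bar>snd i - fst i\<bar>
        \<le> norm (measure lborel (cball (c i) (r i)) *\<^sub>R f (fst i) - integral (cball (c i) (r i)) f)"
      if "i \<in> G" for i
    proof -
      obtain x y where i: "i = (x, y)" by (cases i)
      have xy: "x \<in> {a..b}" "y \<in> {a..b}" "bad x y" using GK[OF that] by (auto simp: i bad_def)
      have *: "integral {u..v} f = F v - F u" if "a \<le> u" "u \<le> v" "v \<le> b" for u v
        unfolding F_def by (rule integral_adjacent[OF f that])
      show ?thesis
      proof (cases "x \<le> y")
        case True
        then show ?thesis using xy * [of x y] unfolding cb i bad_def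
          by (simp add: norm_minus_commute)
      next
        case False
        have "F y - F x - (y - x) *\<^sub>R f x = (x - y) *\<^sub>R f x - (F x - F y)" by (simp add: algebra_simps)
        then have "norm (F y - F x - (y - x) *\<^sub>R f x) = norm ((x - y) *\<^sub>R f x - (F x - F y))" by (rule arg_cong)
        then show ?thesis using False xy * [of y x] unfolding cb i bad_def
          by simp
      qed
    qed
    then have "(\<Sum>i\<in>G. \<eta> * \<bar>snd i - fst i\<bar>)
        \<le> (\<Sum>i\<in>G. norm (measure lborel (cball (c i) (r i)) *\<^sub>R f (fst i) - integral (cball (c i) (r i)) f))"
      by (rule sum_mono)
    ultimately have "\<eta> * (\<Sum>i\<in>G. \<bar>snd i - fst i\<bar>) < \<eta> * e"
      by (simp add: sum_distrib_left)
    then show ?thesis using \<open>\<eta> > 0\<close> by simp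
  qed
  have len: "measure lebesgue (cball (c i) (r i)) = \<bar>snd i - fst i\<bar>" for i
    unfolding cb by (simp add: min_def max_def)
  have bound: "measure lebesgue (\<Union>i\<in>G. cball (c i) (r i)) \<le> e" if "G \<subseteq> C" "finite G" for G
  proof -
    have "measure lebesgue (\<Union>i\<in>G. cball (c i) (r i)) \<le> (\<Sum>i\<in>G. measure lebesgue (cball (c i) (r i)))"
      using that by (intro measure_UNION_le) auto
    with fin[OF that] show ?thesis by (simp add: len)
  qed
  let ?U = "\<Union>i\<in>C. cball (c i) (r i)"
  have U: "?U \<in> lmeasurable" "measure lebesgue ?U \<le> e"
    using fmeasurable_UN_bound[OF C(1) _ bound] measure_UN_bound[OF C(1) _ bound] by auto
  show "\<exists>T. ?B \<subseteq> T \<and> T \<in> lmeasurable \<and> measure lebesgue T \<le> e"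
  proof (intro exI conjI)
    have neg: "?B - ?U \<in> lmeasurable" "measure lebesgue (?B - ?U) = 0"
      using C(4) by (auto simp: negligible_iff_measure)
    show "?B \<subseteq> ?U \<union> (?B - ?U)" by blast
    show "?U \<union> (?B - ?U) \<in> lmeasurable" using U(1) neg(1) by (rule fmeasurable.Un)
    show "measure lebesgue (?U \<union> (?B - ?U)) \<le> e"
      using measure_Un_le[OF fmeasurableD[OF U(1)] fmeasurableD[OF neg(1)]] neg(2) U(2) by linarith
  qed
qed

lemma indefinite_integral_has_vector_derivative_AE:
  fixes f :: "real \<Rightarrow> 'b::euclidean_space"
  assumes f: "f integrable_on {a..b}"
  obtains N where "negligible N" "\<And>t. t \<in> {a..b} - N \<Longrightarrow>
    ((\<lambda>t. integral {a..t} f) has_vector_derivative f t) (at t within {a..b})"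
proof -
  define F where "F t = integral {a..t} f" for t
  define B where "B \<eta> = {x\<in>{a..b}. \<forall>d>0. \<exists>y\<in>{a..b}. y \<noteq> x \<and> \<bar>y - x\<bar> < d \<and>
            norm (F y - F x - (y - x) *\<^sub>R f x) > \<eta> * \<bar>y - x\<bar>}" for \<eta>
  show ?thesis
  proof
    show "negligible (\<Union>n::nat. B (1 / Suc n))"
    proof (rule negligible_countable_Union)
      fix A assume "A \<in> range (\<lambda>n::nat. B (1 / Suc n))"
      then show "negligible A"
        using negligible_primitive_error[OF f, of "1 / Suc n" for n] unfolding B_def F_def by fastforce
    qed simp
    fix t assume t: "t \<in> {a..b} - (\<Union>n::nat. B (1 / Suc n))"
    have "\<exists>d>0. \<forall>y\<in>{a..b}. norm (y - t) < d \<longrightarrow> norm (F y - F t - (y - t) *\<^sub>R f t) \<le> e * norm (y - t)"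
      if e: "e > 0" for e
    proof -
      obtain n :: nat where n: "1 / Suc n < e" using nat_approx_posE[OF e] by metis
      from t have "t \<in> {a..b}" "t \<notin> B (1 / Suc n)" by blast+
      then have "\<exists>d>0. \<forall>y\<in>{a..b}. \<not> (y \<noteq> t \<and> \<bar>y - t\<bar> < d \<and>
          norm (F y - F t - (y - t) *\<^sub>R f t) > 1 / Suc n * \<bar>y - t\<bar>)"
        unfolding B_def by blast
      then obtain d where d: "d > 0" "\<And>y. y \<in> {a..b} \<Longrightarrow> y \<noteq> t \<Longrightarrow> \<bar>y - t\<bar> < d \<Longrightarrow>
          norm (F y - F t - (y - t) *\<^sub>R f t) \<le> 1 / Suc n * \<bar>y - t\<bar>"
        unfolding not_less[symmetric] by blast
      show ?thesis
      proof (intro exI conjI ballI impI)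
        fix y assume y: "y \<in> {a..b}" "norm (y - t) < d"
        show "norm (F y - F t - (y - t) *\<^sub>R f t) \<le> e * norm (y - t)"
        proof (cases "y = t")
          case False
          have "norm (F y - F t - (y - t) *\<^sub>R f t) \<le> 1 / Suc n * \<bar>y - t\<bar>"
            using d(2)[OF y(1) False] y(2) by simp
          also have "\<dots> \<le> e * \<bar>y - t\<bar>" using n by (intro mult_right_mono) auto
          finally show ?thesis by simp
        qed simp
      qed (use d in auto)
    qed
    then show "((\<lambda>t. integral {a..t} f) has_vector_derivative f t) (at t within {a..b})"
      unfolding has_vector_derivative_def has_derivative_within_alt F_def[symmetric]
      by (auto intro: bounded_linear_intros)
  qed
qed

section \<open>Primitives of absolutely integrable functions\<close>

text \<open>For \<open>a \<le> b\<close> this amounts to \<open>u\<close> being absolutely continuous with derivative \<open>g\<close> almost everywhere; the integral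
  form is the one that passes to limits.\<close>

definition primitive_on :: "real \<Rightarrow> real \<Rightarrow> (real \<Rightarrow> 'b::euclidean_space) \<Rightarrow> (real \<Rightarrow> 'b) \<Rightarrow> bool" where
  "primitive_on a b u g \<longleftrightarrow>
     g absolutely_integrable_on {a..b} \<and> (\<forall>t\<in>{a..b}. u t = u a + integral {a..t} g)"

lemma primitive_onD:
  assumes "primitive_on a b u g"
  shows "g absolutely_integrable_on {a..b}" "g integrable_on {a..b}"
  using assms set_lebesgue_integral_eq_integral(1) by (auto simp: primitive_on_def)

lemma primitive_on_eq: "primitive_on a b u g \<Longrightarrow> t \<in> {a..b} \<Longrightarrow> u t = u a + integral {a..t} g"
  unfolding primitive_on_def by blast

lemma primitive_on_increment:
  assumes u: "primitive_on a b u g" and "a \<le> r" "r \<le> t" "t \<le> b"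
  shows "u t - u r = integral {r..t} g"
proof -
  have "u t = u a + integral {a..t} g" "u r = u a + integral {a..r} g"
    using primitive_on_eq[OF u, of t] primitive_on_eq[OF u, of r] assms(2-4) by simp_all
  then show ?thesis
    unfolding integral_adjacent[OF primitive_onD(2)[OF u] assms(2-4)] by (metis add_diff_cancel_left)
qed

lemma primitive_on_increment_le:
  assumes u: "primitive_on a b u g" and "a \<le> r" "r \<le> t" "t \<le> b"
  shows "norm (u t - u r) \<le> integral {r..t} (\<lambda>\<tau>. norm (g \<tau>))"
proof -
  have "g absolutely_integrable_on {r..t}"
    using primitive_onD(1)[OF u] by (rule set_integrable_subset) (use assms in auto)
  then show ?thesis
    unfolding primitive_on_increment[OF assms]
    by (intro integral_norm_bound_integral) (auto simp: absolutely_integrable_on_def)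
qed

lemma primitive_on_abs_continuous_on:
  assumes u: "primitive_on a b u g"
  shows "abs_continuous_on a b u"
  by (rule abs_continuous_on_integral_bound[OF absolutely_integrable_norm[OF primitive_onD(1)[OF u], unfolded o_def]])
    (rule primitive_on_increment_le[OF u])

lemmas primitive_on_continuous_on = abs_continuous_on_imp_continuous_on[OF primitive_on_abs_continuous_on]

lemma primitive_on_has_vector_derivative_AE:
  assumes u: "primitive_on a b u g"
  obtains N where "negligible N"
    "\<And>t. t \<in> {a..b} - N \<Longrightarrow> (u has_vector_derivative g t) (at t within {a..b})"
proof -
  obtain N where N: "negligible N"
    "\<And>t. t \<in> {a..b} - N \<Longrightarrow> ((\<lambda>t. integral {a..t} g) has_vector_derivative g t) (at t within {a..b})"
    using indefinite_integral_has_vector_derivative_AE[OF primitive_onD(2)[OF u]] by metis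
  have "(u has_vector_derivative g t) (at t within {a..b})" if "t \<in> {a..b} - N" for t
  proof (rule has_vector_derivative_transform[where f = "\<lambda>t. u a + integral {a..t} g"])
    show "((\<lambda>t. u a + integral {a..t} g) has_vector_derivative g t) (at t within {a..b})"
      using has_vector_derivative_add[OF has_vector_derivative_const N(2)[OF that], of "u a"] by simp
    show "u r = u a + integral {a..r} g" if "r \<in> {a..b}" for r
      using primitive_on_eq[OF u that] .
  qed (use that in blast)
  with N(1) that show ?thesis by blast
qed

lemma primitive_onI:
  assumes ac: "abs_continuous_on a b u" and g: "g absolutely_integrable_on {a..b}" and N: "negligible N"
    and der: "\<And>t. t \<in> {a..b} - N \<Longrightarrow> (u has_vector_derivative g t) (at t within {a..b})"
  shows "primitive_on a b u g"
  unfolding primitive_on_def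
proof (rule conjI[OF g], rule ballI)
  fix t assume t: "t \<in> {a..b}"
  have "(g has_integral u t - u a) {a..t}"
  proof (rule abs_continuous_on_has_integral[OF abs_continuous_on_subset[OF ac] _ N])
    fix r assume "r \<in> {a..t} - N"
    then show "(u has_vector_derivative g r) (at r within {a..t})"
      using t by (intro has_vector_derivative_within_subset[OF der]) auto
  qed (use t in auto)
  then show "u t = u a + integral {a..t} g" by (simp add: integral_unique)
qed

text \<open>A function whose increments are controlled by those of two primitives is absolutely continuous, hence the
  primitive of its derivative.  Products and exponentials are instances.\<close>

lemma primitive_on_lipschitz_image:
  fixes u :: "real \<Rightarrow> 'b::euclidean_space" and v :: "real \<Rightarrow> 'c::euclidean_space"
    and w :: "real \<Rightarrow> 'd::euclidean_space"
  assumes u: "primitive_on a b u u'" and v: "primitive_on a b v v'"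
    and lip: "\<And>r t. a \<le> r \<Longrightarrow> r \<le> t \<Longrightarrow> t \<le> b \<Longrightarrow> norm (w t - w r) \<le> K * (norm (u t - u r) + norm (v t - v r))"
    and "K \<ge> 0"
    and w': "w' absolutely_integrable_on {a..b}"
    and der: "\<And>t. t \<in> {a..b} \<Longrightarrow> (u has_vector_derivative u' t) (at t within {a..b}) \<Longrightarrow>
      (v has_vector_derivative v' t) (at t within {a..b}) \<Longrightarrow> (w has_vector_derivative w' t) (at t within {a..b})"
  shows "primitive_on a b w w'"
proof -
  obtain N where N: "negligible N"
    "\<And>t. t \<in> {a..b} - N \<Longrightarrow> (u has_vector_derivative u' t) (at t within {a..b})"
    using primitive_on_has_vector_derivative_AE[OF u] by metis
  obtain M where M: "negligible M"
    "\<And>t. t \<in> {a..b} - M \<Longrightarrow> (v has_vector_derivative v' t) (at t within {a..b})"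
    using primitive_on_has_vector_derivative_AE[OF v] by metis
  define h where "h \<tau> = K * (norm (u' \<tau>) + norm (v' \<tau>))" for \<tau>
  have h: "h absolutely_integrable_on {a..b}"
    unfolding h_def using primitive_onD(1)[OF u] primitive_onD(1)[OF v]
    by (intro set_integrable_mult_right set_integral_add absolutely_integrable_norm[unfolded o_def]) auto
  have "abs_continuous_on a b w"
  proof (rule abs_continuous_on_integral_bound[OF h])
    fix r t assume rt: "a \<le> r" "r \<le> t" "t \<le> b"
    have sub: "{r..t} \<subseteq> {a..b}" using rt by auto
    have "u' absolutely_integrable_on {r..t}" "v' absolutely_integrable_on {r..t}"
      using set_integrable_subset[OF primitive_onD(1)[OF u] _ sub] set_integrable_subset[OF primitive_onD(1)[OF v] _ sub]
      by auto
    then have int: "(\<lambda>\<tau>. norm (u' \<tau>)) integrable_on {r..t}" "(\<lambda>\<tau>. norm (v' \<tau>)) integrable_on {r..t}"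
      by (auto simp: absolutely_integrable_on_def)
    have "norm (w t - w r) \<le> K * (integral {r..t} (\<lambda>\<tau>. norm (u' \<tau>)) + integral {r..t} (\<lambda>\<tau>. norm (v' \<tau>)))"
      by (rule order_trans[OF lip[OF rt]])
        (intro mult_left_mono add_mono primitive_on_increment_le[OF u rt] primitive_on_increment_le[OF v rt] \<open>K \<ge> 0\<close>)
    also have "\<dots> = integral {r..t} h"
      unfolding h_def using int by (simp add: Henstock_Kurzweil_Integration.integral_add)
    finally show "norm (w t - w r) \<le> integral {r..t} h" .
  qed
  then show ?thesis
    by (rule primitive_onI[OF _ w' negligible_Un[OF N(1) M(1)]]) (use N(2) M(2) der in auto)
qed

lemma absolutely_integrable_continuous_scaleR:
  fixes f :: "real \<Rightarrow> real" and g :: "real \<Rightarrow> 'b::euclidean_space"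
  assumes "continuous_on {a..b} f" "g absolutely_integrable_on {a..b}"
  shows "(\<lambda>x. f x *\<^sub>R g x) absolutely_integrable_on {a..b}"
  using assms
  by (intro absolutely_integrable_bounded_measurable_product[of "(*\<^sub>R)"])
    (auto simp: bilinear_conv_bounded_bilinear bounded_bilinear_scaleR
      intro!: continuous_imp_measurable_on_sets_lebesgue compact_imp_bounded compact_continuous_image)

lemma primitive_on_scaleR:
  fixes u :: "real \<Rightarrow> real" and v :: "real \<Rightarrow> 'b::euclidean_space"
  assumes u: "primitive_on a b u u'" and v: "primitive_on a b v v'"
  shows "primitive_on a b (\<lambda>t. u t *\<^sub>R v t) (\<lambda>t. u t *\<^sub>R v' t + u' t *\<^sub>R v t)"
proof -
  have cu: "continuous_on {a..b} u" and cv: "continuous_on {a..b} v"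
    using u v by (auto intro: primitive_on_continuous_on)
  obtain Bu where Bu: "\<And>t. t \<in> {a..b} \<Longrightarrow> norm (u t) \<le> Bu"
    using compact_imp_bounded[OF compact_continuous_image[OF cu compact_Icc]] unfolding bounded_iff by blast
  obtain Bv where Bv: "\<And>t. t \<in> {a..b} \<Longrightarrow> norm (v t) \<le> Bv"
    using compact_imp_bounded[OF compact_continuous_image[OF cv compact_Icc]] unfolding bounded_iff by blast
  show ?thesis
  proof (rule primitive_on_lipschitz_image[OF u v, where K = "max 0 (max Bu Bv)"])
    fix r t assume rt: "a \<le> r" "r \<le> t" "t \<le> b"
    have "u t *\<^sub>R v t - u r *\<^sub>R v r = (u t - u r) *\<^sub>R v t + u r *\<^sub>R (v t - v r)" by (simp add: algebra_simps)
    also have "norm \<dots> \<le> norm (u t - u r) * norm (v t) + norm (u r) * norm (v t - v r)"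
      by (metis norm_scaleR norm_triangle_ineq real_norm_def)
    also have "\<dots> \<le> norm (u t - u r) * max 0 (max Bu Bv) + max 0 (max Bu Bv) * norm (v t - v r)"
      using Bu[of r] Bv[of t] rt by (intro add_mono mult_left_mono mult_right_mono) auto
    finally show "norm (u t *\<^sub>R v t - u r *\<^sub>R v r) \<le> max 0 (max Bu Bv) * (norm (u t - u r) + norm (v t - v r))"
      by (simp add: algebra_simps)
  next
    have "(\<lambda>t. u' t *\<^sub>R v t) absolutely_integrable_on {a..b}"
    proof (rule absolutely_integrable_bounded_measurable_product[of "\<lambda>x y. y *\<^sub>R x"])
      show "bilinear (\<lambda>(x :: 'b) y. y *\<^sub>R x)" by (auto simp: bilinear_def linear_iff algebra_simps)
    qed (use cv primitive_onD(1)[OF u] in \<open>auto intro!: continuous_imp_measurable_on_sets_lebesgue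
        compact_imp_bounded compact_continuous_image\<close>)
    then show "(\<lambda>t. u t *\<^sub>R v' t + u' t *\<^sub>R v t) absolutely_integrable_on {a..b}"
      using absolutely_integrable_continuous_scaleR[OF cu primitive_onD(1)[OF v]] by (rule set_integral_add(1)[rotated])
  next
    fix t assume "(u has_vector_derivative u' t) (at t within {a..b})" "(v has_vector_derivative v' t) (at t within {a..b})"
    then show "((\<lambda>t. u t *\<^sub>R v t) has_vector_derivative u t *\<^sub>R v' t + u' t *\<^sub>R v t) (at t within {a..b})"
      by (intro has_vector_derivative_scaleR) (simp_all add: has_real_derivative_iff_has_vector_derivative)
  qed simp
qed

lemma primitive_on_exp:
  fixes u :: "real \<Rightarrow> real"
  assumes u: "primitive_on a b u u'"
  shows "primitive_on a b (\<lambda>t. exp (u t)) (\<lambda>t. exp (u t) * u' t)"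
proof -
  have cu: "continuous_on {a..b} u" using u by (rule primitive_on_continuous_on)
  obtain B where B: "\<And>t. t \<in> {a..b} \<Longrightarrow> norm (u t) \<le> B"
    using compact_imp_bounded[OF compact_continuous_image[OF cu compact_Icc]] unfolding bounded_iff by blast
  show ?thesis
  proof (rule primitive_on_lipschitz_image[OF u u, where K = "exp B"])
    fix r t assume rt: "a \<le> r" "r \<le> t" "t \<le> b"
    have "\<bar>exp y - exp x\<bar> \<le> exp B * \<bar>y - x\<bar>" if "x \<le> B" "y \<le> B" for x y :: real
    proof -
      have 1: "exp y - exp x \<le> exp y * (y - x)" for x y :: real
      proof -
        have "exp y * (1 + (x - y)) \<le> exp y * exp (x - y)" by (intro mult_left_mono exp_ge_add_one_self) auto
        also have "\<dots> = exp x" by (simp add: exp_diff)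
        finally show ?thesis by (simp add: algebra_simps)
      qed
      show ?thesis
      proof (cases "x \<le> y")
        case True
        have "exp y * (y - x) \<le> exp B * (y - x)" using True that by (intro mult_right_mono) auto
        with True 1[where y = y and x = x] show ?thesis by simp
      next
        case False
        have "exp x * (x - y) \<le> exp B * (x - y)" using False that by (intro mult_right_mono) auto
        with 1[where y = x and x = y] have "exp x - exp y \<le> exp B * (x - y)" by linarith
        then show ?thesis using False by simp
      qed
    qed
    then have "\<bar>exp (u t) - exp (u r)\<bar> \<le> exp B * \<bar>u t - u r\<bar>" using B[of t] B[of r] rt by auto
    also have "\<dots> \<le> exp B * (norm (u t - u r) + norm (u t - u r))" by (intro mult_left_mono) auto
    finally show "norm (exp (u t) - exp (u r)) \<le> exp B * (norm (u t - u r) + norm (u t - u r))" by simp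
  next
    show "(\<lambda>t. exp (u t) * u' t) absolutely_integrable_on {a..b}"
      using absolutely_integrable_continuous_scaleR[of a b "\<lambda>t. exp (u t)" u'] primitive_onD(1)[OF u]
      by (simp add: continuous_on_exp cu)
  next
    fix t assume "(u has_vector_derivative u' t) (at t within {a..b})"
    then show "((\<lambda>t. exp (u t)) has_vector_derivative exp (u t) * u' t) (at t within {a..b})"
      unfolding has_real_derivative_iff_has_vector_derivative[symmetric]
      by (auto intro!: derivative_eq_intros)
  qed simp
qed

lemma primitive_on_integral:
  "g absolutely_integrable_on {a..b} \<Longrightarrow> primitive_on a b (\<lambda>t. integral {a..t} g) g"
  by (auto simp: primitive_on_def)

lemma primitive_on_cong:
  assumes "primitive_on a b u g" "\<And>t. t \<in> {a..b} \<Longrightarrow> v t = u t"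
  shows "primitive_on a b v g"
  unfolding primitive_on_def
proof (rule conjI[OF primitive_onD(1)[OF assms(1)]], rule ballI)
  fix t assume t: "t \<in> {a..b}"
  then have "a \<in> {a..b}" by simp
  then show "v t = v a + integral {a..t} g" using primitive_on_eq[OF assms(1) t] assms(2) t by metis
qed

lemma primitive_on_const: "primitive_on a b (\<lambda>_. v) (\<lambda>_. 0)"
  by (simp add: primitive_on_def)

lemma primitive_on_diff:
  assumes u: "primitive_on a b u u'" and v: "primitive_on a b v v'"
  shows "primitive_on a b (\<lambda>t. u t - v t) (\<lambda>t. u' t - v' t)"
  unfolding primitive_on_def
proof (rule conjI, rule set_integral_diff(1)[OF primitive_onD(1)[OF u] primitive_onD(1)[OF v]], rule ballI)
  fix t assume t: "t \<in> {a..b}"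
  have "integral {a..t} (\<lambda>t. u' t - v' t) = integral {a..t} u' - integral {a..t} v'"
    using t integrable_subinterval_real[OF primitive_onD(2)[OF u]] integrable_subinterval_real[OF primitive_onD(2)[OF v]]
    by (intro Henstock_Kurzweil_Integration.integral_diff) auto
  then show "u t - v t = u a - v a + integral {a..t} (\<lambda>t. u' t - v' t)"
    using primitive_on_eq[OF u t] primitive_on_eq[OF v t] by (metis add_diff_add)
qed

lemma primitive_on_bounded_linear:
  assumes u: "primitive_on a b u u'" and h: "bounded_linear h"
  shows "primitive_on a b (\<lambda>t. h (u t)) (\<lambda>t. h (u' t))"
  unfolding primitive_on_def
proof (rule conjI, rule absolutely_integrable_linear[OF primitive_onD(1)[OF u] h, unfolded o_def], rule ballI)
  fix t assume t: "t \<in> {a..b}"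
  have "integral {a..t} (\<lambda>t. h (u' t)) = h (integral {a..t} u')"
    using t integrable_subinterval_real[OF primitive_onD(2)[OF u], of a t] integral_linear[OF _ h, of u' "{a..t}"]
    by (auto simp: o_def)
  then show "h (u t) = h (u a) + integral {a..t} (\<lambda>t. h (u' t))"
    using primitive_on_eq[OF u t] linear_simps(1)[OF h] by metis
qed

lemma absolutely_integrable_bound_negligible:
  fixes f :: "'a::euclidean_space \<Rightarrow> 'b::euclidean_space"
  assumes f: "f integrable_on S" and g: "g integrable_on S" and N: "negligible N"
    and le: "\<And>x. x \<in> S - N \<Longrightarrow> norm (f x) \<le> g x"
  shows "f absolutely_integrable_on S"
proof -
  define f' where "f' x = (if x \<in> N then 0 else f x)" for x
  define g' where "g' x = (if x \<in> N then 0 else g x)" for x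
  have "f' absolutely_integrable_on S"
  proof (rule absolutely_integrable_integrable_bound)
    show "f' integrable_on S" by (rule integrable_spike[OF f N]) (auto simp: f'_def)
    show "g' integrable_on S" by (rule integrable_spike[OF g N]) (auto simp: g'_def)
    show "norm (f' x) \<le> g' x" if "x \<in> S" for x using le[of x] that by (auto simp: f'_def g'_def)
  qed
  then show ?thesis
    by (rule absolutely_integrable_spike[OF _ N]) (auto simp: f'_def)
qed

lemma absolutely_integrable_abs:
  fixes h :: "real \<Rightarrow> real"
  shows "h absolutely_integrable_on S \<Longrightarrow> (\<lambda>t. \<bar>h t\<bar>) absolutely_integrable_on S"
  by (drule absolutely_integrable_norm) (simp add: o_def)

lemma integral_mono_negligible:
  fixes f g :: "real \<Rightarrow> real"
  assumes "f integrable_on S" "g integrable_on S" and N: "negligible N" and le: "\<And>x. x \<in> S - N \<Longrightarrow> f x \<le> g x"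
  shows "integral S f \<le> integral S g"
proof -
  have "(\<lambda>x. if x \<in> N then g x else f x) integrable_on S"
    by (rule integrable_spike[OF assms(1) N]) auto
  then have "integral S (\<lambda>x. if x \<in> N then g x else f x) \<le> integral S g"
    using assms(2) by (rule integral_le) (use le in auto)
  moreover have "integral S f = integral S (\<lambda>x. if x \<in> N then g x else f x)"
    by (rule integral_spike[OF N]) auto
  ultimately show ?thesis by simp
qed

text \<open>Multiplication by \<open>exp (\<integral>\<alpha>)\<close> turns the differential inequality into monotonicity of the product.\<close>

lemma gronwall_differential:
  fixes z :: "real \<Rightarrow> real"
  assumes z: "primitive_on a b z z'" and \<alpha>: "\<alpha> absolutely_integrable_on {a..b}" and N: "negligible N"
    and ineq: "\<And>t. t \<in> {a..b} - N \<Longrightarrow> z' t \<ge> - \<alpha> t * z t" and t: "t \<in> {a..b}"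
  shows "z a \<le> exp (integral {a..t} \<alpha>) * z t"
proof -
  define P where "P t = integral {a..t} \<alpha>" for t
  have P: "primitive_on a b P \<alpha>" unfolding P_def by (rule primitive_on_integral[OF \<alpha>])
  have p: "primitive_on a b (\<lambda>t. exp (P t) *\<^sub>R z t) (\<lambda>t. exp (P t) *\<^sub>R z' t + (exp (P t) * \<alpha> t) *\<^sub>R z t)"
    by (rule primitive_on_scaleR[OF primitive_on_exp[OF P] z])
  have "0 \<le> integral {a..t} (\<lambda>t. exp (P t) *\<^sub>R z' t + (exp (P t) * \<alpha> t) *\<^sub>R z t)"
  proof -
    have "integral {a..t} (\<lambda>_. 0 :: real) \<le> integral {a..t} (\<lambda>t. exp (P t) *\<^sub>R z' t + (exp (P t) * \<alpha> t) *\<^sub>R z t)"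
    proof (rule integral_mono_negligible[OF _ _ N])
      show "0 \<le> exp (P x) *\<^sub>R z' x + (exp (P x) * \<alpha> x) *\<^sub>R z x" if "x \<in> {a..t} - N" for x
      proof -
        have "0 \<le> exp (P x) * (z' x + \<alpha> x * z x)" using ineq[of x] that t by (intro mult_nonneg_nonneg) auto
        then show ?thesis by (simp add: algebra_simps)
      qed
      show "(\<lambda>t. exp (P t) *\<^sub>R z' t + (exp (P t) * \<alpha> t) *\<^sub>R z t) integrable_on {a..t}"
        using integrable_subinterval_real[OF primitive_onD(2)[OF p]] t by auto
    qed (rule integrable_0)
    then show ?thesis by simp
  qed
  then have "exp (P a) *\<^sub>R z a \<le> exp (P t) *\<^sub>R z t"
    using primitive_on_increment[OF p order.refl, of t] t by auto
  then show ?thesis by (simp add: P_def)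
qed

text \<open>The negative of the right-hand side is a primitive that satisfies the differential form with \<open>- \<alpha>\<close>.\<close>

lemma gronwall_integral:
  fixes u \<alpha> :: "real \<Rightarrow> real"
  assumes cu: "continuous_on {a..b} u" and \<alpha>: "\<alpha> absolutely_integrable_on {a..b}"
    and N: "negligible N" and nn: "\<And>t. t \<in> {a..b} - N \<Longrightarrow> \<alpha> t \<ge> 0"
    and ineq: "\<And>t. t \<in> {a..b} \<Longrightarrow> u t \<le> A + integral {a..t} (\<lambda>\<tau>. u \<tau> * \<alpha> \<tau>)" and t: "t \<in> {a..b}"
  shows "u t \<le> A * exp (integral {a..t} \<alpha>)"
proof -
  define R where "R t = A + integral {a..t} (\<lambda>\<tau>. u \<tau> * \<alpha> \<tau>)" for t
  have int: "(\<lambda>\<tau>. u \<tau> * \<alpha> \<tau>) absolutely_integrable_on {a..b}"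
    using absolutely_integrable_continuous_scaleR[OF cu \<alpha>] by simp
  have "primitive_on a b (\<lambda>t. - R t) (\<lambda>\<tau>. - (u \<tau> * \<alpha> \<tau>))"
    unfolding primitive_on_def
    using absolutely_integrable_linear[OF int bounded_linear_minus[OF bounded_linear_ident]]
    by (auto simp: R_def o_def)
  moreover have "(\<lambda>t. - \<alpha> t) absolutely_integrable_on {a..b}"
    using absolutely_integrable_linear[OF \<alpha> bounded_linear_minus[OF bounded_linear_ident]] by (simp add: o_def)
  moreover have "- (u \<tau> * \<alpha> \<tau>) \<ge> - (- \<alpha> \<tau>) * (- R \<tau>)" if "\<tau> \<in> {a..b} - N" for \<tau>
  proof -
    have "u \<tau> * \<alpha> \<tau> \<le> R \<tau> * \<alpha> \<tau>"
      unfolding R_def using that by (intro mult_right_mono ineq nn) auto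
    then show ?thesis by (simp add: mult.commute)
  qed
  ultimately have "- R a \<le> exp (integral {a..t} (\<lambda>t. - \<alpha> t)) * (- R t)"
    using t N by (intro gronwall_differential)
  moreover have "R a = A" by (simp add: R_def)
  ultimately have "exp (- integral {a..t} \<alpha>) * R t \<le> A" by simp
  then have "R t \<le> A * exp (integral {a..t} \<alpha>)" by (simp add: exp_minus field_simps)
  then show ?thesis using ineq[OF t] by (simp add: R_def)
qed

lemma nn_set_integral_eq_integral:
  fixes h :: "real \<Rightarrow> real"
  assumes h: "h absolutely_integrable_on S" and nn: "\<And>x. x \<in> S \<Longrightarrow> 0 \<le> h x"
  shows "(\<integral>\<^sup>+x\<in>S. ennreal (h x) \<partial>lebesgue) = ennreal (integral S h)"
proof -
  have "(\<integral>\<^sup>+x\<in>S. ennreal (h x) \<partial>lebesgue) = (\<integral>\<^sup>+x. ennreal (indicator S x *\<^sub>R h x) \<partial>lebesgue)"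
    by (intro nn_integral_cong) (simp add: indicator_def)
  also have "\<dots> = ennreal (LINT x|lebesgue. indicator S x *\<^sub>R h x)"
    using h nn by (intro nn_integral_eq_integral) (auto simp: set_integrable_def indicator_def)
  also have "(LINT x|lebesgue. indicator S x *\<^sub>R h x) = integral S h"
    using set_lebesgue_integral_eq_integral(2)[OF h] by (simp add: set_lebesgue_integral_def)
  finally show ?thesis .
qed

lemma primitive_on_dist_le:
  fixes u v :: "real \<Rightarrow> 'b::euclidean_space"
  assumes u: "primitive_on a b u g" and v: "primitive_on a b v h" and init: "u a = v a" and t: "t \<in> {a..b}"
  shows "ennreal (norm (u t - v t)) \<le> (\<integral>\<^sup>+\<tau>\<in>{a..b}. ennreal (norm (g \<tau> - h \<tau>)) \<partial>lebesgue)"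
proof -
  note d = primitive_on_diff[OF u v]
  have int: "(\<lambda>\<tau>. norm (g \<tau> - h \<tau>)) absolutely_integrable_on {a..b}"
    using absolutely_integrable_norm[OF primitive_onD(1)[OF d]] by (simp add: o_def)
  then have int': "(\<lambda>\<tau>. norm (g \<tau> - h \<tau>)) integrable_on {a..b}" by (rule set_lebesgue_integral_eq_integral(1))
  have "norm (u t - v t) \<le> integral {a..t} (\<lambda>\<tau>. norm (g \<tau> - h \<tau>))"
    using primitive_on_increment_le[OF d order.refl, of t] t init by simp
  also have "\<dots> \<le> integral {a..b} (\<lambda>\<tau>. norm (g \<tau> - h \<tau>))"
    by (rule integral_subset_le[OF _ integrable_subinterval_real[OF int'] int']) (use t in auto)
  finally show ?thesis
    by (subst nn_set_integral_eq_integral[OF int]) (auto intro: ennreal_leI)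
qed

section \<open>The flow of a Lipschitz field that is increasing up to a linear term\<close>

text \<open>\<open>X t x\<close> is the position at time \<open>t\<close> of the trajectory that starts at \<open>x\<close> at time \<open>s\<close>.  The bounds \<open>a\<close> and \<open>c\<close> will be
  common to a family of fields while \<open>L\<close> will not, so only estimates in terms of \<open>a\<close> and \<open>c\<close> survive the limit.\<close>

locale monotone_lipschitz_flow =
  fixes s T :: real and f :: "real \<Rightarrow> real^'d \<Rightarrow> real^'d" and a c L :: "real \<Rightarrow> real" and N :: "real set"
    and X :: "real \<Rightarrow> real^'d \<Rightarrow> real^'d"
  assumes sT: "s \<le> T" and N: "negligible N"
    and a: "a absolutely_integrable_on {s..T}" and a_nonneg: "\<And>t. t \<in> {s..T} - N \<Longrightarrow> 0 \<le> a t"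
    and c: "c absolutely_integrable_on {s..T}" and c_nonneg: "\<And>t. t \<in> {s..T} - N \<Longrightarrow> 0 \<le> c t"
    and L: "L absolutely_integrable_on {s..T}" and L_nonneg: "\<And>t. t \<in> {s..T} - N \<Longrightarrow> 0 \<le> L t"
    and growth: "\<And>t y. t \<in> {s..T} - N \<Longrightarrow> norm (f t y) \<le> a t * (1 + norm y)"
    and mono: "\<And>t. t \<in> {s..T} - N \<Longrightarrow> mono (\<lambda>x. f t x + c t *\<^sub>R x)"
    and lipschitz: "\<And>t x y. t \<in> {s..T} - N \<Longrightarrow> norm (f t x - f t y) \<le> L t * norm (x - y)"
    and ac: "\<And>x. abs_continuous_on s T (\<lambda>t. X t x)" and init: "\<And>x. X s x = x"
    and ode: "\<And>x. \<exists>M. negligible M \<and> (\<forall>t\<in>{s..T} - M.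
      ((\<lambda>t. X t x) has_vector_derivative f t (X t x)) (at t within {s..T}))"
begin

lemma continuous_time: "continuous_on {s..T} (\<lambda>t. X t x)"
  by (rule abs_continuous_on_imp_continuous_on[OF ac])

lemma primitive: "primitive_on s T (\<lambda>t. X t x) (\<lambda>t. f t (X t x))"
proof -
  obtain M where M: "negligible M"
    "\<And>t. t \<in> {s..T} - M \<Longrightarrow> ((\<lambda>t. X t x) has_vector_derivative f t (X t x)) (at t within {s..T})"
    using ode[of x] by blast
  obtain B where B: "\<And>t. t \<in> {s..T} \<Longrightarrow> norm (X t x) \<le> B"
    using compact_imp_bounded[OF compact_continuous_image[OF continuous_time compact_Icc]]
    unfolding bounded_iff by blast
  show ?thesis
  proof (rule primitive_onI[OF ac _ M])
    show "(\<lambda>t. f t (X t x)) absolutely_integrable_on {s..T}"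
    proof (rule absolutely_integrable_bound_negligible[OF _ _ N])
      show "(\<lambda>t. f t (X t x)) integrable_on {s..T}"
        using abs_continuous_on_has_integral[OF ac sT M] by blast
      show "(\<lambda>t. (1 + B) * a t) integrable_on {s..T}"
        by (rule integrable_on_mult_right[OF set_lebesgue_integral_eq_integral(1)[OF a]])
      show "norm (f t (X t x)) \<le> (1 + B) * a t" if "t \<in> {s..T} - N" for t
      proof -
        have "a t * (1 + norm (X t x)) \<le> a t * (1 + B)"
          using B[of t] that a_nonneg[OF that] by (intro mult_left_mono) auto
        then show ?thesis using growth[OF that, of "X t x"] by (simp add: mult.commute)
      qed
    qed
  qed
qed

lemma integral_nonneg_mono:
  fixes h :: "real \<Rightarrow> real"
  assumes "h absolutely_integrable_on {s..T}" "\<And>t. t \<in> {s..T} - N \<Longrightarrow> 0 \<le> h t"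
    and "s \<le> r" "r \<le> t" "t \<le> T"
  shows "integral {r..t} h \<le> integral {s..T} h" "0 \<le> integral {r..t} h"
proof -
  define h' where "h' t = (if t \<in> N then 0 else h t)" for t
  have eq: "integral A h = integral A h'" for A
    by (rule integral_spike[OF N]) (auto simp: h'_def)
  have "h integrable_on {s..T}" by (rule set_lebesgue_integral_eq_integral(1)[OF assms(1)])
  then have int: "h' integrable_on {s..T}" by (rule integrable_spike[OF _ N]) (auto simp: h'_def)
  then have int': "h' integrable_on {r..t}"
    by (rule integrable_subinterval_real) (use assms in auto)
  have nn: "h' \<tau> \<ge> 0" if "\<tau> \<in> {s..T}" for \<tau> using assms(2) that by (auto simp: h'_def)
  show "integral {r..t} h \<le> integral {s..T} h"
    unfolding eq by (rule integral_subset_le[OF _ int' int]) (use assms nn in auto)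
  show "0 \<le> integral {r..t} h"
    unfolding eq by (rule integral_nonneg[OF int']) (use assms nn in auto)
qed

definition growth_const :: real where "growth_const = exp (integral {s..T} a)"
definition expansion_const :: real where "expansion_const = exp (- integral {s..T} c)"

lemma growth_bound:
  assumes t: "t \<in> {s..T}"
  shows "1 + norm (X t x) \<le> growth_const * (1 + norm x)"
proof -
  have "1 + norm (X t x) \<le> (1 + norm x) * exp (integral {s..t} a)"
  proof (rule gronwall_integral[OF _ a N a_nonneg _ t])
    show "continuous_on {s..T} (\<lambda>t. 1 + norm (X t x))"
      by (intro continuous_intros continuous_time)
    then have int: "(\<lambda>t. (1 + norm (X t x)) * a t) absolutely_integrable_on {s..T}"
      using absolutely_integrable_continuous_scaleR[OF _ a] by auto
    fix t assume t: "t \<in> {s..T}"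
    have "norm (X t x - x) \<le> integral {s..t} (\<lambda>\<tau>. norm (f \<tau> (X \<tau> x)))"
      using primitive_on_increment_le[OF primitive, of s t x] t by (simp add: init)
    also have "\<dots> \<le> integral {s..t} (\<lambda>\<tau>. (1 + norm (X \<tau> x)) * a \<tau>)"
    proof (rule integral_mono_negligible[OF _ _ N])
      have "(\<lambda>\<tau>. f \<tau> (X \<tau> x)) absolutely_integrable_on {s..t}"
        by (rule set_integrable_subset[OF primitive_onD(1)[OF primitive]]) (use t in auto)
      then show "(\<lambda>\<tau>. norm (f \<tau> (X \<tau> x))) integrable_on {s..t}" by (auto simp: absolutely_integrable_on_def)
      show "(\<lambda>t. (1 + norm (X t x)) * a t) integrable_on {s..t}"
        using int t set_lebesgue_integral_eq_integral(1)[OF int] by (auto intro: integrable_subinterval_real)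
    qed (use growth t in \<open>auto simp: mult.commute\<close>)
    finally show "1 + norm (X t x) \<le> 1 + norm x + integral {s..t} (\<lambda>\<tau>. (1 + norm (X \<tau> x)) * a \<tau>)"
      using norm_triangle_ineq2[of "X t x" x] by linarith
  qed
  also have "\<dots> \<le> (1 + norm x) * growth_const"
    unfolding growth_const_def
    using integral_nonneg_mono(1)[OF a a_nonneg, of s t] t by (intro mult_left_mono) auto
  finally show ?thesis by (simp add: mult.commute)
qed

lemma growth_const_ge_1: "growth_const \<ge> 1"
  using integral_nonneg_mono(2)[OF a a_nonneg, of s T] sT by (simp add: growth_const_def)

lemma speed_bound:
  assumes t: "t \<in> {s..T} - N"
  shows "norm (f t (X t x)) \<le> growth_const * (1 + norm x) * a t"
proof -
  have "norm (f t (X t x)) \<le> a t * (1 + norm (X t x))" by (rule growth[OF t])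
  also have "\<dots> \<le> a t * (growth_const * (1 + norm x))"
    using growth_bound[of t x] a_nonneg[OF t] t by (intro mult_left_mono) auto
  finally show ?thesis by (simp add: mult_ac)
qed

lemma time_modulus:
  assumes "s \<le> r" "r \<le> t" "t \<le> T"
  shows "norm (X t x - X r x) \<le> growth_const * (1 + norm x) * integral {r..t} a"
proof -
  have a': "a integrable_on {s..T}" by (rule set_lebesgue_integral_eq_integral(1)[OF a])
  have "norm (X t x - X r x) \<le> integral {r..t} (\<lambda>\<tau>. norm (f \<tau> (X \<tau> x)))"
    by (rule primitive_on_increment_le[OF primitive assms])
  also have "\<dots> \<le> integral {r..t} (\<lambda>\<tau>. growth_const * (1 + norm x) * a \<tau>)"
  proof (rule integral_mono_negligible[OF _ _ N])
    have "(\<lambda>\<tau>. f \<tau> (X \<tau> x)) absolutely_integrable_on {r..t}"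
      by (rule set_integrable_subset[OF primitive_onD(1)[OF primitive]]) (use assms in auto)
    then show "(\<lambda>\<tau>. norm (f \<tau> (X \<tau> x))) integrable_on {r..t}" by (auto simp: absolutely_integrable_on_def)
    show "(\<lambda>\<tau>. growth_const * (1 + norm x) * a \<tau>) integrable_on {r..t}"
      using assms by (intro integrable_on_mult_right integrable_subinterval_real[OF a']) auto
  qed (use speed_bound assms in auto)
  finally show ?thesis by simp
qed

lemma space_lipschitz:
  assumes t: "t \<in> {s..T}"
  shows "norm (X t x - X t y) \<le> exp (integral {s..T} L) * norm (x - y)"
proof -
  have "norm (X t x - X t y) \<le> norm (x - y) * exp (integral {s..t} L)"
  proof (rule gronwall_integral[OF _ L N L_nonneg _ t])
    show "continuous_on {s..T} (\<lambda>t. norm (X t x - X t y))"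
      by (intro continuous_intros continuous_time)
    then have int: "(\<lambda>t. norm (X t x - X t y) * L t) absolutely_integrable_on {s..T}"
      using absolutely_integrable_continuous_scaleR[OF _ L] by auto
    fix t assume t: "t \<in> {s..T}"
    note prim = primitive_on_diff[OF primitive[of x] primitive[of y]]
    have "norm ((X t x - X t y) - (x - y)) \<le> integral {s..t} (\<lambda>\<tau>. norm (f \<tau> (X \<tau> x) - f \<tau> (X \<tau> y)))"
      using primitive_on_increment_le[OF prim, of s t] t by (simp add: init)
    also have "\<dots> \<le> integral {s..t} (\<lambda>\<tau>. norm (X \<tau> x - X \<tau> y) * L \<tau>)"
    proof (rule integral_mono_negligible[OF _ _ N])
      have "(\<lambda>\<tau>. f \<tau> (X \<tau> x) - f \<tau> (X \<tau> y)) absolutely_integrable_on {s..t}"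
        by (rule set_integrable_subset[OF primitive_onD(1)[OF prim]]) (use t in auto)
      then show "(\<lambda>\<tau>. norm (f \<tau> (X \<tau> x) - f \<tau> (X \<tau> y))) integrable_on {s..t}"
        by (auto simp: absolutely_integrable_on_def)
      show "(\<lambda>\<tau>. norm (X \<tau> x - X \<tau> y) * L \<tau>) integrable_on {s..t}"
        using t set_lebesgue_integral_eq_integral(1)[OF int] by (auto intro: integrable_subinterval_real)
    qed (use lipschitz t in \<open>auto simp: mult.commute\<close>)
    finally show "norm (X t x - X t y) \<le> norm (x - y) + integral {s..t} (\<lambda>\<tau>. norm (X \<tau> x - X \<tau> y) * L \<tau>)"
      using norm_triangle_ineq2[of "X t x - X t y" "x - y"] by linarith
  qed
  also have "\<dots> \<le> norm (x - y) * exp (integral {s..T} L)"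
    using integral_nonneg_mono(1)[OF L L_nonneg, of s t] t by (intro mult_left_mono) auto
  finally show ?thesis by (simp add: mult.commute)
qed

text \<open>The negative parts of \<open>X t y - X t x\<close> obey a Gronwall inequality: where the \<open>i\<close>-th component is
  negative, \<open>X t x\<close> and the maximum of the two points share their \<open>i\<close>-th component, so monotonicity
  compares the fields at these points, and the maximum is as far from \<open>X t y\<close> as the negative parts allow.\<close>

lemma order_preserving:
  assumes xy: "x \<le> y" and t: "t \<in> {s..T}"
  shows "X t x \<le> X t y"
proof -
  define z where "z t i = X t y $ i - X t x $ i" for t i
  define w where "w t = (\<Sum>i\<in>UNIV. max 0 (- z t i))" for t
  define g where "g t i = f t (X t y) $ i - f t (X t x) $ i" for t i
  have prim: "primitive_on s T (\<lambda>t. z t i) (\<lambda>t. g t i)" for i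
    unfolding z_def g_def
    by (intro primitive_on_diff primitive_on_bounded_linear[OF primitive] bounded_linear_vec_nth)
  have cz: "continuous_on {s..T} (\<lambda>t. z t i)" for i
    by (rule primitive_on_continuous_on[OF prim])
  have cw: "continuous_on {s..T} w" unfolding w_def by (intro continuous_intros cz)
  have w_nonneg: "0 \<le> w t" for t unfolding w_def by (intro sum_nonneg) auto
  have g_ge: "g t i \<ge> - (w t * L t)" if t: "t \<in> {s..T} - N" and neg: "z t i \<le> 0" for t i
  proof -
    define m where "m = (\<chi> j. max (X t y $ j) (X t x $ j))"
    have "f t (X t x) $ i + c t * X t x $ i \<le> f t m $ i + c t * m $ i"
      using monoD[OF mono[OF t], of "X t x" m] by (simp add: less_eq_vec_def m_def)
    moreover have "m $ i = X t x $ i" using neg by (simp add: m_def z_def)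
    ultimately have "f t (X t x) $ i \<le> f t m $ i" by simp
    moreover have "f t m $ i - f t (X t y) $ i \<le> w t * L t"
    proof -
      have "f t m $ i - f t (X t y) $ i \<le> norm (f t m - f t (X t y))"
        using component_le_norm_cart[of "f t m - f t (X t y)" i] by simp
      also have "\<dots> \<le> L t * norm (m - X t y)" by (rule lipschitz[OF t])
      also have "\<dots> \<le> L t * w t"
      proof (rule mult_left_mono[OF _ L_nonneg[OF t]])
        have "norm (m - X t y) \<le> (\<Sum>j\<in>UNIV. \<bar>(m - X t y) $ j\<bar>)" by (rule norm_le_l1_cart)
        also have "\<dots> = w t" unfolding w_def by (intro sum.cong) (auto simp: m_def z_def)
        finally show "norm (m - X t y) \<le> w t" .
      qed
      finally show ?thesis by (simp add: mult.commute)
    qed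
    ultimately show ?thesis by (simp add: g_def)
  qed
  have wL: "(\<lambda>t. w t * L t) absolutely_integrable_on {s..T}"
    using absolutely_integrable_continuous_scaleR[OF cw L] by simp
  then have wL': "(\<lambda>t. w t * L t) integrable_on {s..T}" by (rule set_lebesgue_integral_eq_integral(1))
  have wL_nonneg: "0 \<le> w t * L t" if "t \<in> {s..T} - N" for t using w_nonneg L_nonneg[OF that] by simp
  have neg_part: "max 0 (- z t i) \<le> integral {s..t} (\<lambda>\<tau>. w \<tau> * L \<tau>)" if t: "t \<in> {s..T}" for t i
  proof (cases "z t i \<ge> 0")
    case True
    then show ?thesis using integral_nonneg_mono(2)[OF wL wL_nonneg, of s t] t by auto
  next
    case False
    \<comment> \<open>The negative part has grown since the last time \<open>r\<close> at which the component was nonnegative.\<close>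
    define S where "S = {\<tau> \<in> {s..t}. z \<tau> i \<ge> 0}"
    have "continuous_on {s..t} (\<lambda>\<tau>. z \<tau> i)" by (rule continuous_on_subset[OF cz]) (use t in auto)
    then have "closed S" unfolding S_def
      using continuous_closed_preimage[of "{s..t}" "\<lambda>\<tau>. z \<tau> i" "{0..}"] by (simp add: vimage_def Int_def)
    moreover have "bounded S" unfolding S_def by (rule bounded_subset[of "{s..t}"]) auto
    ultimately have "compact S" by (simp add: compact_eq_bounded_closed)
    moreover have "s \<in> S" using xy t by (auto simp: S_def z_def init less_eq_vec_def)
    ultimately obtain r where r: "r \<in> S" "\<And>\<tau>. \<tau> \<in> S \<Longrightarrow> \<tau> \<le> r"
      using compact_attains_sup[of S] by blast
    have rt: "s \<le> r" "r \<le> t" "z r i \<ge> 0" using r(1) by (auto simp: S_def)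
    have after: "z \<tau> i < 0" if "r < \<tau>" "\<tau> \<le> t" for \<tau> using r(2)[of \<tau>] that rt by (force simp: S_def)
    have "- integral {r..t} (\<lambda>\<tau>. g \<tau> i) = integral {r..t} (\<lambda>\<tau>. - g \<tau> i)" by simp
    also have "\<dots> \<le> integral {r..t} (\<lambda>\<tau>. w \<tau> * L \<tau>)"
    proof (rule integral_mono_negligible[where N = "N \<union> {r}"])
      show "(\<lambda>\<tau>. - g \<tau> i) integrable_on {r..t}"
        using rt t by (intro integrable_neg integrable_subinterval_real[OF primitive_onD(2)[OF prim]]) auto
      show "(\<lambda>\<tau>. w \<tau> * L \<tau>) integrable_on {r..t}"
        using rt t by (intro integrable_subinterval_real[OF wL']) auto
      show "- g \<tau> i \<le> w \<tau> * L \<tau>" if "\<tau> \<in> {r..t} - (N \<union> {r})" for \<tau>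
        using g_ge[of \<tau> i] after[of \<tau>] that rt t by auto
    qed (use N in auto)
    also have "\<dots> \<le> integral {s..t} (\<lambda>\<tau>. w \<tau> * L \<tau>)"
    proof -
      have "integral {s..r} (\<lambda>\<tau>. w \<tau> * L \<tau>) + integral {r..t} (\<lambda>\<tau>. w \<tau> * L \<tau>) = integral {s..t} (\<lambda>\<tau>. w \<tau> * L \<tau>)"
        using rt t by (intro Henstock_Kurzweil_Integration.integral_combine integrable_subinterval_real[OF wL']) auto
      moreover have "0 \<le> integral {s..r} (\<lambda>\<tau>. w \<tau> * L \<tau>)"
        using integral_nonneg_mono(2)[OF wL wL_nonneg, of s r] rt t by auto
      ultimately show ?thesis by linarith
    qed
    finally have "- integral {r..t} (\<lambda>\<tau>. g \<tau> i) \<le> integral {s..t} (\<lambda>\<tau>. w \<tau> * L \<tau>)" .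
    moreover have "z t i - z r i = integral {r..t} (\<lambda>\<tau>. g \<tau> i)"
      using primitive_on_increment[OF prim rt(1,2)] t by auto
    ultimately show ?thesis using rt False by auto
  qed
  have "w t \<le> 0 * exp (integral {s..t} (\<lambda>\<tau>. real CARD('d) * L \<tau>))"
  proof (rule gronwall_integral[OF cw _ N _ _ t])
    show "(\<lambda>\<tau>. real CARD('d) * L \<tau>) absolutely_integrable_on {s..T}" using L by simp
    show "0 \<le> real CARD('d) * L t" if "t \<in> {s..T} - N" for t using L_nonneg[OF that] by simp
    fix t assume t: "t \<in> {s..T}"
    have "w t \<le> (\<Sum>i\<in>(UNIV :: 'd set). integral {s..t} (\<lambda>\<tau>. w \<tau> * L \<tau>))"
      unfolding w_def by (intro sum_mono neg_part[unfolded w_def] t)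
    also have "\<dots> = integral {s..t} (\<lambda>\<tau>. real CARD('d) * (w \<tau> * L \<tau>))"
      by simp
    finally show "w t \<le> 0 + integral {s..t} (\<lambda>\<tau>. w \<tau> * (real CARD('d) * L \<tau>))"
      by (simp add: mult_ac)
  qed
  then have "w t = 0" using w_nonneg[of t] by simp
  then have "max 0 (- z t i) = 0" for i
    unfolding w_def by (simp add: sum_nonneg_eq_0_iff)
  then have "z t i \<ge> 0" for i by (metis max.cobounded2 neg_le_0_iff_le)
  then show ?thesis by (simp add: less_eq_vec_def z_def)
qed

text \<open>On ordered pairs the one-sided bound \<open>f y - f x \<ge> - c (y - x)\<close> makes the flow expand the order
  at a rate that does not depend on the Lipschitz constant.\<close>

lemma order_expanding:
  assumes xy: "x \<le> y" and t: "t \<in> {s..T}"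
  shows "X t y $ i - X t x $ i \<ge> expansion_const * (y $ i - x $ i)"
proof -
  define z where "z t = X t y $ i - X t x $ i" for t
  have prim: "primitive_on s T z (\<lambda>t. f t (X t y) $ i - f t (X t x) $ i)"
    unfolding z_def
    by (intro primitive_on_diff primitive_on_bounded_linear[OF primitive] bounded_linear_vec_nth)
  have z_nonneg: "z t \<ge> 0" if "t \<in> {s..T}" for t
    using order_preserving[OF xy that] by (simp add: z_def less_eq_vec_def)
  have "z s \<le> exp (integral {s..t} c) * z t"
  proof (rule gronwall_differential[OF prim c N _ t])
    fix t assume t: "t \<in> {s..T} - N"
    have "f t (X t x) + c t *\<^sub>R X t x \<le> f t (X t y) + c t *\<^sub>R X t y"
      using monoD[OF mono[OF t] order_preserving[OF xy]] t by auto
    then show "- c t * z t \<le> f t (X t y) $ i - f t (X t x) $ i"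
      by (simp add: less_eq_vec_def z_def algebra_simps)
  qed
  also have "\<dots> \<le> exp (integral {s..T} c) * z t"
    using integral_nonneg_mono(1)[OF c c_nonneg, of s t] t z_nonneg[OF t] by (intro mult_right_mono) auto
  finally have "exp (integral {s..T} c) * (expansion_const * z s) \<le> exp (integral {s..T} c) * z t"
    by (simp add: expansion_const_def mult.assoc[symmetric] exp_add[symmetric])
  then have "expansion_const * z s \<le> z t" by (rule mult_left_le_imp_le) simp
  then show ?thesis by (simp add: z_def init)
qed

lemma continuous_joint: "continuous_on ({s..T} \<times> UNIV) (\<lambda>(t, x). X t x)"
  unfolding continuous_on_iff
proof (intro ballI allI impI)
  fix q :: "real \<times> (real^'d)" and e :: real assume "q \<in> {s..T} \<times> UNIV" "e > 0"
  then obtain t x where q: "q = (t, x)" and t: "t \<in> {s..T}" by auto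
  define M where "M = exp (integral {s..T} L)"
  have M: "M > 0" by (simp add: M_def)
  obtain d where d: "d > 0" "\<And>r. r \<in> {s..T} \<Longrightarrow> dist r t < d \<Longrightarrow> dist (X r x) (X t x) < e / 2"
    using continuous_time[of x] t \<open>e > 0\<close> unfolding continuous_on_iff by (meson half_gt_zero)
  show "\<exists>d>0. \<forall>p\<in>{s..T} \<times> UNIV. dist p q < d \<longrightarrow>
      dist (case p of (t, x) \<Rightarrow> X t x) (case q of (t, x) \<Rightarrow> X t x) < e"
  proof (intro exI[of _ "min d (e / (2 * M))"] conjI ballI impI)
    show "0 < min d (e / (2 * M))" using d(1) M \<open>e > 0\<close> by simp
    fix p :: "real \<times> (real^'d)" assume p: "p \<in> {s..T} \<times> UNIV" "dist p q < min d (e / (2 * M))"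
    obtain r y where ry: "p = (r, y)" by (cases p)
    have r: "r \<in> {s..T}" using p ry by auto
    have "dist r t < d" using p(2) dist_fst_le[of p q] ry q by simp
    then have 1: "dist (X r x) (X t x) < e / 2" using d(2) r by blast
    have "dist (X r y) (X r x) \<le> M * dist y x"
      using space_lipschitz[OF r, of y x] by (simp add: dist_norm M_def)
    also have "\<dots> < M * (e / (2 * M))"
      using p(2) dist_snd_le[of p q] ry q M by (intro mult_strict_left_mono) auto
    also have "\<dots> = e / 2" using M by simp
    finally show "dist (case p of (t, x) \<Rightarrow> X t x) (case q of (t, x) \<Rightarrow> X t x) < e"
      using 1 dist_triangle[of "X r y" "X t x" "X r x"] by (simp add: ry q)
  qed
qed

end

section \<open>Null sets in products and Borel versions\<close>

lemma borel_measurable_vecI: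
  fixes f :: "'a \<Rightarrow> real^'d"
  assumes "\<And>i. (\<lambda>x. f x $ i) \<in> borel_measurable M"
  shows "f \<in> borel_measurable M"
  unfolding borel_measurable_euclidean_space[of f]
  using assms by (auto simp: Basis_vec_def inner_axis)

lemma borel_measurable_vec_nth [measurable (raw)]:
  fixes f :: "'a \<Rightarrow> real^'d"
  assumes "f \<in> borel_measurable M"
  shows "(\<lambda>x. f x $ i) \<in> borel_measurable M"
  using assms by (rule measurable_compose) (intro borel_measurable_continuous_onI continuous_intros)

lemma AE_lborel_strip:
  fixes P :: "real \<Rightarrow> 'a::euclidean_space \<Rightarrow> bool"
  assumes "AE (t, x) in lebesgue_on ({0..T} \<times> UNIV). P t x"
  shows "AE p in lborel. fst p \<in> {0..T} \<longrightarrow> P (fst p) (snd p)"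
proof -
  have "closed ({0..T} \<times> (UNIV :: 'a set))" by (intro closed_Times) auto
  then have "{0..T} \<times> (UNIV :: 'a set) \<in> sets lebesgue" by (simp add: borel_closed sets_completionI_sets)
  then have "AE p in lebesgue. p \<in> {0..T} \<times> UNIV \<longrightarrow> (case p of (t, x) \<Rightarrow> P t x)"
    using assms by (subst (asm) AE_restrict_space_iff) auto
  then show ?thesis
    unfolding AE_completion_iff by (rule AE_mp) (auto intro!: AE_I2)
qed

lemma AE_strip_sections:
  fixes P :: "real \<Rightarrow> 'a::euclidean_space \<Rightarrow> bool"
  assumes "AE (t, x) in lebesgue_on ({0..T} \<times> UNIV). P t x"
  shows "AE t in lborel. t \<in> {0..T} \<longrightarrow> (AE x in lborel. P t x)"
  using lborel_pair.AE_pair[OF AE_lborel_strip[OF assms, folded lborel_prod]]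
  by (rule AE_mp) (auto intro!: AE_I2)

text \<open>The exceptional set is enclosed in a Borel null set, whose sections can be taken in either order.\<close>

lemma AE_lborel_commute:
  fixes Q :: "'a::euclidean_space \<times> 'b::euclidean_space \<Rightarrow> bool"
  assumes "AE p in lborel. Q p"
  shows "AE y in lborel. AE x in lborel. Q (x, y)"
proof -
  obtain N where N: "{p. \<not> Q p} \<subseteq> N" "emeasure lborel N = 0" "N \<in> sets lborel"
    using AE_E[OF assms] by auto
  have "AE p in lborel \<Otimes>\<^sub>M lborel. p \<notin> N"
    unfolding lborel_prod using N by (intro AE_not_in) auto
  then have "AE x in lborel. AE y in lborel. (x, y) \<notin> N" by (rule lborel_pair.AE_pair)
  then have "AE y in lborel. AE x in lborel. (x, y) \<notin> N"
  proof (subst (asm) lborel_pair.AE_commute)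
    have "N \<in> sets (lborel \<Otimes>\<^sub>M lborel)" using N(3) unfolding lborel_prod .
    then show "{x \<in> space (lborel \<Otimes>\<^sub>M lborel). (fst x, snd x) \<notin> N} \<in> sets (lborel \<Otimes>\<^sub>M lborel)"
      using sets.compl_sets[of N "lborel \<Otimes>\<^sub>M lborel"] by (simp add: Compl_eq set_diff_eq)
  qed
  then show ?thesis
  proof (rule AE_mp[OF _ AE_I2[OF impI]])
    fix y assume "AE x in lborel. (x, y) \<notin> N"
    then show "AE x in lborel. Q (x, y)" by (rule AE_mp) (use N(1) in \<open>auto intro!: AE_I2\<close>)
  qed
qed

lemma AE_lborel_Icc:
  assumes "AE t in lebesgue_on {a..b::real}. P t"
  shows "AE t in lborel. t \<in> {a..b} \<longrightarrow> P t"
proof -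
  have "AE t in lebesgue. t \<in> {a..b} \<longrightarrow> P t"
    using assms by (subst (asm) AE_restrict_space_iff) auto
  then show ?thesis by (simp only: AE_completion_iff)
qed

lemma AE_lborel_negligible:
  fixes P :: "'a::euclidean_space \<Rightarrow> bool"
  assumes "AE t in lborel. P t"
  obtains N where "negligible N" "\<And>t. t \<notin> N \<Longrightarrow> P t"
proof -
  have "AE t in lebesgue. P t" using assms by (rule AE_completion)
  then obtain N where N: "N \<in> null_sets lebesgue" "{t \<in> space lebesgue. \<not> P t} \<subseteq> N"
    unfolding eventually_ae_filter by blast
  show ?thesis
  proof
    show "negligible N" using N(1) by (simp add: negligible_iff_null_sets)
    show "P t" if "t \<notin> N" for t using N(2) that by auto
  qed
qed

lemma borel_measurable_sections:
  fixes F :: "'a::second_countable_topology \<times> 'b::second_countable_topology \<Rightarrow> 'c::topological_space"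
  assumes "F \<in> borel_measurable borel"
  shows "(\<lambda>y. F (x, y)) \<in> borel_measurable borel" "(\<lambda>x. F (x, y)) \<in> borel_measurable borel"
    "(\<lambda>(y, x). F (x, y)) \<in> borel_measurable borel"
  unfolding case_prod_beta'
  by (rule measurable_compose[OF borel_measurable_continuous_onI assms], intro continuous_intros)+

lemma lebesgue_ex_borel_version:
  fixes g :: "'a::euclidean_space \<Rightarrow> real^'d"
  assumes "g \<in> borel_measurable lebesgue"
  obtains g' where "g' \<in> borel_measurable borel" "AE x in lborel. g x = g' x"
proof -
  have "\<exists>h\<in>borel_measurable lborel. AE x in lborel. g x $ i = h x" for i
    using assms by (intro completion_ex_borel_measurable_real) measurable
  then obtain h where h: "\<And>i. h i \<in> borel_measurable lborel" "\<And>i. AE x in lborel. g x $ i = h i x" by metis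
  show ?thesis
  proof
    show "(\<lambda>x. \<chi> i. h i x) \<in> borel_measurable borel"
      using h(1) by (intro borel_measurable_vecI) simp
    have "AE x in lborel. \<forall>i. g x $ i = h i x" using h(2) by (simp add: AE_all_countable)
    then show "AE x in lborel. g x = (\<chi> i. h i x)" by (rule AE_mp) (auto simp: vec_eq_iff intro!: AE_I2)
  qed
qed

lemma countable_dense_subset_AE:
  fixes P :: "'a::euclidean_space \<Rightarrow> bool"
  assumes "AE x in lborel. P x"
  obtains D where "countable D" "\<And>x. x \<in> D \<Longrightarrow> P x" "\<And>U. open U \<Longrightarrow> U \<noteq> {} \<Longrightarrow> \<exists>x\<in>D. x \<in> U"
proof -
  obtain D where D: "countable D" "D \<subseteq> {x. P x}" "{x. P x} \<subseteq> closure D"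
    using separable[of "{x. P x}"] by metis
  have "\<exists>x\<in>D. x \<in> U" if U: "open U" "U \<noteq> {}" for U
  proof -
    have "\<exists>x\<in>U. P x"
    proof (rule ccontr)
      assume "\<not> (\<exists>x\<in>U. P x)"
      then have "AE x in lebesgue. x \<notin> U" using assms by (intro AE_completion) auto
      moreover have "U \<in> sets lebesgue" using U by auto
      ultimately have "negligible U" by (simp add: negligible_iff_null_sets AE_iff_null_sets)
      then show False using open_not_negligible U by blast
    qed
    then have "U \<inter> closure D \<noteq> {}" using D by auto
    then show ?thesis using open_Int_closure_eq_empty[OF U(1)] by blast
  qed
  with D that show ?thesis by blast
qed

lemma norm_le_card_times:
  fixes x :: "real^'d"
  assumes "\<And>j. \<bar>x $ j\<bar> \<le> \<delta>"
  shows "norm x \<le> real CARD('d) * \<delta>"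
proof -
  have "norm x \<le> (\<Sum>j\<in>UNIV. \<bar>x $ j\<bar>)" by (rule norm_le_l1_cart)
  also have "\<dots> \<le> (\<Sum>j\<in>(UNIV :: 'd set). \<delta>)" using assms by (intro sum_mono)
  finally show ?thesis by simp
qed

section \<open>A bounded weak gradient makes an increasing field Lipschitz\<close>

text \<open>For \<open>\<rho> \<ge> 0\<close>, a nonnegative function supported in the ball of radius \<open>\<rho>\<close> around \<open>p\<close>; squaring the truncated paraboloid makes it
  continuously differentiable across the boundary of the ball.\<close>

definition bump :: "real \<Rightarrow> 'a::real_inner \<Rightarrow> 'a \<Rightarrow> real" where
  "bump \<rho> p w = (max 0 (\<rho>\<^sup>2 - (norm (w - p))\<^sup>2))\<^sup>2"

definition bump_deriv :: "real \<Rightarrow> 'a::real_inner \<Rightarrow> 'a \<Rightarrow> 'a \<Rightarrow> real" where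
  "bump_deriv \<rho> p w h = - 4 * max 0 (\<rho>\<^sup>2 - (norm (w - p))\<^sup>2) * ((w - p) \<bullet> h)"

text \<open>The error of the linear approximation is at most \<open>h\<^sup>2\<close> whatever the signs of \<open>u\<close> and \<open>u + h\<close>.\<close>

lemma DERIV_positive_part_square: "((\<lambda>u::real. (max 0 u)\<^sup>2) has_real_derivative 2 * max 0 u) (at u)"
  unfolding DERIV_def
proof (rule Lim_null_comparison[THEN LIM_zero_cancel])
  have "\<bar>(max 0 (u + h))\<^sup>2 - (max 0 u)\<^sup>2 - 2 * max 0 u * h\<bar> \<le> h\<^sup>2" for h
  proof -
    consider "u + h \<ge> 0" "u \<ge> 0" | "u + h \<ge> 0" "u < 0" | "u + h < 0" "u \<ge> 0" | "u + h < 0" "u < 0" by linarith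
    then show ?thesis
    proof cases
      case 2
      then have "0 \<le> u + h" "u + h \<le> h" by auto
      then have "(u + h)\<^sup>2 \<le> h\<^sup>2" by (intro power_mono) auto
      then show ?thesis using 2 by (simp add: max_def)
    next
      case 3
      then have "\<bar>- u\<^sup>2 - 2 * u * h\<bar> \<le> h\<^sup>2"
      proof -
        have "u\<^sup>2 + 2 * u * h = (u + h)\<^sup>2 - h\<^sup>2" by (simp add: power2_eq_square algebra_simps)
        moreover have "(u + h)\<^sup>2 \<le> h\<^sup>2" using 3 by (intro abs_le_square_iff[THEN iffD1]) auto
        moreover have "0 \<le> (u + h)\<^sup>2" by simp
        ultimately show ?thesis by linarith
      qed
      then show ?thesis using 3 by (simp add: max_def)
    qed (auto simp: max_def power2_eq_square algebra_simps)
  qed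
  then have "norm (((max 0 (u + h))\<^sup>2 - (max 0 u)\<^sup>2) / h - 2 * max 0 u) \<le> \<bar>h\<bar>" if "h \<noteq> 0" for h
  proof -
    have "((max 0 (u + h))\<^sup>2 - (max 0 u)\<^sup>2) / h - 2 * max 0 u = ((max 0 (u + h))\<^sup>2 - (max 0 u)\<^sup>2 - 2 * max 0 u * h) / h"
      using that by (simp add: field_simps)
    also have "norm \<dots> \<le> h\<^sup>2 / \<bar>h\<bar>"
      using \<open>\<And>h. \<bar>(max 0 (u + h))\<^sup>2 - (max 0 u)\<^sup>2 - 2 * max 0 u * h\<bar> \<le> h\<^sup>2\<close>[of h]
      by (simp add: divide_right_mono)
    also have "\<dots> = \<bar>h\<bar>" using that by (simp add: power2_eq_square field_simps abs_if)
    finally show ?thesis .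
  qed
  then show "\<forall>\<^sub>F h in at 0. norm (((max 0 (u + h))\<^sup>2 - (max 0 u)\<^sup>2) / h - 2 * max 0 u) \<le> \<bar>h\<bar>"
    by (auto simp: eventually_at intro!: exI[of _ 1])
  show "((\<lambda>h::real. \<bar>h\<bar>) \<longlongrightarrow> 0) (at 0)" by (rule tendsto_rabs_zero) simp
qed

lemma bump_has_derivative: "(bump \<rho> p has_derivative bump_deriv \<rho> p w) (at w)"
proof -
  have 1: "((\<lambda>w. \<rho>\<^sup>2 - (w - p) \<bullet> (w - p)) has_derivative (\<lambda>h. - (2 * ((w - p) \<bullet> h)))) (at w)"
    by (auto intro!: derivative_eq_intros simp: inner_commute)
  have 2: "((\<lambda>u::real. (max 0 u)\<^sup>2) has_derivative (*) (2 * max 0 (\<rho>\<^sup>2 - (w - p) \<bullet> (w - p)))) (at (\<rho>\<^sup>2 - (w - p) \<bullet> (w - p)))"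
    using DERIV_positive_part_square unfolding has_field_derivative_def .
  have "bump \<rho> p = (\<lambda>u. (max 0 u)\<^sup>2) \<circ> (\<lambda>w. \<rho>\<^sup>2 - (w - p) \<bullet> (w - p))"
    by (auto simp: bump_def power2_norm_eq_inner)
  moreover have "bump_deriv \<rho> p w = (*) (2 * max 0 (\<rho>\<^sup>2 - (w - p) \<bullet> (w - p))) \<circ> (\<lambda>h. - (2 * ((w - p) \<bullet> h)))"
    by (auto simp: bump_deriv_def power2_norm_eq_inner)
  ultimately show ?thesis using diff_chain_at[OF 1 2] by simp
qed

lemma frechet_derivative_bump: "frechet_derivative (bump \<rho> p) (at w) = bump_deriv \<rho> p w"
  by (rule frechet_derivative_at[OF bump_has_derivative, symmetric])

lemma continuous_bump: "continuous_on UNIV (bump \<rho> p)"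
  unfolding bump_def by (intro continuous_intros)

lemma bump_eq_0: "\<rho> \<ge> 0 \<Longrightarrow> norm (w - p) \<ge> \<rho> \<Longrightarrow> bump \<rho> p w = 0"
  by (simp add: bump_def max_def)

lemma bump_nonneg: "bump \<rho> p w \<ge> 0"
  by (simp add: bump_def)

lemma test_function_bump:
  assumes "\<rho> \<ge> 0"
  shows "test_function UNIV (bump \<rho> (p::'a::euclidean_space))"
  unfolding test_function_def frechet_derivative_bump
proof (intro conjI allI)
  show "bump \<rho> p differentiable at x" for x
    using bump_has_derivative unfolding differentiable_def by blast
  show "continuous_on UNIV (\<lambda>x. bump_deriv \<rho> p x h)" for h
    unfolding bump_deriv_def by (intro continuous_intros)
  have "{x. bump \<rho> p x \<noteq> 0} \<subseteq> cball p \<rho>"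
    using bump_eq_0[OF assms] by (force simp: dist_norm norm_minus_commute)
  then have "closure {x. bump \<rho> p x \<noteq> 0} \<subseteq> cball p \<rho>" by (rule closure_minimal) simp
  then show "compact (closure {x. bump \<rho> p x \<noteq> 0})"
    by (auto simp: compact_eq_bounded_closed intro: bounded_subset)
qed simp

lemma bump_deriv_bound:
  assumes "\<rho> \<ge> 0"
  shows "\<bar>bump_deriv \<rho> p w h\<bar> \<le> 4 * \<rho> ^ 3 * norm h"
proof (cases "norm (w - p) \<le> \<rho>")
  case True
  have "\<bar>bump_deriv \<rho> p w h\<bar> = 4 * max 0 (\<rho>\<^sup>2 - (norm (w - p))\<^sup>2) * \<bar>(w - p) \<bullet> h\<bar>"
    by (simp add: bump_deriv_def abs_mult)
  also have "\<dots> \<le> (4 * \<rho>\<^sup>2) * (\<rho> * norm h)"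
  proof (rule mult_mono)
    show "\<bar>(w - p) \<bullet> h\<bar> \<le> \<rho> * norm h"
      using Cauchy_Schwarz_ineq2[of "w - p" h] mult_right_mono[OF True norm_ge_zero[of h]] by linarith
  qed auto
  finally show ?thesis by (simp add: power2_eq_square power3_eq_cube mult_ac)
next
  case False
  then have "\<rho>\<^sup>2 \<le> (norm (w - p))\<^sup>2" using assms by (intro power_mono) auto
  then show ?thesis using assms by (simp add: bump_deriv_def max_def)
qed

lemma bump_lipschitz:
  assumes "\<rho> \<ge> 0"
  shows "\<bar>bump \<rho> p w - bump \<rho> q w\<bar> \<le> 4 * \<rho> ^ 3 * norm (p - q)"
proof -
  have sh: "bump \<rho> q w = bump \<rho> p (w + (p - q))" by (simp add: bump_def algebra_simps)
  have "norm (bump \<rho> p w - bump \<rho> p (w + (p - q))) \<le> 4 * \<rho> ^ 3 * norm (w - (w + (p - q)))"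
  proof (rule differentiable_bound[of UNIV _ "bump_deriv \<rho> p"])
    show "onorm (bump_deriv \<rho> p x) \<le> 4 * \<rho> ^ 3" for x
      using bump_deriv_bound[OF assms] assms by (intro onorm_bound) (simp_all add: mult.commute)
  qed (auto intro: bump_has_derivative)
  then show ?thesis unfolding sh by (simp add: norm_minus_commute)
qed

lemma bump_center_derivative:
  "((\<lambda>r. bump \<rho> (p + r *\<^sub>R v) w) has_real_derivative - bump_deriv \<rho> (p + r *\<^sub>R v) w v) (at r)"
proof -
  have "((\<lambda>r. bump \<rho> p (w - r *\<^sub>R v)) has_derivative (\<lambda>h. bump_deriv \<rho> p (w - r *\<^sub>R v) (- (h *\<^sub>R v)))) (at r)"
    by (rule has_derivative_compose[OF _ bump_has_derivative]) (auto intro!: derivative_eq_intros)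
  moreover have "bump \<rho> p (w - r *\<^sub>R v) = bump \<rho> (p + r *\<^sub>R v) w" for r by (simp add: bump_def algebra_simps)
  moreover have "(\<lambda>h. bump_deriv \<rho> p (w - r *\<^sub>R v) (- (h *\<^sub>R v))) = (*) (- bump_deriv \<rho> (p + r *\<^sub>R v) w v)"
    by (simp add: bump_deriv_def algebra_simps fun_eq_iff)
  ultimately show ?thesis unfolding has_field_derivative_def by simp
qed


lemma compactly_supported_scaleR_integrable:
  fixes g :: "'a::euclidean_space \<Rightarrow> 'b::euclidean_space" and k :: "'a \<Rightarrow> real"
  assumes g: "locally_integrable_on UNIV g" and k: "continuous_on UNIV k" "\<And>w. \<bar>k w\<bar> \<le> C"
    and supp: "\<And>w. w \<notin> cball p \<rho> \<Longrightarrow> k w = 0"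
  shows "integrable lebesgue (\<lambda>w. k w *\<^sub>R g w)"
proof -
  have "g absolutely_integrable_on cball p \<rho>" using g by (simp add: locally_integrable_on_def)
  then have int: "integrable lebesgue (\<lambda>w. indicator (cball p \<rho>) w *\<^sub>R g w)" by (simp add: set_integrable_def)
  have meas: "k \<in> borel_measurable lebesgue"
    using borel_measurable_continuous_onI[OF k(1)] by (simp add: measurable_completion)
  have "integrable lebesgue (\<lambda>w. k w *\<^sub>R (indicator (cball p \<rho>) w *\<^sub>R g w))"
  proof (rule Bochner_Integration.integrable_bound[OF integrable_scaleR_right[OF int, of C]])
    show "(\<lambda>w. k w *\<^sub>R (indicator (cball p \<rho>) w *\<^sub>R g w)) \<in> borel_measurable lebesgue"
      using borel_measurable_scaleR[OF meas borel_measurable_integrable[OF int]] .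
    show "AE w in lebesgue. norm (k w *\<^sub>R (indicator (cball p \<rho>) w *\<^sub>R g w))
        \<le> norm (C *\<^sub>R (indicator (cball p \<rho>) w *\<^sub>R g w))"
    proof (rule AE_I2)
      fix w
      show "norm (k w *\<^sub>R (indicator (cball p \<rho>) w *\<^sub>R g w))
          \<le> norm (C *\<^sub>R (indicator (cball p \<rho>) w *\<^sub>R g w))"
        unfolding norm_scaleR using k(2)[of w] by (intro mult_right_mono) auto
    qed
  qed
  moreover have "(\<lambda>w. k w *\<^sub>R (indicator (cball p \<rho>) w *\<^sub>R g w)) = (\<lambda>w. k w *\<^sub>R g w)"
    using supp by (fastforce simp: indicator_def)
  ultimately show ?thesis by (simp only:)
qed

lemma bump_scaleR_integrable:
  fixes g :: "'a::euclidean_space \<Rightarrow> 'b::euclidean_space"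
  assumes g: "locally_integrable_on UNIV g" and "\<rho> \<ge> 0"
  shows "integrable lebesgue (\<lambda>w. bump \<rho> p w *\<^sub>R g w)"
proof (rule compactly_supported_scaleR_integrable[OF g continuous_bump])
  show "\<bar>bump \<rho> p w\<bar> \<le> (\<rho>\<^sup>2)\<^sup>2" for w
    unfolding abs_of_nonneg[OF bump_nonneg] unfolding bump_def by (intro power_mono) auto
  show "bump \<rho> p w = 0" if "w \<notin> cball p \<rho>" for w
    using that by (intro bump_eq_0 \<open>\<rho> \<ge> 0\<close>) (simp add: dist_norm norm_minus_commute)
qed

lemma bump_deriv_scaleR_integrable:
  fixes g :: "'a::euclidean_space \<Rightarrow> 'b::euclidean_space"
  assumes g: "locally_integrable_on UNIV g" and "\<rho> \<ge> 0"
  shows "integrable lebesgue (\<lambda>w. bump_deriv \<rho> p w v *\<^sub>R g w)"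
proof (rule compactly_supported_scaleR_integrable[OF g _ bump_deriv_bound[OF \<open>\<rho> \<ge> 0\<close>]])
  show "continuous_on UNIV (\<lambda>w. bump_deriv \<rho> p w v)" unfolding bump_deriv_def by (intro continuous_intros)
  show "bump_deriv \<rho> p w v = 0" if "w \<notin> cball p \<rho>" for w
  proof -
    have "\<rho>\<^sup>2 \<le> (norm (w - p))\<^sup>2"
      using that \<open>\<rho> \<ge> 0\<close> by (intro power_mono) (auto simp: dist_norm norm_minus_commute)
    then show ?thesis by (simp add: bump_deriv_def max_def)
  qed
qed

text \<open>The integral of a bump does not depend on its centre; the type argument fixes the dimension.\<close>

definition bump_mass :: "real \<Rightarrow> 'a::euclidean_space itself \<Rightarrow> real" where
  "bump_mass \<rho> _ = (LINT w|lebesgue. bump \<rho> (0 :: 'a) w)"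

lemma bump_integrable:
  assumes "\<rho> \<ge> 0"
  shows "integrable lebesgue (bump \<rho> (p :: 'a::euclidean_space))"
proof -
  have "locally_integrable_on UNIV (\<lambda>_::'a. 1 :: real)"
    by (auto simp: locally_integrable_on_def intro!: absolutely_integrable_on_const lmeasurable_compact)
  from bump_scaleR_integrable[OF this assms, of p] show ?thesis by simp
qed

lemma integral_bump:
  fixes p :: "'a::euclidean_space"
  shows "(LINT w|lebesgue. bump \<rho> p w) = bump_mass \<rho> TYPE('a)"
proof -
  have meas: "bump \<rho> q \<in> borel_measurable borel" for q :: 'a
    using borel_measurable_continuous_onI[OF continuous_bump] .
  have "(LINT w|lebesgue. bump \<rho> p w) = (LINT w|lborel. bump \<rho> p w)"
    using meas by (intro integral_completion) simp
  also have "\<dots> = (LINT w|distr lborel borel ((+) p). bump \<rho> p w)" by (simp add: lborel_distr_plus)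
  also have "\<dots> = (LINT w|lborel. bump \<rho> p (p + w))" using meas by (intro integral_distr) auto
  also have "\<dots> = (LINT w|lborel. bump \<rho> (0 :: 'a) w)" by (simp add: bump_def)
  also have "\<dots> = (LINT w|lebesgue. bump \<rho> (0 :: 'a) w)" using meas by (intro integral_completion[symmetric]) simp
  finally show ?thesis by (simp add: bump_mass_def)
qed

lemma bump_mass_pos:
  assumes "\<rho> > 0"
  shows "bump_mass \<rho> TYPE('a::euclidean_space) > 0"
proof -
  have "bump_mass \<rho> TYPE('a) \<ge> 0" unfolding bump_mass_def by (intro integral_nonneg_AE) (simp add: bump_nonneg)
  moreover have "bump_mass \<rho> TYPE('a) \<noteq> 0"
  proof
    assume "bump_mass \<rho> TYPE('a) = 0"
    then have "AE w in lebesgue. bump \<rho> (0::'a) w = 0"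
      using integral_nonneg_eq_0_iff_AE[OF bump_integrable[of \<rho> "0::'a"]] assms
      by (auto simp: bump_mass_def bump_nonneg)
    then have "AE w in lebesgue. w \<notin> ball (0::'a) \<rho>"
    proof (rule AE_mp, intro AE_I2 impI notI)
      fix w :: 'a assume "bump \<rho> 0 w = 0" "w \<in> ball 0 \<rho>"
      moreover from this have "(norm w)\<^sup>2 < \<rho>\<^sup>2" by (intro power_strict_mono) auto
      ultimately show False by (simp add: bump_def)
    qed
    then have "negligible (ball (0::'a) \<rho>)" by (simp add: negligible_iff_null_sets AE_iff_null_sets)
    then show False using open_not_negligible[of "ball (0::'a) \<rho>"] assms by simp
  qed
  ultimately show ?thesis by simp
qed

definition mollified :: "real \<Rightarrow> ('a::euclidean_space \<Rightarrow> 'b::euclidean_space) \<Rightarrow> 'a \<Rightarrow> 'b" where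
  "mollified \<rho> g p = (LINT w|lebesgue. bump \<rho> p w *\<^sub>R g w)"

text \<open>Differentiation under the integral sign; the difference quotients of the kernel are dominated
  because the kernel is Lipschitz in its centre.\<close>

lemma mollified_has_vector_derivative:
  fixes g :: "'a::euclidean_space \<Rightarrow> 'b::euclidean_space"
  assumes g: "locally_integrable_on UNIV g" and \<rho>: "\<rho> \<ge> 0"
  shows "((\<lambda>r. mollified \<rho> g (p + r *\<^sub>R v)) has_vector_derivative
      (LINT w|lebesgue. - bump_deriv \<rho> (p + r *\<^sub>R v) w v *\<^sub>R g w)) (at r)"
proof -
  define q where "q = p + r *\<^sub>R v"
  define R where "R = \<rho> + norm v"
  define Q where "Q h w = ((bump \<rho> (q + h *\<^sub>R v) w - bump \<rho> q w) / h) *\<^sub>R g w" for h w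
  have "g absolutely_integrable_on cball q R" using g by (simp add: locally_integrable_on_def)
  then have int: "integrable lebesgue (\<lambda>w. indicator (cball q R) w *\<^sub>R g w)" by (simp add: set_integrable_def)
  have Qint: "integrable lebesgue (Q h)" for h
  proof -
    have "integrable lebesgue (\<lambda>w. (1 / h) *\<^sub>R (bump \<rho> (q + h *\<^sub>R v) w *\<^sub>R g w - bump \<rho> q w *\<^sub>R g w))"
      using bump_scaleR_integrable[OF g \<rho>] by (intro integrable_scaleR_right Bochner_Integration.integrable_diff)
    then show ?thesis by (simp add: Q_def[abs_def] scaleR_diff_left[symmetric])
  qed
  have quot: "(mollified \<rho> g (q + h *\<^sub>R v) - mollified \<rho> g q) /\<^sub>R h = (LINT w|lebesgue. Q h w)" for h
  proof -
    have "(LINT w|lebesgue. Q h w)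
        = (LINT w|lebesgue. (1 / h) *\<^sub>R (bump \<rho> (q + h *\<^sub>R v) w *\<^sub>R g w - bump \<rho> q w *\<^sub>R g w))"
      by (simp add: Q_def scaleR_diff_left[symmetric])
    also have "\<dots> = (1 / h) *\<^sub>R (mollified \<rho> g (q + h *\<^sub>R v) - mollified \<rho> g q)"
      unfolding mollified_def using bump_scaleR_integrable[OF g \<rho>] by simp
    finally show ?thesis by (simp add: divide_inverse)
  qed
  have "((\<lambda>h. LINT w|lebesgue. Q h w) \<longlongrightarrow> (LINT w|lebesgue. - bump_deriv \<rho> q w v *\<^sub>R g w)) (at 0 within {-1..1})"
    unfolding tendsto_at_iff_sequentially o_def
  proof (intro allI impI)
    fix h :: "nat \<Rightarrow> real" assume h: "\<forall>i. h i \<in> {-1..1} - {0}" "h \<longlonglongrightarrow> 0"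
    show "(\<lambda>n. LINT w|lebesgue. Q (h n) w) \<longlonglongrightarrow> (LINT w|lebesgue. - bump_deriv \<rho> q w v *\<^sub>R g w)"
    proof (rule integral_dominated_convergence)
      show lim: "AE w in lebesgue. (\<lambda>n. Q (h n) w) \<longlonglongrightarrow> - bump_deriv \<rho> q w v *\<^sub>R g w"
      proof (rule AE_I2)
        fix w
        have "((\<lambda>k. (bump \<rho> (q + k *\<^sub>R v) w - bump \<rho> q w) / k) \<longlongrightarrow> - bump_deriv \<rho> q w v) (at 0)"
          using bump_center_derivative[of \<rho> q v w 0] by (simp add: DERIV_def)
        then have "(\<lambda>n. (bump \<rho> (q + h n *\<^sub>R v) w - bump \<rho> q w) / h n) \<longlonglongrightarrow> - bump_deriv \<rho> q w v"
          by (rule filterlim_compose) (use h in \<open>auto simp: filterlim_at intro!: always_eventually\<close>)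
        then show "(\<lambda>n. Q (h n) w) \<longlonglongrightarrow> - bump_deriv \<rho> q w v *\<^sub>R g w"
          unfolding Q_def by (intro tendsto_intros)
      qed
      show meas: "Q (h n) \<in> borel_measurable lebesgue" for n
        using Qint by (rule borel_measurable_integrable)
      show "(\<lambda>w. - bump_deriv \<rho> q w v *\<^sub>R g w) \<in> borel_measurable lebesgue"
      proof (rule borel_measurable_scaleR)
        have "(\<lambda>w. - bump_deriv \<rho> q w v) \<in> borel_measurable borel"
          unfolding bump_deriv_def by (intro borel_measurable_continuous_onI continuous_intros)
        then show "(\<lambda>w. - bump_deriv \<rho> q w v) \<in> borel_measurable lebesgue" by (simp add: measurable_completion)
        show "g \<in> borel_measurable lebesgue"
        proof (rule borel_measurable_LIMSEQ_metric)
          show "(\<lambda>w. indicator (cball 0 (real n)) w *\<^sub>R g w) \<in> borel_measurable lebesgue" for n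
          proof -
            have "g absolutely_integrable_on cball 0 (real n)" using g by (simp add: locally_integrable_on_def)
            then show ?thesis unfolding set_integrable_def by (rule borel_measurable_integrable)
          qed
          show "(\<lambda>n. indicator (cball 0 (real n)) w *\<^sub>R g w) \<longlonglongrightarrow> g w" for w
          proof (rule tendsto_eventually)
            obtain m :: nat where "norm w \<le> real m" using real_arch_simple by blast
            then show "\<forall>\<^sub>F n in sequentially. indicator (cball 0 (real n)) w *\<^sub>R g w = g w"
              by (intro eventually_sequentiallyI[of m]) (auto simp: dist_norm)
          qed
        qed
      qed
      show "integrable lebesgue (\<lambda>w. (4 * \<rho> ^ 3 * norm v) * norm (indicator (cball q R) w *\<^sub>R g w))"
        using int by (intro integrable_mult_right integrable_norm)
      show "AE w in lebesgue. norm (Q (h n) w) \<le> (4 * \<rho> ^ 3 * norm v) * norm (indicator (cball q R) w *\<^sub>R g w)" for n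
      proof (rule AE_I2)
        fix w
        have hn: "h n \<noteq> 0" "\<bar>h n\<bar> \<le> 1" using h(1)[rule_format, of n] by auto
        show "norm (Q (h n) w) \<le> (4 * \<rho> ^ 3 * norm v) * norm (indicator (cball q R) w *\<^sub>R g w)"
        proof (cases "w \<in> cball q R")
          case True
          have "\<bar>bump \<rho> (q + h n *\<^sub>R v) w - bump \<rho> q w\<bar> \<le> 4 * \<rho> ^ 3 * (\<bar>h n\<bar> * norm v)"
            using bump_lipschitz[OF \<rho>, of "q + h n *\<^sub>R v" w q] by simp
          then have "\<bar>bump \<rho> (q + h n *\<^sub>R v) w - bump \<rho> q w\<bar> / \<bar>h n\<bar> \<le> 4 * \<rho> ^ 3 * norm v"
            using hn by (simp add: field_simps)
          then have "\<bar>bump \<rho> (q + h n *\<^sub>R v) w - bump \<rho> q w\<bar> / \<bar>h n\<bar> * norm (g w) \<le> 4 * \<rho> ^ 3 * norm v * norm (g w)"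
            by (intro mult_right_mono) auto
          then show ?thesis using True by (simp add: Q_def abs_divide)
        next
          case False
          then have far: "norm (w - q) > R" by (simp add: dist_norm norm_minus_commute)
          have "norm (h n *\<^sub>R v) \<le> norm v" using hn(2) by (simp add: mult_left_le_one_le)
          then have "norm (w - (q + h n *\<^sub>R v)) \<ge> \<rho>"
            using far norm_triangle_ineq2[of "w - q" "h n *\<^sub>R v"] by (simp add: R_def algebra_simps)
          moreover have "norm (w - q) \<ge> \<rho>" using far norm_ge_zero[of v] unfolding R_def by linarith
          ultimately have "bump \<rho> (q + h n *\<^sub>R v) w = 0" "bump \<rho> q w = 0" using bump_eq_0[OF \<rho>] by blast+
          then show ?thesis using False by (simp add: Q_def)
        qed
      qed
    qed
  qed
  then have "((\<lambda>h. (mollified \<rho> g (q + h *\<^sub>R v) - mollified \<rho> g q) /\<^sub>R h) \<longlongrightarrow> (LINT w|lebesgue. - bump_deriv \<rho> q w v *\<^sub>R g w)) (at 0)"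
  proof -
    have "at (0::real) within {-1..1} = at 0"
      by (rule at_within_interior) (simp add: interior_atLeastAtMost_real)
    then show ?thesis using \<open>((\<lambda>h. LINT w|lebesgue. Q h w) \<longlongrightarrow> _) (at 0 within {-1..1})\<close> unfolding quot by (simp only:)
  qed
  then have "((\<lambda>h. norm ((mollified \<rho> g (q + h *\<^sub>R v) - mollified \<rho> g q) /\<^sub>R h
      - (LINT w|lebesgue. - bump_deriv \<rho> q w v *\<^sub>R g w))) \<longlongrightarrow> 0) (at 0)"
    by (intro tendsto_norm_zero LIM_zero)
  moreover have "\<forall>\<^sub>F h in at 0. norm ((mollified \<rho> g (q + h *\<^sub>R v) - mollified \<rho> g q) /\<^sub>R h - D)
      = norm (mollified \<rho> g (p + (r + h) *\<^sub>R v) - mollified \<rho> g (p + r *\<^sub>R v) - h *\<^sub>R D) / norm h" for D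
    unfolding eventually_at
  proof (intro exI[of _ 1] conjI ballI impI)
    fix h :: real assume "h \<noteq> 0 \<and> dist h 0 < 1"
    then have "h \<noteq> 0" by simp
    have "(mollified \<rho> g (q + h *\<^sub>R v) - mollified \<rho> g q) /\<^sub>R h - D
        = (mollified \<rho> g (q + h *\<^sub>R v) - mollified \<rho> g q - h *\<^sub>R D) /\<^sub>R h"
      using \<open>h \<noteq> 0\<close> by (simp add: scaleR_diff_right)
    also have "norm \<dots> = norm (mollified \<rho> g (q + h *\<^sub>R v) - mollified \<rho> g q - h *\<^sub>R D) / norm h"
      by (simp add: divide_inverse mult.commute)
    finally show "norm ((mollified \<rho> g (q + h *\<^sub>R v) - mollified \<rho> g q) /\<^sub>R h - D)
      = norm (mollified \<rho> g (p + (r + h) *\<^sub>R v) - mollified \<rho> g (p + r *\<^sub>R v) - h *\<^sub>R D) / norm h"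
      by (simp add: q_def scaleR_add_left add.assoc)
  qed simp
  ultimately have "((\<lambda>h. norm (mollified \<rho> g (p + (r + h) *\<^sub>R v) - mollified \<rho> g (p + r *\<^sub>R v)
      - h *\<^sub>R (LINT w|lebesgue. - bump_deriv \<rho> q w v *\<^sub>R g w)) / norm h) \<longlongrightarrow> 0) (at 0)"
    by (rule Lim_transform_eventually)
  then show ?thesis
    unfolding has_vector_derivative_def has_derivative_at
    by (intro conjI bounded_linear_scaleR_left) (simp only: q_def)
qed


lemma norm_column_le: "norm (column j A) \<le> norm (A :: real^'n^'m)"
  unfolding norm_vec_def[of "column j A"] norm_vec_def[of A]
  by (intro L2_set_mono) (auto simp: column_def component_le_norm_cart)

text \<open>Moving the centre of the kernel differentiates the kernel, and integration by parts passes the derivative on to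
  \<open>f\<close>, where it is bounded by \<open>M\<close>.\<close>

lemma mollified_lipschitz_weak_gradient:
  fixes f :: "real^'d \<Rightarrow> real^'d"
  assumes G: "weak_gradient f G" and M: "AE x in lebesgue. norm (G x) \<le> M" and \<rho>: "\<rho> \<ge> 0"
  shows "norm (mollified \<rho> f p - mollified \<rho> f q)
    \<le> (\<Sum>j\<in>UNIV. \<bar>p $ j - q $ j\<bar>) * (M * bump_mass \<rho> TYPE(real^'d))"
proof -
  have wd: "weak_derivative UNIV (axis j 1) f (\<lambda>x. column j (G x))" for j
    using G by (simp add: weak_gradient_def)
  then have f: "locally_integrable_on UNIV f" and g: "locally_integrable_on UNIV (\<lambda>x. column j (G x))" for j
    by (auto simp: weak_derivative_def)
  define v where "v = p - q"
  define D where "D r = (LINT w|lebesgue. - bump_deriv \<rho> (q + r *\<^sub>R v) w v *\<^sub>R f w)" for r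
  have D: "norm (D r) \<le> (\<Sum>j\<in>UNIV. \<bar>v $ j\<bar>) * (M * bump_mass \<rho> TYPE(real^'d))" for r
  proof -
    let ?c = "q + r *\<^sub>R v"
    have axis: "bump_deriv \<rho> ?c w v = (\<Sum>j\<in>UNIV. v $ j * bump_deriv \<rho> ?c w (axis j 1))" for w
    proof -
      have "(w - ?c) \<bullet> v = (\<Sum>j\<in>UNIV. (w - ?c) $ j * v $ j)" by (simp add: inner_vec_def)
      moreover have "(w - ?c) \<bullet> axis j 1 = (w - ?c) $ j" for j by (simp add: inner_axis)
      ultimately show ?thesis unfolding bump_deriv_def by (simp only: sum_distrib_left) (simp add: mult_ac)
    qed
    have by_parts: "(LINT w|lebesgue. bump_deriv \<rho> ?c w (axis j 1) *\<^sub>R f w) = - (LINT w|lebesgue. bump \<rho> ?c w *\<^sub>R column j (G w))" for j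
    proof -
      have "(LINT w:UNIV|lebesgue. frechet_derivative (bump \<rho> ?c) (at w) (axis j 1) *\<^sub>R f w)
          = - (LINT w:UNIV|lebesgue. bump \<rho> ?c w *\<^sub>R column j (G w))"
        using wd[of j] test_function_bump[OF \<rho>, of ?c] unfolding weak_derivative_def by blast
      then show ?thesis unfolding frechet_derivative_bump set_lebesgue_integral_def by simp
    qed
    have "D r = (LINT w|lebesgue. (\<Sum>j\<in>UNIV. (- v $ j) *\<^sub>R (bump_deriv \<rho> ?c w (axis j 1) *\<^sub>R f w)))"
      unfolding D_def axis by (simp add: scaleR_sum_left sum_negf)
    also have "\<dots> = (\<Sum>j\<in>UNIV. (- v $ j) *\<^sub>R (LINT w|lebesgue. bump_deriv \<rho> ?c w (axis j 1) *\<^sub>R f w))"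
      using bump_deriv_scaleR_integrable[OF f \<rho>, of ?c]
      by (subst Bochner_Integration.integral_sum) (simp_all del: scaleR_scaleR)
    also have "\<dots> = (\<Sum>j\<in>UNIV. v $ j *\<^sub>R (LINT w|lebesgue. bump \<rho> ?c w *\<^sub>R column j (G w)))"
      by (simp add: by_parts)
    also have "norm \<dots> \<le> (\<Sum>j\<in>UNIV. \<bar>v $ j\<bar> * (M * bump_mass \<rho> TYPE(real^'d)))"
    proof (rule sum_norm_le)
      fix j
      have "norm (LINT w|lebesgue. bump \<rho> ?c w *\<^sub>R column j (G w)) \<le> (LINT w|lebesgue. norm (bump \<rho> ?c w *\<^sub>R column j (G w)))"
        by (rule integral_norm_bound)
      also have "\<dots> \<le> (LINT w|lebesgue. M * bump \<rho> ?c w)"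
      proof (rule integral_mono_AE)
        show "integrable lebesgue (\<lambda>w. norm (bump \<rho> ?c w *\<^sub>R column j (G w)))"
          using bump_scaleR_integrable[OF g \<rho>] by (rule integrable_norm)
        show "integrable lebesgue (\<lambda>w. M * bump \<rho> ?c w)" using bump_integrable[OF \<rho>, of ?c] by simp
        show "AE w in lebesgue. norm (bump \<rho> ?c w *\<^sub>R column j (G w)) \<le> M * bump \<rho> ?c w"
          using M
        proof (rule AE_mp, intro AE_I2 impI)
          fix w assume "norm (G w) \<le> M"
          then have "norm (column j (G w)) \<le> M" using norm_column_le order_trans by blast
          then have "bump \<rho> ?c w * norm (column j (G w)) \<le> bump \<rho> ?c w * M"
            by (intro mult_left_mono bump_nonneg)
          then show "norm (bump \<rho> ?c w *\<^sub>R column j (G w)) \<le> M * bump \<rho> ?c w"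
            by (simp add: abs_of_nonneg[OF bump_nonneg] mult.commute)
        qed
      qed
      also have "\<dots> = M * bump_mass \<rho> TYPE(real^'d)" by (simp add: integral_bump)
      finally show "norm (v $ j *\<^sub>R (LINT w|lebesgue. bump \<rho> ?c w *\<^sub>R column j (G w)))
          \<le> \<bar>v $ j\<bar> * (M * bump_mass \<rho> TYPE(real^'d))"
        by (simp add: mult_left_mono)
    qed
    finally show ?thesis by (simp add: sum_distrib_right)
  qed
  have "norm (mollified \<rho> f (q + 1 *\<^sub>R v) - mollified \<rho> f (q + 0 *\<^sub>R v))
      \<le> (\<Sum>j\<in>UNIV. \<bar>v $ j\<bar>) * (M * bump_mass \<rho> TYPE(real^'d)) * norm (1 - 0 :: real)"
  proof (rule differentiable_bound[of UNIV "\<lambda>r. mollified \<rho> f (q + r *\<^sub>R v)" "\<lambda>r h. h *\<^sub>R D r"])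
    show "((\<lambda>r. mollified \<rho> f (q + r *\<^sub>R v)) has_derivative (\<lambda>h. h *\<^sub>R D r)) (at r)" for r
      using mollified_has_vector_derivative[OF f \<rho>, of q v r] unfolding has_vector_derivative_def D_def .
    show "onorm (\<lambda>h. h *\<^sub>R D r) \<le> (\<Sum>j\<in>UNIV. \<bar>v $ j\<bar>) * (M * bump_mass \<rho> TYPE(real^'d))" for r
      using D[of r] order_trans[OF norm_ge_zero D[of r]]
      by (intro onorm_bound) (auto simp: mult.commute intro!: mult_left_mono)
  qed auto
  then show ?thesis by (simp add: v_def)
qed

text \<open>Monotonicity squeezes \<open>f x\<close> below averages of \<open>f\<close> over balls in the positive orthant at \<open>x\<close> and above
  averages over balls in the negative one, and these averages are Lipschitz.\<close>

lemma weak_gradient_lipschitz: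
  fixes f :: "real^'d \<Rightarrow> real^'d"
  assumes G: "weak_gradient f G" and M: "AE x in lebesgue. norm (G x) \<le> M"
    and mono: "mono (\<lambda>x. f x + c *\<^sub>R x)" and c: "c \<ge> 0"
  shows "norm (f x - f y) \<le> real CARD('d) ^ 2 * M * norm (x - y)"
proof -
  define e :: "real^'d" where "e = (\<chi> i. 1)"
  have f: "locally_integrable_on UNIV f"
    using G by (auto simp: weak_gradient_def weak_derivative_def)
  have "M \<ge> 0"
  proof -
    obtain D where "\<And>x. x \<in> D \<Longrightarrow> norm (G x) \<le> M" "\<And>U. open U \<Longrightarrow> U \<noteq> {} \<Longrightarrow> \<exists>x\<in>D. x \<in> U"
      using countable_dense_subset_AE[OF M[unfolded AE_completion_iff]] by metis
    then show ?thesis using order_trans[OF norm_ge_zero] by (metis UNIV_not_empty open_UNIV)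
  qed
  have mol: "mollified \<rho> f p $ i = (LINT w|lebesgue. bump \<rho> p w * f w $ i)" "integrable lebesgue (\<lambda>w. bump \<rho> p w * f w $ i)"
    if "\<rho> > 0" for \<rho> p i
  proof -
    have int: "integrable lebesgue (\<lambda>w. bump \<rho> p w *\<^sub>R f w)" using bump_scaleR_integrable[OF f] that by simp
    show "mollified \<rho> f p $ i = (LINT w|lebesgue. bump \<rho> p w * f w $ i)" "integrable lebesgue (\<lambda>w. bump \<rho> p w * f w $ i)"
      using integral_bounded_linear[OF bounded_linear_vec_nth int, of i] integrable_bounded_linear[OF bounded_linear_vec_nth int, of i]
      by (simp_all add: mollified_def)
  qed
  have near: "\<bar>w $ i - p $ i\<bar> \<le> \<rho>" if "bump \<rho> p w \<noteq> 0" "\<rho> > 0" for \<rho> p w and i :: 'd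
  proof -
    have "norm (w - p) < \<rho>" using bump_eq_0[of \<rho> w p] that by force
    then show ?thesis using component_le_norm_cart[of "w - p" i] by simp
  qed
  have comp: "f x $ i - f y $ i \<le> (\<Sum>j\<in>UNIV. \<bar>x $ j - y $ j\<bar>) * M" for x y i
  proof -
    have approx: "f x $ i - f y $ i \<le> (\<Sum>j\<in>UNIV. \<bar>x $ j - y $ j\<bar> + 2 * \<rho>) * M + 4 * \<rho> * c" if \<rho>: "\<rho> > 0" for \<rho>
    proof -
      \<comment> \<open>The ball of radius \<open>\<rho>\<close> around \<open>p\<close> lies above \<open>x\<close>, that around \<open>q\<close> below \<open>y\<close>.\<close>
      define p where "p = x + \<rho> *\<^sub>R e"
      define q where "q = y - \<rho> *\<^sub>R e"
      define m where "m = bump_mass \<rho> TYPE(real^'d)"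
      have "m > 0" unfolding m_def by (rule bump_mass_pos[OF \<rho>])
      have bint: "integrable lebesgue (bump \<rho> r)" for r :: "real^'d" using bump_integrable[of \<rho> r] \<rho> by simp
      have up: "m * f x $ i \<le> mollified \<rho> f p $ i + 2 * \<rho> * c * m"
      proof -
        have "(LINT w|lebesgue. bump \<rho> p w * f x $ i) \<le> (LINT w|lebesgue. bump \<rho> p w * f w $ i + 2 * \<rho> * c * bump \<rho> p w)"
        proof (rule integral_mono)
          fix w
          show "bump \<rho> p w * f x $ i \<le> bump \<rho> p w * f w $ i + 2 * \<rho> * c * bump \<rho> p w"
          proof (cases "bump \<rho> p w = 0")
            case False
            have w: "x $ j \<le> w $ j" "w $ j \<le> x $ j + 2 * \<rho>" for j
              using near[OF False \<rho>, of j] by (auto simp: p_def e_def)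
            have "f x $ i + c * x $ i \<le> f w $ i + c * w $ i"
              using monoD[OF mono, of x w] w(1) by (simp add: less_eq_vec_def)
            also have "\<dots> \<le> f w $ i + c * (x $ i + 2 * \<rho>)" using w(2)[of i] c by (intro add_left_mono mult_left_mono)
            finally have "f x $ i \<le> f w $ i + 2 * \<rho> * c" by (simp add: algebra_simps)
            then show ?thesis using mult_left_mono[OF _ bump_nonneg] by (metis distrib_left mult.commute)
          qed simp
        qed (use bint mol(2)[OF \<rho>] in auto)
        then show ?thesis using bint mol[OF \<rho>] by (simp add: integral_bump m_def)
      qed
      have lo: "mollified \<rho> f q $ i \<le> m * f y $ i + 2 * \<rho> * c * m"
      proof -
        have "(LINT w|lebesgue. bump \<rho> q w * f w $ i) \<le> (LINT w|lebesgue. bump \<rho> q w * f y $ i + 2 * \<rho> * c * bump \<rho> q w)"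
        proof (rule integral_mono)
          fix w
          show "bump \<rho> q w * f w $ i \<le> bump \<rho> q w * f y $ i + 2 * \<rho> * c * bump \<rho> q w"
          proof (cases "bump \<rho> q w = 0")
            case False
            have w: "w $ j \<le> y $ j" "y $ j \<le> w $ j + 2 * \<rho>" for j
              using near[OF False \<rho>, of j] by (auto simp: q_def e_def)
            have "f w $ i + c * w $ i \<le> f y $ i + c * y $ i"
              using monoD[OF mono, of w y] w(1) by (simp add: less_eq_vec_def)
            also have "\<dots> \<le> f y $ i + c * (w $ i + 2 * \<rho>)" using w(2)[of i] c by (intro add_left_mono mult_left_mono)
            finally have "f w $ i \<le> f y $ i + 2 * \<rho> * c" by (simp add: algebra_simps)
            then show ?thesis using mult_left_mono[OF _ bump_nonneg] by (metis distrib_left mult.commute)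
          qed simp
        qed (use bint mol(2)[OF \<rho>] in auto)
        then show ?thesis using bint mol[OF \<rho>] by (simp add: integral_bump m_def)
      qed
      have "m * (f x $ i - f y $ i) \<le> (mollified \<rho> f p - mollified \<rho> f q) $ i + 4 * \<rho> * c * m"
        using up lo by (simp add: algebra_simps)
      also have "(mollified \<rho> f p - mollified \<rho> f q) $ i \<le> (\<Sum>j\<in>UNIV. \<bar>p $ j - q $ j\<bar>) * (M * m)"
        using component_le_norm_cart[of "mollified \<rho> f p - mollified \<rho> f q" i]
          mollified_lipschitz_weak_gradient[OF G M, of \<rho> p q] \<rho> by (simp add: m_def)
      also have "(\<Sum>j\<in>UNIV. \<bar>p $ j - q $ j\<bar>) * (M * m) \<le> (\<Sum>j\<in>UNIV. \<bar>x $ j - y $ j\<bar> + 2 * \<rho>) * (M * m)"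
        using \<open>M \<ge> 0\<close> \<open>m > 0\<close> \<rho> by (intro mult_right_mono sum_mono) (auto simp: p_def q_def e_def)
      finally have "m * (f x $ i - f y $ i) \<le> m * ((\<Sum>j\<in>UNIV. \<bar>x $ j - y $ j\<bar> + 2 * \<rho>) * M + 4 * \<rho> * c)"
        by (simp add: distrib_left mult_ac)
      then show ?thesis using \<open>m > 0\<close> by (rule mult_left_le_imp_le)
    qed
    have "((\<lambda>\<rho>. (\<Sum>j\<in>UNIV. \<bar>x $ j - y $ j\<bar> + 2 * \<rho>) * M + 4 * \<rho> * c) \<longlongrightarrow>
        (\<Sum>j\<in>UNIV. \<bar>x $ j - y $ j\<bar> + 2 * 0) * M + 4 * 0 * c) (at_right 0)"
      by (intro tendsto_intros)
    then have "f x $ i - f y $ i \<le> (\<Sum>j\<in>UNIV. \<bar>x $ j - y $ j\<bar> + 2 * 0) * M + 4 * 0 * c"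
    proof (rule tendsto_lowerbound)
      show "\<forall>\<^sub>F \<rho> in at_right 0. f x $ i - f y $ i \<le> (\<Sum>j\<in>UNIV. \<bar>x $ j - y $ j\<bar> + 2 * \<rho>) * M + 4 * \<rho> * c"
        using approx by (auto simp: eventually_at_right_field intro!: exI[of _ 1])
    qed simp
    then show ?thesis by simp
  qed
  have "norm (f x - f y) \<le> real CARD('d) * ((\<Sum>j\<in>UNIV. \<bar>(x - y) $ j\<bar>) * M)"
  proof (rule norm_le_card_times)
    fix i
    have "(\<Sum>j\<in>UNIV. \<bar>y $ j - x $ j\<bar>) = (\<Sum>j\<in>UNIV. \<bar>x $ j - y $ j\<bar>)" by (simp add: abs_minus_commute)
    then show "\<bar>(f x - f y) $ i\<bar> \<le> (\<Sum>j\<in>UNIV. \<bar>(x - y) $ j\<bar>) * M"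
      using comp[of x i y] comp[of y i x] by (auto simp: abs_le_iff)
  qed
  also have "\<dots> \<le> real CARD('d) * ((real CARD('d) * norm (x - y)) * M)"
  proof -
    have "(\<Sum>j\<in>UNIV. \<bar>(x - y) $ j\<bar>) \<le> (\<Sum>j\<in>(UNIV :: 'd set). norm (x - y))"
      by (intro sum_mono component_le_norm_cart)
    then show ?thesis using \<open>M \<ge> 0\<close> by (intro mult_left_mono mult_right_mono) auto
  qed
  finally show ?thesis by (simp add: power2_eq_square mult_ac)
qed

section \<open>Integrable Lipschitz constants and Borel versions of the fields\<close>

text \<open>Points of the dense set slightly above and slightly below \<open>x\<close> in every component bound the value at \<open>x\<close>.\<close>

lemma mono_dense_approx:
  fixes f :: "real^'d \<Rightarrow> real^'d"
  assumes mono: "mono (\<lambda>x. f x + c *\<^sub>R x)" and c: "c \<ge> 0" and \<delta>: "\<delta> > 0"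
    and D: "\<And>U :: (real^'d) set. open U \<Longrightarrow> U \<noteq> {} \<Longrightarrow> \<exists>x\<in>D. x \<in> U"
  obtains u v where "u \<in> D" "norm (u - x) \<le> real CARD('d) * \<delta>" "\<And>i. f x $ i \<le> f u $ i + c * \<delta>"
    "v \<in> D" "norm (v - x) \<le> real CARD('d) * \<delta>" "\<And>i. f v $ i \<le> f x $ i + c * \<delta>"
proof -
  define one :: "real^'d" where "one = (\<chi> i. 1)"
  have "box x (x + \<delta> *\<^sub>R one) \<noteq> {}" "box (x - \<delta> *\<^sub>R one) x \<noteq> {}"
    using \<delta> by (auto simp: box_ne_empty Basis_vec_def inner_axis one_def)
  then obtain u v where u: "u \<in> D" "u \<in> box x (x + \<delta> *\<^sub>R one)" and v: "v \<in> D" "v \<in> box (x - \<delta> *\<^sub>R one) x"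
    using D open_box by meson
  have uj: "x $ j < u $ j" "u $ j < x $ j + \<delta>" for j using u(2) by (auto simp: mem_box_cart one_def)
  have vj: "x $ j - \<delta> < v $ j" "v $ j < x $ j" for j using v(2) by (auto simp: mem_box_cart one_def)
  have step: "f y $ i \<le> f z $ i + c * \<delta>" if "\<And>j. y $ j < z $ j" "z $ i < y $ i + \<delta>" for y z i
  proof -
    have "f y $ i + c * y $ i \<le> f z $ i + c * z $ i"
      using monoD[OF mono, of y z] that(1) by (simp add: less_eq_vec_def less_imp_le)
    also have "\<dots> \<le> f z $ i + c * (y $ i + \<delta>)"
      using that(2) c by (intro add_left_mono mult_left_mono) auto
    finally show ?thesis by (simp add: algebra_simps)
  qed
  show ?thesis
  proof (rule that[OF u(1) norm_le_card_times step v(1) norm_le_card_times step])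
    show "\<bar>(u - x) $ j\<bar> \<le> \<delta>" for j using uj[of j] by simp
    show "\<bar>(v - x) $ j\<bar> \<le> \<delta>" for j using vj[of j] by simp
    show "x $ i < v $ i + \<delta>" for i using vj(1)[of i] by linarith
  qed (use uj vj in auto)
qed

lemma mono_lipschitz_dense:
  fixes f :: "real^'d \<Rightarrow> real^'d"
  assumes mono: "mono (\<lambda>x. f x + c *\<^sub>R x)" and c: "c \<ge> 0" and K: "K \<ge> 0"
    and D: "\<And>U :: (real^'d) set. open U \<Longrightarrow> U \<noteq> {} \<Longrightarrow> \<exists>x\<in>D. x \<in> U"
    and lip: "\<And>x y. x \<in> D \<Longrightarrow> y \<in> D \<Longrightarrow> norm (f x - f y) \<le> K * norm (x - y)"
  shows "norm (f x - f y) \<le> real CARD('d) * (K * norm (x - y))"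
proof -
  have comp: "f x $ i - f y $ i \<le> K * norm (x - y)" for x y i
  proof (rule field_le_epsilon)
    fix e :: real assume "e > 0"
    define A where "A = 2 * (K * real CARD('d) + c)"
    define \<delta> where "\<delta> = e / (A + 1)"
    have A: "A \<ge> 0" using K c by (simp add: A_def)
    then have \<delta>: "\<delta> > 0" using \<open>e > 0\<close> by (simp add: \<delta>_def add_nonneg_pos)
    obtain u where u: "u \<in> D" "norm (u - x) \<le> real CARD('d) * \<delta>" "\<And>i. f x $ i \<le> f u $ i + c * \<delta>"
      by (rule mono_dense_approx[OF mono c \<delta> D]) blast+
    obtain v where v: "v \<in> D" "norm (v - y) \<le> real CARD('d) * \<delta>" "\<And>i. f v $ i \<le> f y $ i + c * \<delta>"
      by (rule mono_dense_approx[OF mono c \<delta> D]) blast+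
    have "f u $ i - f v $ i \<le> norm (f u - f v)" using component_le_norm_cart[of "f u - f v" i] by simp
    also have "\<dots> \<le> K * norm (u - v)" by (rule lip[OF u(1) v(1)])
    also have "\<dots> \<le> K * (norm (x - y) + 2 * (real CARD('d) * \<delta>))"
      using u(2) v(2) norm_triangle_ineq[of "(u - x) - (v - y)" "x - y"] norm_triangle_ineq4[of "u - x" "v - y"] K
      by (intro mult_left_mono) (simp_all add: algebra_simps)
    finally have "f x $ i - f y $ i \<le> K * norm (x - y) + A * \<delta>"
      using u(3)[of i] v(3)[of i] by (simp add: A_def algebra_simps)
    also have "A * \<delta> \<le> (A + 1) * \<delta>" using \<delta> by (intro mult_right_mono) auto
    also have "\<dots> = e" using A by (simp add: \<delta>_def add_nonneg_pos less_imp_neq[symmetric])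
    finally show "f x $ i - f y $ i \<le> K * norm (x - y) + e" by simp
  qed
  show ?thesis
    by (rule norm_le_card_times) (use comp[of x _ y] comp[of y _ x] in \<open>auto simp: abs_le_iff norm_minus_commute\<close>)
qed

lemma mono_growth_everywhere:
  fixes f :: "real^'d \<Rightarrow> real^'d"
  assumes mono: "mono (\<lambda>x. f x + c *\<^sub>R x)" and c: "c \<ge> 0" and a: "a \<ge> 0"
    and bound: "AE y in lborel. norm (f y) \<le> a * (1 + norm y)"
  shows "norm (f x) \<le> real CARD('d) * (a * (1 + norm x))"
proof (rule norm_le_card_times, rule field_le_epsilon)
  fix i and e :: real assume "e > 0"
  obtain D where D: "\<And>y. y \<in> D \<Longrightarrow> norm (f y) \<le> a * (1 + norm y)"
    "\<And>U. open U \<Longrightarrow> U \<noteq> {} \<Longrightarrow> \<exists>x\<in>D. x \<in> U"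
    using countable_dense_subset_AE[OF bound] by metis
  define A where "A = a * real CARD('d) + c"
  define \<delta> where "\<delta> = e / (A + 1)"
  have A: "A \<ge> 0" using a c by (simp add: A_def)
  then have \<delta>: "\<delta> > 0" using \<open>e > 0\<close> by (simp add: \<delta>_def add_nonneg_pos)
  obtain u v where u: "u \<in> D" "norm (u - x) \<le> real CARD('d) * \<delta>" "\<And>i. f x $ i \<le> f u $ i + c * \<delta>"
    and v: "v \<in> D" "norm (v - x) \<le> real CARD('d) * \<delta>" "\<And>i. f v $ i \<le> f x $ i + c * \<delta>"
    by (rule mono_dense_approx[OF mono c \<delta> D(2)]) blast+
  have near: "\<bar>f z $ i\<bar> \<le> a * (1 + (norm x + real CARD('d) * \<delta>))" if "z \<in> D" "norm (z - x) \<le> real CARD('d) * \<delta>" for z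
  proof -
    have "norm z \<le> norm x + real CARD('d) * \<delta>" using norm_triangle_ineq2[of z x] that(2) by linarith
    then have "a * (1 + norm z) \<le> a * (1 + (norm x + real CARD('d) * \<delta>))" using a by (intro mult_left_mono) auto
    then show ?thesis using component_le_norm_cart[of "f z" i] D(1)[OF that(1)] by linarith
  qed
  have "\<bar>f x $ i\<bar> \<le> a * (1 + (norm x + real CARD('d) * \<delta>)) + c * \<delta>"
    using near[OF u(1,2)] near[OF v(1,2)] u(3)[of i] v(3)[of i] by linarith
  also have "\<dots> = a * (1 + norm x) + A * \<delta>" by (simp add: A_def algebra_simps)
  also have "A * \<delta> \<le> (A + 1) * \<delta>" using \<delta> by (intro mult_right_mono) auto
  also have "\<dots> = e" using A by (simp add: \<delta>_def add_nonneg_pos less_imp_neq[symmetric])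
  finally show "\<bar>f x $ i\<bar> \<le> a * (1 + norm x) + e" by simp
qed

text \<open>Every weak gradient bounds the difference quotients by its own essential supremum, so the infimum over all of them
  does; it is \<open>\<infinity>\<close> if there is none.\<close>

lemma le_gradient_sup_norm:
  fixes f :: "real^'d \<Rightarrow> real^'d"
  assumes mono: "mono (\<lambda>x. f x + c *\<^sub>R x)" and c: "c \<ge> 0"
  shows "ennreal (norm (f x - f y) / (real CARD('d) ^ 2 * norm (x - y))) \<le> gradient_sup_norm f"
  unfolding gradient_sup_norm_def
proof (rule INF_greatest, clarify)
  fix G assume G: "weak_gradient f G"
  define e where "e = esssup lebesgue (\<lambda>x. ennreal (norm (G x)))"
  show "ennreal (norm (f x - f y) / (real CARD('d) ^ 2 * norm (x - y))) \<le> esssup lebesgue (\<lambda>x. ennreal (norm (G x)))"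
  proof (cases "e = \<infinity> \<or> x = y")
    case True
    then show ?thesis by (auto simp: e_def)
  next
    case False
    have "AE x in lebesgue. ennreal (norm (G x)) \<le> e" unfolding e_def by (rule esssup_AE)
    then have M: "AE x in lebesgue. norm (G x) \<le> enn2real e"
    proof (rule AE_mp, intro AE_I2 impI)
      fix x assume "ennreal (norm (G x)) \<le> e"
      then show "norm (G x) \<le> enn2real e" using False enn2real_mono[of "ennreal (norm (G x))" e] by (simp add: less_top)
    qed
    have "norm (f x - f y) / (real CARD('d) ^ 2 * norm (x - y)) \<le> enn2real e"
      using weak_gradient_lipschitz[OF G M mono c, of x y] False by (simp add: divide_le_eq mult_ac)
    then show ?thesis using False unfolding e_def[symmetric]
      by (metis ennreal_enn2real ennreal_leI infinity_ennreal_def less_top)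
  qed
qed


text \<open>The function \<open>t \<mapsto> gradient_sup_norm (b t)\<close> need not be measurable, and its integral is then only a supremum
  over the simple functions below it, which provides no integrable majorant.  The supremum of the difference
  quotients over a countable dense set is measurable and lies below it.\<close>

lemma integrable_lipschitz_constant_and_borel_version:
  fixes b :: "real \<Rightarrow> real^'d \<Rightarrow> real^'d"
  assumes meas: "(\<lambda>(t, x). b t x) \<in> borel_measurable (lebesgue_on ({0..T} \<times> UNIV))"
    and mono: "AE t in lborel. t \<in> {0..T} \<longrightarrow> mono (\<lambda>x. b t x + c t *\<^sub>R x)"
    and c: "AE t in lborel. t \<in> {0..T} \<longrightarrow> 0 \<le> c t"
    and grad: "(\<integral>\<^sup>+ t\<in>{0..T}. gradient_sup_norm (b t) \<partial>lebesgue) < \<infinity>"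
  obtains L B where "L absolutely_integrable_on {0..T}" "\<And>t. 0 \<le> L t"
    "B \<in> borel_measurable (borel :: (real \<times> (real^'d)) measure)"
    "AE t in lborel. t \<in> {0..T} \<longrightarrow>
      (\<forall>x y. norm (b t x - b t y) \<le> L t * norm (x - y)) \<and> (\<forall>y. B (t, y) = b t y)"
proof -
  define S where "S = {0..T} \<times> (UNIV :: (real^'d) set)"
  have "closed S" unfolding S_def by (intro closed_Times) auto
  then have S: "S \<in> sets lebesgue" by (simp add: borel_closed sets_completionI_sets)
  define b0 where "b0 p = (if p \<in> S then b (fst p) (snd p) else 0)" for p
  have "b0 \<in> borel_measurable lebesgue"
    using meas borel_measurable_if[OF S, of "\<lambda>p. b (fst p) (snd p)"]
    unfolding S_def[symmetric] b0_def[abs_def] case_prod_beta' by blast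
  then obtain F where F: "F \<in> borel_measurable borel" "AE p in lborel. b0 p = F p"
    by (rule lebesgue_ex_borel_version)
  obtain D where D: "countable D" "\<And>y. y \<in> D \<Longrightarrow> AE t in lborel. b0 (t, y) = F (t, y)"
    "\<And>U. open U \<Longrightarrow> U \<noteq> {} \<Longrightarrow> \<exists>x\<in>D. x \<in> U"
    by (rule countable_dense_subset_AE[OF AE_lborel_commute[OF F(2)]]) blast
  have FD: "AE t in lborel. t \<in> {0..T} \<longrightarrow> (\<forall>y\<in>D. F (t, y) = b t y)"
  proof -
    have "AE t in lborel. \<forall>y\<in>D. b0 (t, y) = F (t, y)" using D(1,2) by (simp add: AE_ball_countable)
    then show ?thesis by (rule AE_mp) (auto intro!: AE_I2 simp: b0_def S_def)
  qed
  define k where "k = real CARD('d) ^ 2"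
  have k: "k > 0" by (simp add: k_def)
  define lip where "lip t = (SUP p\<in>D \<times> D. ennreal (norm (F (t, fst p) - F (t, snd p)) / (k * norm (fst p - snd p))))" for t
  note Fsec = borel_measurable_sections(2)[OF F(1)]
  have lip_meas: "lip \<in> borel_measurable borel"
    unfolding lip_def
  proof (rule borel_measurable_SUP)
    show "countable (D \<times> D)" using D(1) by simp
    note [measurable] = Fsec
    show "(\<lambda>t. ennreal (norm (F (t, fst p) - F (t, snd p)) / (k * norm (fst p - snd p)))) \<in> borel_measurable borel" for p
      by measurable
  qed
  have lip_le: "AE t in lborel. t \<in> {0..T} \<longrightarrow> lip t \<le> gradient_sup_norm (b t)"
    using FD mono c
  proof eventually_elim
    case (elim t)
    show ?case
    proof
      assume t: "t \<in> {0..T}"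
      show "lip t \<le> gradient_sup_norm (b t)"
        unfolding lip_def k_def using elim t by (intro SUP_least) (auto intro!: le_gradient_sup_norm[where c = "c t"])
    qed
  qed
  \<comment> \<open>One factor \<open>CARD('d)\<close> is lost in passing from the dense set to all points.\<close>
  define C where "C = real CARD('d) * k"
  have C: "C \<ge> 0" using k by (simp add: C_def)
  define L where "L t = C * enn2real (lip t)" for t
  have lip_int: "(\<integral>\<^sup>+ t\<in>{0..T}. lip t \<partial>lebesgue) < \<infinity>"
  proof (rule order.strict_trans1[OF nn_integral_mono_AE grad])
    show "AE t in lebesgue. lip t * indicator {0..T} t \<le> gradient_sup_norm (b t) * indicator {0..T} t"
      using AE_completion[OF lip_le] by (rule AE_mp) (auto intro!: AE_I2 simp: indicator_def)
  qed
  have lip_fin: "AE t in lborel. t \<in> {0..T} \<longrightarrow> lip t \<noteq> \<infinity>"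
  proof -
    have "AE t in lebesgue. lip t * indicator {0..T} t \<noteq> \<infinity>"
      using lip_int lip_meas by (intro nn_integral_PInf_AE) (auto intro: measurable_completion)
    then show ?thesis unfolding AE_completion_iff by (rule AE_mp) (auto intro!: AE_I2)
  qed
  have L_meas: "L \<in> borel_measurable borel" unfolding L_def using lip_meas by measurable
  show ?thesis
  proof
    show "0 \<le> L t" for t unfolding L_def using C by simp
    show "L absolutely_integrable_on {0..T}"
      unfolding set_integrable_def
    proof (rule integrableI_bounded)
      show "(\<lambda>t. indicator {0..T} t *\<^sub>R L t) \<in> borel_measurable lebesgue"
        using L_meas by (intro measurable_completion) (auto intro!: borel_measurable_scaleR)
      have "(\<integral>\<^sup>+ t. ennreal (norm (indicator {0..T} t *\<^sub>R L t)) \<partial>lebesgue)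
          \<le> (\<integral>\<^sup>+ t. ennreal C * (lip t * indicator {0..T} t) \<partial>lebesgue)"
      proof (rule nn_integral_mono)
        fix t
        have "ennreal (C * enn2real (lip t)) \<le> ennreal C * lip t"
          using C by (cases "lip t") (auto simp: ennreal_mult ennreal_mult_eq_top_iff)
        then show "ennreal (norm (indicator {0..T} t *\<^sub>R L t)) \<le> ennreal C * (lip t * indicator {0..T} t)"
          using C by (auto simp: L_def indicator_def abs_mult)
      qed
      also have "\<dots> = ennreal C * (\<integral>\<^sup>+ t\<in>{0..T}. lip t \<partial>lebesgue)"
        using lip_meas by (intro nn_integral_cmult) (auto intro: measurable_completion)
      also have "\<dots> < \<infinity>" using lip_int by (simp add: ennreal_mult_less_top)
      finally show "(\<integral>\<^sup>+ t. ennreal (norm (indicator {0..T} t *\<^sub>R L t)) \<partial>lebesgue) < \<infinity>" .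
    qed
    \<comment> \<open>McShane's formula recovers a Lipschitz function from its values on a dense set, here as a countable infimum of
    Borel functions of both variables.\<close>
    define B where "B p = (\<chi> i. INF z\<in>D. F (fst p, z) $ i + L (fst p) * norm (z - snd p))" for p :: "real \<times> (real^'d)"
    show "B \<in> borel_measurable borel"
    proof (rule borel_measurable_vecI)
      fix i
      have "(\<lambda>p. F (fst p, z)) \<in> borel_measurable borel" for z
        by (rule measurable_compose[OF borel_measurable_continuous_onI Fsec]) (intro continuous_intros)
      moreover have "(\<lambda>p. L (fst p)) \<in> borel_measurable (borel :: (real \<times> (real^'d)) measure)"
        by (rule measurable_compose[OF borel_measurable_continuous_onI L_meas]) (intro continuous_intros)
      moreover have "(\<lambda>p. norm (z - snd p)) \<in> borel_measurable (borel :: (real \<times> (real^'d)) measure)" for z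
        by (intro borel_measurable_continuous_onI continuous_intros)
      ultimately show "(\<lambda>p. B p $ i) \<in> borel_measurable borel"
        unfolding B_def using D(1)
        by (auto intro!: borel_measurable_cINF_real borel_measurable_add borel_measurable_times borel_measurable_vec_nth)
    qed
    show "AE t in lborel. t \<in> {0..T} \<longrightarrow>
      (\<forall>x y. norm (b t x - b t y) \<le> L t * norm (x - y)) \<and> (\<forall>y. B (t, y) = b t y)"
      using FD mono c lip_fin
    proof eventually_elim
      case (elim t)
      show ?case
      proof
        assume t: "t \<in> {0..T}"
        have Db: "F (t, y) = b t y" if "y \<in> D" for y using elim t that by blast
        have lipD: "norm (b t x - b t y) \<le> k * enn2real (lip t) * norm (x - y)" if "x \<in> D" "y \<in> D" for x y
        proof (cases "x = y")
          case False
          have "ennreal (norm (b t x - b t y) / (k * norm (x - y))) \<le> lip t"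
            unfolding lip_def using that by (intro SUP_upper2[of "(x, y)"]) (auto simp: Db)
          then have "norm (b t x - b t y) / (k * norm (x - y)) \<le> enn2real (lip t)"
            using enn2real_mono[of "ennreal (norm (b t x - b t y) / (k * norm (x - y)))" "lip t"] elim t k
            by (simp add: less_top)
          then show ?thesis using False k by (simp add: divide_le_eq mult_ac)
        qed simp
        have lipL: "norm (b t x - b t y) \<le> L t * norm (x - y)" for x y
          using mono_lipschitz_dense[of "b t" "c t" "k * enn2real (lip t)" D, OF _ _ _ D(3) lipD] elim t k
          by (simp add: L_def C_def mult_ac)
        have L0: "L t \<ge> 0" unfolding L_def using C by simp
        have "B (t, y) $ i = b t y $ i" for y i
        proof -
          define h where "h z = F (t, z) $ i + L t * norm (z - y)" for z
          have lower: "b t y $ i \<le> h z" if "z \<in> D" for z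
            using component_le_norm_cart[of "b t y - b t z" i] lipL[of y z] Db[OF that]
            by (simp add: h_def norm_minus_commute)
          have bdd: "bdd_below (h ` D)" using lower by (auto intro!: bdd_belowI2)
          have "D \<noteq> {}" using D(3)[of UNIV] by auto
          have "(INF z\<in>D. h z) \<le> b t y $ i + e" if "e > 0" for e
          proof -
            have "ball y (e / (2 * L t + 1)) \<noteq> {}" using that L0 by (simp add: add_nonneg_pos not_le)
            then obtain z where z: "z \<in> D" "z \<in> ball y (e / (2 * L t + 1))" using D(3) open_ball by meson
            have "b t z $ i - b t y $ i \<le> L t * norm (z - y)"
              using component_le_norm_cart[of "b t z - b t y" i] lipL[of z y] by simp
            then have "h z \<le> b t y $ i + 2 * L t * norm (z - y)" using Db[OF z(1)] by (simp add: h_def)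
            also have "2 * L t * norm (z - y) \<le> (2 * L t + 1) * (e / (2 * L t + 1))"
              using z(2) L0 by (intro mult_mono) (auto simp: dist_norm norm_minus_commute)
            also have "\<dots> = e" using L0 by (simp add: add_nonneg_pos less_imp_neq[symmetric])
            finally show ?thesis using cINF_lower[OF bdd z(1)] by simp
          qed
          then have "(INF z\<in>D. h z) \<le> b t y $ i" by (rule field_le_epsilon)
          moreover have "b t y $ i \<le> (INF z\<in>D. h z)" using \<open>D \<noteq> {}\<close> lower by (intro cINF_greatest)
          ultimately show ?thesis by (simp add: B_def h_def)
        qed
        then show "(\<forall>x y. norm (b t x - b t y) \<le> L t * norm (x - y)) \<and> (\<forall>y. B (t, y) = b t y)"
          using lipL by (auto simp: vec_eq_iff)
      qed
    qed
  qed
qed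

section \<open>Monotone sequences of functions along the diagonal direction\<close>

abbreviation diagonal :: "real^'d" where "diagonal \<equiv> (\<chi> i. 1)"

text \<open>The average of the measures of the translates of \<open>A\<close> along a diagonal segment is the measure of \<open>A\<close>, by translation
  invariance, and it is \<open>0\<close>, by Fubini.\<close>

lemma AE_not_in_countable_diagonals:
  fixes A :: "(real^'d) set"
  assumes A: "A \<in> sets borel" and lines: "\<And>x. countable {r. x + r *\<^sub>R diagonal \<in> A}"
  shows "AE x in lborel. x \<notin> A"
proof -
  have shift: "(\<lambda>p. fst p + snd p *\<^sub>R diagonal) \<in> borel_measurable (borel :: ((real^'d) \<times> real) measure)"
    by (intro borel_measurable_continuous_onI continuous_intros)
  have A2: "(\<lambda>(x, r). indicator A (x + r *\<^sub>R diagonal) * indicator {0..1} r :: ennreal)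
      \<in> borel_measurable (lborel \<Otimes>\<^sub>M lborel)"
  proof -
    have "(\<lambda>p. indicator A (fst p + snd p *\<^sub>R diagonal) * indicator {0..1} (snd p) :: ennreal)
      \<in> borel_measurable (borel :: ((real^'d) \<times> real) measure)"
    proof (rule borel_measurable_times_ennreal)
      show "(\<lambda>p. indicator A (fst p + snd p *\<^sub>R diagonal) :: ennreal) \<in> borel_measurable (borel :: ((real^'d) \<times> real) measure)"
        using A by (intro measurable_compose[OF shift]) simp
      have "snd \<in> borel_measurable (borel :: ((real^'d) \<times> real) measure)"
        by (intro borel_measurable_continuous_onI continuous_intros)
      then show "(\<lambda>p. indicator {0..1} (snd p) :: ennreal) \<in> borel_measurable (borel :: ((real^'d) \<times> real) measure)"
        by (rule measurable_compose) simp
    qed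
    then show ?thesis unfolding lborel_prod by (simp add: case_prod_beta')
  qed
  have trans: "(\<integral>\<^sup>+x. indicator A (x + v) \<partial>lborel) = emeasure lborel A" for v :: "real^'d"
  proof -
    have "emeasure lborel A = (\<integral>\<^sup>+x. indicator A x \<partial>distr lborel borel ((+) v))"
      unfolding lborel_distr_plus using A by simp
    also have "\<dots> = (\<integral>\<^sup>+x. indicator A (x + v) \<partial>lborel)"
      using A by (subst nn_integral_distr) (auto simp: add.commute)
    finally show ?thesis by simp
  qed
  have "(\<integral>\<^sup>+r. \<integral>\<^sup>+x. indicator A (x + r *\<^sub>R diagonal) * indicator {0..1} r \<partial>lborel \<partial>lborel)
      = (\<integral>\<^sup>+(r::real). emeasure lborel A * indicator {0..1} r \<partial>lborel)"
    using A by (intro nn_integral_cong) (simp add: indicator_def trans[unfolded indicator_def])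
  also have "\<dots> = emeasure lborel A" by (simp add: nn_integral_cmult)
  finally have 1: "(\<integral>\<^sup>+r. \<integral>\<^sup>+x. indicator A (x + r *\<^sub>R diagonal) * indicator {0..1::real} r \<partial>lborel \<partial>lborel) = emeasure lborel A" .
  have "(\<integral>\<^sup>+x. \<integral>\<^sup>+r. indicator A (x + r *\<^sub>R diagonal) * indicator {0..1::real} r \<partial>lborel \<partial>lborel) = (\<integral>\<^sup>+(x::real^'d). 0 \<partial>lborel)"
  proof (rule nn_integral_cong)
    fix x :: "real^'d"
    have "AE r in lborel. r \<notin> {r. x + r *\<^sub>R diagonal \<in> A}"
      using countable_imp_null_set_lborel[OF lines[of x]] by (rule AE_not_in)
    then have "AE r in lborel. indicator A (x + r *\<^sub>R diagonal) * indicator {0..1} r = (0 :: ennreal)"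
      by (rule AE_mp) (auto intro!: AE_I2)
    then have "(\<integral>\<^sup>+r. indicator A (x + r *\<^sub>R diagonal) * indicator {0..1::real} r \<partial>lborel) = (\<integral>\<^sup>+r. 0 \<partial>(lborel :: real measure))"
      by (rule nn_integral_cong_AE)
    then show "(\<integral>\<^sup>+r. indicator A (x + r *\<^sub>R diagonal) * indicator {0..1::real} r \<partial>lborel) = 0" by simp
  qed
  then have "emeasure lborel A = 0"
    using lborel_pair.Fubini'[OF A2] 1 by simp
  then show ?thesis using A by (intro AE_not_in) auto
qed

lemma not_convergent_oscillates:
  fixes h :: "nat \<Rightarrow> real"
  assumes bd: "\<And>n. \<bar>h n\<bar> \<le> M" and nc: "\<not> convergent h"
  obtains p q where "p \<in> \<rat>" "q \<in> \<rat>" "p < q"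
    "\<not> (\<forall>\<^sub>F n in sequentially. h n \<ge> p)" "\<not> (\<forall>\<^sub>F n in sequentially. h n \<le> q)"
proof -
  define l u where "l = liminf (\<lambda>n. ereal (h n))" and "u = limsup (\<lambda>n. ereal (h n))"
  have "l \<le> u" unfolding l_def u_def by (rule Liminf_le_Limsup) simp
  moreover have "l \<noteq> u"
  proof
    assume "l = u"
    then have conv: "(\<lambda>n. ereal (h n)) \<longlonglongrightarrow> l"
      unfolding l_def u_def by (intro Liminf_eq_Limsup) auto
    have "- M \<le> h n" "h n \<le> M" for n using bd[of n] by linarith+
    then have "ereal (- M) \<le> l" "l \<le> ereal M"
      by (auto intro: LIMSEQ_le_const[OF conv] LIMSEQ_le_const2[OF conv])
    then obtain x where "l = ereal x" by (cases l) auto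
    with conv have "h \<longlonglongrightarrow> x" by simp
    with nc show False by (auto simp: convergent_def)
  qed
  ultimately have "l < u" by simp
  then obtain x where x: "l < ereal x" "ereal x < u" using ereal_dense2 by blast
  then obtain y where y: "ereal x < ereal y" "ereal y < u" using ereal_dense2 by blast
  have "x < y" using y by simp
  then obtain p where p: "p \<in> \<rat>" "x < p" "p < y" using Rats_dense_in_real by blast
  then obtain q where q: "q \<in> \<rat>" "p < q" "q < y" using Rats_dense_in_real by blast
  show ?thesis
  proof
    show "\<not> (\<forall>\<^sub>F n in sequentially. h n \<ge> p)"
    proof
      assume "\<forall>\<^sub>F n in sequentially. h n \<ge> p"
      then have "ereal p \<le> l" unfolding l_def by (intro Liminf_bounded) simp
      moreover have "l < ereal p" using x(1) p(2) by (rule_tac order.strict_trans[of l "ereal x"]) simp_all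
      ultimately show False by simp
    qed
    show "\<not> (\<forall>\<^sub>F n in sequentially. h n \<le> q)"
    proof
      assume "\<forall>\<^sub>F n in sequentially. h n \<le> q"
      then have "u \<le> ereal q" unfolding u_def by (intro Limsup_bounded) simp
      moreover have "ereal q < u" using y(2) q(3) by (rule_tac order.strict_trans[of "ereal q" "ereal y"]) simp_all
      ultimately show False by simp
    qed
  qed (use p q in auto)
qed

text \<open>If the values at two points of a diagonal line are always separated by a convergent sequence, then
  the oscillation intervals at different points of the line do not overlap, so that at most countably
  many points of each line have a nontrivial one.\<close>

lemma AE_convergent_separated_diagonals:
  fixes h :: "nat \<Rightarrow> real^'d \<Rightarrow> real" and H :: "(real^'d) set"
  assumes h: "\<And>n. h n \<in> borel_measurable borel" and H: "H \<in> sets borel"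
    and bd: "\<And>x. x \<in> H \<Longrightarrow> \<exists>M. \<forall>n. \<bar>h n x\<bar> \<le> M"
    and sep: "\<And>x r. x \<in> H \<Longrightarrow> x + r *\<^sub>R diagonal \<in> H \<Longrightarrow> 0 < r \<Longrightarrow>
      \<exists>q. convergent q \<and> (\<forall>\<^sub>F n in sequentially. h n x \<le> q n \<and> q n \<le> h n (x + r *\<^sub>R diagonal))"
  shows "AE x in lborel. x \<in> H \<longrightarrow> convergent (\<lambda>n. h n x)"
proof -
  define A where "A = {x \<in> H. \<not> convergent (\<lambda>n. h n x)}"
  have "{x \<in> space borel. Cauchy (\<lambda>n. h n x)} \<in> sets borel"
    using h by (rule sets_Collect_Cauchy)
  then have "A \<in> sets borel"
    using H sets.Diff[of H borel "{x. Cauchy (\<lambda>n. h n x)}"]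
    by (simp add: A_def Cauchy_convergent_iff set_diff_eq)
  moreover have "countable {r. x + r *\<^sub>R diagonal \<in> A}" for x
  proof -
    let ?S = "{r. x + r *\<^sub>R diagonal \<in> A}"
    define osc where "osc r p \<longleftrightarrow> fst p \<in> \<rat> \<and> snd p \<in> \<rat> \<and> fst p < snd p \<and>
      \<not> (\<forall>\<^sub>F n in sequentially. h n (x + r *\<^sub>R diagonal) \<ge> fst p) \<and>
      \<not> (\<forall>\<^sub>F n in sequentially. h n (x + r *\<^sub>R diagonal) \<le> snd p)" for r p
    have "\<exists>p. osc r p" if "r \<in> ?S" for r
    proof -
      from that have r: "x + r *\<^sub>R diagonal \<in> H" "\<not> convergent (\<lambda>n. h n (x + r *\<^sub>R diagonal))"
        by (auto simp: A_def)
      obtain M where "\<And>n. \<bar>h n (x + r *\<^sub>R diagonal)\<bar> \<le> M" using bd[OF r(1)] by blast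
      from not_convergent_oscillates[OF this r(2)] show ?thesis unfolding osc_def by (metis fst_conv snd_conv)
    qed
    then obtain g where g: "\<And>r. r \<in> ?S \<Longrightarrow> osc r (g r)" by metis
    have no: False if rr: "r \<in> ?S" "r' \<in> ?S" "r < r'" "g r = g r'" for r r'
    proof -
      let ?y = "x + r *\<^sub>R diagonal"
      have y': "?y + (r' - r) *\<^sub>R diagonal = x + r' *\<^sub>R diagonal" by (simp add: algebra_simps)
      obtain q where q: "convergent q"
        "\<forall>\<^sub>F n in sequentially. h n ?y \<le> q n \<and> q n \<le> h n (x + r' *\<^sub>R diagonal)"
        using sep[of ?y "r' - r"] rr(1-3) unfolding y' by (auto simp: A_def)
      obtain l where l: "q \<longlonglongrightarrow> l" using q(1) by (auto simp: convergent_def)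
      note o1 = g[OF rr(1), unfolded osc_def] and o2 = g[OF rr(2), unfolded osc_def rr(4)[symmetric]]
      show False
      proof (cases "l < snd (g r)")
        case True
        have "\<forall>\<^sub>F n in sequentially. h n ?y \<le> snd (g r)"
          using order_tendstoD(2)[OF l True] q(2) by eventually_elim auto
        with o1 show False by blast
      next
        case False
        then have "fst (g r) < l" using o1 by linarith
        have "\<forall>\<^sub>F n in sequentially. h n (x + r' *\<^sub>R diagonal) \<ge> fst (g r)"
          using order_tendstoD(1)[OF l \<open>fst (g r) < l\<close>] q(2) by eventually_elim linarith
        with o2 show False by blast
      qed
    qed
    have "inj_on g ?S"
    proof (rule inj_onI)
      fix r r' assume "r \<in> ?S" "r' \<in> ?S" "g r = g r'"
      then show "r = r'" using no[of r r'] no[of r' r] by (cases r r' rule: linorder_cases) auto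
    qed
    moreover have "g ` ?S \<subseteq> \<rat> \<times> \<rat>" 
    proof (rule image_subsetI)
      fix r assume "r \<in> ?S"
      then show "g r \<in> \<rat> \<times> \<rat>" using g[of r] by (simp add: osc_def mem_Times_iff)
    qed
    then have "countable (g ` ?S)" by (rule countable_subset) (simp add: countable_rat)
    ultimately show ?thesis using countable_image_inj_on by blast
  qed
  ultimately have "AE x in lborel. x \<notin> A" by (rule AE_not_in_countable_diagonals)
  then show ?thesis by (rule AE_mp) (auto intro!: AE_I2 simp: A_def)
qed


lemma between_strict:
  fixes x y :: "real^'d"
  assumes D: "\<And>U :: (real^'d) set. open U \<Longrightarrow> U \<noteq> {} \<Longrightarrow> \<exists>z\<in>D. z \<in> U"
    and xy: "\<And>i. x $ i < y $ i"
  obtains z where "z \<in> D" "\<And>i. x $ i < z $ i" "\<And>i. z $ i < y $ i"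
proof -
  have "box x y \<noteq> {}" using xy by (auto simp: box_ne_empty Basis_vec_def inner_axis)
  then obtain z where "z \<in> D" "z \<in> box x y" using D open_box by meson
  then show ?thesis using that by (auto simp: mem_box_cart)
qed

lemma eventually_le_of_limit:
  fixes \<xi> :: "nat \<Rightarrow> real^'d"
  assumes \<xi>: "\<xi> \<longlonglongrightarrow> x"
  shows "(\<And>i. x $ i < z $ i) \<Longrightarrow> \<forall>\<^sub>F n in sequentially. \<xi> n \<le> z"
    and "(\<And>i. z $ i < x $ i) \<Longrightarrow> \<forall>\<^sub>F n in sequentially. z \<le> \<xi> n"
proof -
  have comp: "(\<lambda>n. \<xi> n $ i) \<longlonglongrightarrow> x $ i" for i by (intro tendsto_vec_nth \<xi>)
  show "\<forall>\<^sub>F n in sequentially. \<xi> n \<le> z" if "\<And>i. x $ i < z $ i"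
  proof -
    have "\<forall>\<^sub>F n in sequentially. \<forall>i. \<xi> n $ i < z $ i"
      using order_tendstoD(2)[OF comp that] by (simp add: eventually_all_finite)
    then show ?thesis by (rule eventually_mono) (simp add: less_eq_vec_def less_imp_le)
  qed
  show "\<forall>\<^sub>F n in sequentially. z \<le> \<xi> n" if "\<And>i. z $ i < x $ i"
  proof -
    have "\<forall>\<^sub>F n in sequentially. \<forall>i. z $ i < \<xi> n $ i"
      using order_tendstoD(1)[OF comp that] by (simp add: eventually_all_finite)
    then show ?thesis by (rule eventually_mono) (simp add: less_eq_vec_def less_imp_le)
  qed
qed

section \<open>Sequences of flows\<close>

text \<open>The Borel functions \<open>B n\<close> represent the fields, which are themselves only Lebesgue measurable, in compositions with
  the flows.\<close>

locale flow_sequence =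
  fixes s T :: real and f :: "nat \<Rightarrow> real \<Rightarrow> real^'d \<Rightarrow> real^'d" and b :: "real \<Rightarrow> real^'d \<Rightarrow> real^'d"
    and a c :: "real \<Rightarrow> real" and L :: "nat \<Rightarrow> real \<Rightarrow> real" and N :: "real set"
    and X :: "nat \<Rightarrow> real \<Rightarrow> real^'d \<Rightarrow> real^'d" and B :: "nat \<Rightarrow> real \<times> (real^'d) \<Rightarrow> real^'d"
  assumes flow: "\<And>n. monotone_lipschitz_flow s T (f n) a c (L n) N (X n)"
    and B_borel: "\<And>n. B n \<in> borel_measurable borel"
    and B_eq: "\<And>n t y. t \<in> {s..T} - N \<Longrightarrow> B n (t, y) = f n t y"
    and field_conv: "\<And>t. t \<in> {s..T} - N \<Longrightarrow> AE y in lborel. (\<lambda>n. f n t y) \<longlonglongrightarrow> b t y"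
begin

sublocale flow: monotone_lipschitz_flow s T "f n" a c "L n" N "X n" for n
  by (rule flow)

text \<open>The growth and expansion constants of the single flows do not depend on \<open>n\<close>.\<close>

definition E :: real where "E = exp (integral {s..T} a)"
definition \<kappa> :: real where "\<kappa> = exp (- integral {s..T} c)"

lemma kappa_pos: "\<kappa> > 0" by (simp add: \<kappa>_def)
lemma E_ge_1: "E \<ge> 1" using flow.growth_const_ge_1 by (simp add: E_def flow.growth_const_def)
lemma X_bound: "t \<in> {s..T} \<Longrightarrow> norm (X n t x) \<le> E * (1 + norm x)"
  using flow.growth_bound[of t n x] by (simp add: E_def flow.growth_const_def)
lemma X_speed: "t \<in> {s..T} - N \<Longrightarrow> norm (f n t (X n t x)) \<le> E * (1 + norm x) * a t"
  using flow.speed_bound[of t n x] by (simp add: E_def flow.growth_const_def)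
lemma X_time: "s \<le> r \<Longrightarrow> r \<le> t \<Longrightarrow> t \<le> T \<Longrightarrow> norm (X n t x - X n r x) \<le> E * (1 + norm x) * integral {r..t} a"
  using flow.time_modulus[of r t n x] by (simp add: E_def flow.growth_const_def)
lemma X_expanding: "x \<le> y \<Longrightarrow> t \<in> {s..T} \<Longrightarrow> X n t y $ i - X n t x $ i \<ge> \<kappa> * (y $ i - x $ i)"
  using flow.order_expanding[of x y t i n] by (simp add: \<kappa>_def flow.expansion_const_def)

lemma a_integrable: "a integrable_on {s..T}"
  by (rule set_lebesgue_integral_eq_integral(1)[OF flow.a])

lemma AE_not_N: "AE t in lebesgue. t \<notin> N"
  using flow.N by (intro AE_not_in) (simp add: negligible_iff_null_sets)

text \<open>Clamping the time to the interval makes the flow continuous on the whole space.\<close>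

definition Xc :: "nat \<Rightarrow> real \<times> (real^'d) \<Rightarrow> real^'d" where
  "Xc n p = X n (max s (min T (fst p))) (snd p)"

definition speed :: "nat \<Rightarrow> real \<times> (real^'d) \<Rightarrow> real^'d" where
  "speed n p = (if fst p \<in> {s..T} then B n (fst p, Xc n p) else 0)"

lemma Xc_eq: "t \<in> {s..T} \<Longrightarrow> Xc n (t, x) = X n t x"
  by (simp add: Xc_def)

lemma Xc_borel: "Xc n \<in> borel_measurable borel"
proof (rule borel_measurable_continuous_onI)
  have "continuous_on UNIV ((\<lambda>(t, x). X n t x) \<circ> (\<lambda>p. (max s (min T (fst p)), snd p)))"
    using flow.sT
    by (intro continuous_on_compose continuous_intros continuous_on_subset[OF flow.continuous_joint]) auto
  then show "continuous_on UNIV (Xc n)" by (simp add: Xc_def[abs_def] o_def)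
qed

lemma speed_borel: "speed n \<in> borel_measurable borel"
proof -
  have "(\<lambda>p. (fst p, Xc n p)) \<in> borel \<rightarrow>\<^sub>M (borel \<Otimes>\<^sub>M borel)"
  proof (rule measurable_Pair)
    show "fst \<in> borel_measurable (borel :: (real \<times> (real^'d)) measure)"
      by (intro borel_measurable_continuous_onI continuous_intros)
  qed (rule Xc_borel)
  then have "(\<lambda>p. B n (fst p, Xc n p)) \<in> borel_measurable borel"
    using B_borel[of n] unfolding borel_prod by (rule measurable_compose)
  moreover have "{p :: real \<times> (real^'d). fst p \<in> {s..T}} \<in> sets borel"
    by (intro borel_closed closed_Collect_conj) (auto intro!: closed_Collect_le continuous_intros simp: Collect_conj_eq)
  ultimately show ?thesis unfolding speed_def[abs_def] by (intro measurable_If) auto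
qed

lemma speed_eq: "t \<in> {s..T} - N \<Longrightarrow> speed n (t, x) = f n t (X n t x)"
  by (simp add: speed_def Xc_eq B_eq)

lemma speed_bound: "t \<in> {s..T} - N \<Longrightarrow> norm (speed n (t, x)) \<le> E * (1 + norm x) * a t"
  using X_speed by (simp add: speed_eq)

lemma X_primitive: "primitive_on s T (\<lambda>t. X n t x) (\<lambda>t. speed n (t, x))"
proof -
  obtain M where M: "negligible M" "\<And>t. t \<in> {s..T} - M \<Longrightarrow>
      ((\<lambda>t. X n t x) has_vector_derivative f n t (X n t x)) (at t within {s..T})"
    using flow.ode[of n x] by blast
  show ?thesis
  proof (rule primitive_onI[OF flow.ac])
  show "(\<lambda>t. speed n (t, x)) absolutely_integrable_on {s..T}"
    by (rule absolutely_integrable_spike[OF primitive_onD(1)[OF flow.primitive[of n x]] flow.N]) (simp add: speed_eq)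
  show "negligible (M \<union> N)" using M(1) flow.N by simp
  show "((\<lambda>t. X n t x) has_vector_derivative speed n (t, x)) (at t within {s..T})" if "t \<in> {s..T} - (M \<union> N)" for t
    using M(2)[of t] that by (simp add: speed_eq)
  qed
qed

text \<open>A subsequence converges on a countable dense set of times and starting points.  At each of those
  times, the monotone maps squeeze the values at other starting points between convergent sequences, and
  the common modulus of continuity extends the convergence to all times.\<close>

lemma convergent_subsequence:
  obtains k where "strict_mono k" "AE x in lborel. \<forall>t\<in>{s..T}. convergent (\<lambda>n. X (k n) t x)"
proof -
  obtain Dt where Dt: "countable Dt" "Dt \<subseteq> {s..T}" "{s..T} \<subseteq> closure Dt"
    using separable[of "{s..T}"] by metis
  obtain Dx :: "(real^'d) set" where Dx: "countable Dx" "\<And>U. open U \<Longrightarrow> U \<noteq> {} \<Longrightarrow> \<exists>x\<in>Dx. x \<in> U"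
    using countable_dense_subset_AE[of "\<lambda>_. True"] by auto
  obtain k where k: "strict_mono k" "\<And>p. p \<in> Dt \<times> Dx \<Longrightarrow>
      \<exists>l. (\<lambda>n. X (k n) (fst p) (snd p) /\<^sub>R (1 + norm (snd p))) \<longlonglongrightarrow> l"
  proof (rule function_convergent_subsequence[of "Dt \<times> Dx" "\<lambda>n p. X n (fst p) (snd p) /\<^sub>R (1 + norm (snd p))" E])
    fix n p assume "p \<in> Dt \<times> Dx"
    then have "norm (X n (fst p) (snd p)) \<le> E * (1 + norm (snd p))" using Dt(2) by (intro X_bound) auto
    moreover have "1 + norm (snd p) > 0" by (simp add: add_pos_nonneg)
    ultimately show "norm (X n (fst p) (snd p) /\<^sub>R (1 + norm (snd p))) \<le> E"
      by (simp add: divide_inverse[symmetric] mult.commute[of "inverse _"] pos_divide_le_eq)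
  qed (use Dt Dx in auto)
  have conv: "convergent (\<lambda>n. X (k n) t z)" if tz: "t \<in> Dt" "z \<in> Dx" for t z
  proof -
    obtain l where "(\<lambda>n. X (k n) t z /\<^sub>R (1 + norm z)) \<longlonglongrightarrow> l" using k(2)[of "(t, z)"] tz by auto
    then have "(\<lambda>n. (1 + norm z) *\<^sub>R (X (k n) t z /\<^sub>R (1 + norm z))) \<longlonglongrightarrow> (1 + norm z) *\<^sub>R l"
      by (intro tendsto_intros)
    moreover have "1 + norm z \<noteq> 0" using norm_ge_zero[of z] by linarith
    ultimately show ?thesis by (auto simp: convergent_def)
  qed
  have "AE x in lborel. convergent (\<lambda>n. X (k n) t x $ i)" if t: "t \<in> Dt" for t i
  proof -
    have ts: "t \<in> {s..T}" using t Dt by auto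
    have "AE x in lborel. x \<in> UNIV \<longrightarrow> convergent (\<lambda>n. X (k n) t x $ i)"
    proof (rule AE_convergent_separated_diagonals)
      show "(\<lambda>x. X (k n) t x $ i) \<in> borel_measurable borel" for n
        using borel_measurable_sections(1)[OF Xc_borel, of "k n" t] by (simp add: Xc_eq[OF ts] borel_measurable_vec_nth)
      show "\<exists>M. \<forall>n. \<bar>X (k n) t x $ i\<bar> \<le> M" for x
        using component_le_norm_cart[of "X (k n) t x" i for n] X_bound[OF ts] order_trans by blast
      fix x :: "real^'d" and r :: real assume r: "0 < r"
      obtain z where z: "z \<in> Dx" "\<And>i. x $ i < z $ i" "\<And>i. z $ i < (x + r *\<^sub>R diagonal) $ i"
        by (rule between_strict[OF Dx(2), of x "x + r *\<^sub>R diagonal"]) (use r in auto)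
      have "x \<le> z" "z \<le> x + r *\<^sub>R diagonal" using z(2,3) by (auto simp: less_eq_vec_def less_imp_le)
      then have "X (k n) t x \<le> X (k n) t z" "X (k n) t z \<le> X (k n) t (x + r *\<^sub>R diagonal)" for n
        using flow.order_preserving ts by blast+
      moreover have "convergent (\<lambda>n. X (k n) t z $ i)"
        using conv[OF t z(1)] by (auto simp: convergent_def intro: tendsto_vec_nth)
      ultimately show "\<exists>q. convergent q \<and> (\<forall>\<^sub>F n in sequentially. X (k n) t x $ i \<le> q n \<and> q n \<le> X (k n) t (x + r *\<^sub>R diagonal) $ i)"
        by (intro exI[of _ "\<lambda>n. X (k n) t z $ i"]) (auto simp: less_eq_vec_def)
    qed auto
    then show ?thesis by simp
  qed
  then have "AE x in lborel. \<forall>t\<in>Dt. \<forall>i. convergent (\<lambda>n. X (k n) t x $ i)"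
    using Dt(1) by (simp add: AE_ball_countable AE_all_countable)
  then have "AE x in lborel. \<forall>t\<in>{s..T}. convergent (\<lambda>n. X (k n) t x)"
  proof (rule AE_mp, intro AE_I2 impI ballI)
    fix x t assume *: "\<forall>t\<in>Dt. \<forall>i. convergent (\<lambda>n. X (k n) t x $ i)" and t: "t \<in> {s..T}"
    define I where "I t = integral {s..t} a" for t
    have "continuous_on {s..T} I" unfolding I_def by (rule indefinite_integral_continuous_1[OF a_integrable])
    have inc: "norm (X n t x - X n r x) \<le> E * (1 + norm x) * \<bar>I t - I r\<bar>" if "t \<in> {s..T}" "r \<in> {s..T}" for n t r
    proof -
      have le: "norm (X n t x - X n r x) \<le> E * (1 + norm x) * \<bar>I t - I r\<bar>" if "s \<le> r" "r \<le> t" "t \<le> T" for r t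
      proof -
        have "integral {r..t} a \<le> \<bar>I t - I r\<bar>"
          unfolding I_def integral_adjacent[OF a_integrable that] by (rule abs_ge_self)
        then have "E * (1 + norm x) * integral {r..t} a \<le> E * (1 + norm x) * \<bar>I t - I r\<bar>"
          using E_ge_1 by (intro mult_left_mono) auto
        with X_time[OF that, of n x] show ?thesis by linarith
      qed
      show ?thesis
        using le[of r t] le[of t r] that by (cases "r \<le> t") (auto simp: norm_minus_commute abs_minus_commute)
    qed
    show "convergent (\<lambda>n. X (k n) t x)"
      unfolding Cauchy_convergent_iff[symmetric]
    proof (rule metric_CauchyI)
      fix e :: real assume "e > 0"
      define K where "K = E * (1 + norm x)"
      define \<eta> where "\<eta> = e / (3 * K)"
      have K: "K > 0" unfolding K_def using E_ge_1 by (simp add: add_pos_nonneg)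
      then have "\<eta> > 0" using \<open>e > 0\<close> by (simp add: \<eta>_def)
      then obtain d where d: "d > 0" "\<And>r. r \<in> {s..T} \<Longrightarrow> dist r t < d \<Longrightarrow> dist (I r) (I t) < \<eta>"
        using \<open>continuous_on {s..T} I\<close> t unfolding continuous_on_iff by blast
      obtain r where r: "r \<in> Dt" "dist r t < d" using Dt(3) t d(1) closure_approachable by blast
      have rs: "r \<in> {s..T}" using r Dt by auto
      have near: "dist (X n t x) (X n r x) < e / 3" for n
      proof -
        have "dist (X n t x) (X n r x) \<le> K * \<bar>I t - I r\<bar>" unfolding K_def using inc[OF t rs] by (simp add: dist_norm)
        also have "\<dots> < K * \<eta>"
          using d(2)[OF rs r(2)] K by (intro mult_strict_left_mono) (auto simp: dist_real_def)
        also have "\<dots> = e / 3" using K by (simp add: \<eta>_def)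
        finally show ?thesis .
      qed
      have "\<exists>l. \<forall>i. (\<lambda>n. X (k n) r x $ i) \<longlonglongrightarrow> l i" using * r(1) unfolding convergent_def by metis
      then obtain l where "\<And>i. (\<lambda>n. X (k n) r x $ i) \<longlonglongrightarrow> l i" by blast
      then have "(\<lambda>n. X (k n) r x) \<longlonglongrightarrow> (\<chi> i. l i)" by (intro vec_tendstoI) simp
      then have "Cauchy (\<lambda>n. X (k n) r x)" by (rule LIMSEQ_imp_Cauchy)
      then obtain M where M: "\<And>m n. m \<ge> M \<Longrightarrow> n \<ge> M \<Longrightarrow> dist (X (k m) r x) (X (k n) r x) < e / 3"
        using \<open>e > 0\<close> unfolding Cauchy_def by (metis divide_pos_pos zero_less_numeral)
      show "\<exists>M. \<forall>m\<ge>M. \<forall>n\<ge>M. dist (X (k m) t x) (X (k n) t x) < e"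
      proof (intro exI[of _ M] allI impI)
        fix m n assume "M \<le> m" "M \<le> n"
        then show "dist (X (k m) t x) (X (k n) t x) < e"
          using M[of m n] near[of "k m"] near[of "k n"] dist_triangle[of "X (k m) t x" "X (k n) t x" "X (k m) r x"]
            dist_triangle[of "X (k m) r x" "X (k n) t x" "X (k n) r x"] dist_commute[of "X (k n) r x" "X (k n) t x"]
          by linarith
      qed
    qed
  qed
  with k(1) that show ?thesis by blast
qed

end


locale convergent_flow_sequence = flow_sequence s T f b a c L N X B
  for s T :: real and f :: "nat \<Rightarrow> real \<Rightarrow> real^'d \<Rightarrow> real^'d" and b :: "real \<Rightarrow> real^'d \<Rightarrow> real^'d"
    and a c :: "real \<Rightarrow> real" and L :: "nat \<Rightarrow> real \<Rightarrow> real" and N :: "real set"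
    and X :: "nat \<Rightarrow> real \<Rightarrow> real^'d \<Rightarrow> real^'d" and B :: "nat \<Rightarrow> real \<times> (real^'d) \<Rightarrow> real^'d" +
  assumes X_conv: "AE x in lborel. \<forall>t\<in>{s..T}. convergent (\<lambda>n. X n t x)"
begin

text \<open>Where the flows converge, their limit keeps the order expansion, so the limits at two points
  of a diagonal line are strictly ordered and leave room for a point at which the fields converge.\<close>

lemma speeds_converge_at_time:
  assumes t: "t \<in> {s..T} - N"
  shows "AE x in lborel. Cauchy (\<lambda>n. Xc n (t, x)) \<longrightarrow> Cauchy (\<lambda>n. speed n (t, x))"
proof -
  have ts: "t \<in> {s..T}" using t by simp
  obtain D where D: "countable D" "\<And>y. y \<in> D \<Longrightarrow> (\<lambda>n. f n t y) \<longlonglongrightarrow> b t y"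
    "\<And>U. open U \<Longrightarrow> U \<noteq> {} \<Longrightarrow> \<exists>x\<in>D. x \<in> U"
    by (rule countable_dense_subset_AE[OF field_conv[OF t]]) blast
  define H where "H = {x. Cauchy (\<lambda>n. Xc n (t, x))}"
  define h where "h i n x = speed n (t, x) $ i + c t * Xc n (t, x) $ i" for i n x
  note secX = borel_measurable_sections(1)[OF Xc_borel] and secS = borel_measurable_sections(1)[OF speed_borel]
  have H: "H \<in> sets borel" unfolding H_def using sets_Collect_Cauchy[of "\<lambda>n x. Xc n (t, x)" borel] secX by simp
  have h_eq: "h i n x = (f n t (X n t x) + c t *\<^sub>R X n t x) $ i" for i n x
    by (simp add: h_def speed_eq[OF t] Xc_eq[OF ts])
  have "AE x in lborel. x \<in> H \<longrightarrow> convergent (\<lambda>n. h i n x)" for i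
  proof (rule AE_convergent_separated_diagonals[OF _ H])
    show "h i n \<in> borel_measurable borel" for n
      unfolding h_def[abs_def]
      by (intro borel_measurable_add borel_measurable_times borel_measurable_const borel_measurable_vec_nth secX secS)
    show "\<exists>M. \<forall>n. \<bar>h i n x\<bar> \<le> M" for x
    proof (intro exI allI)
      fix n
      have "\<bar>h i n x\<bar> \<le> norm (f n t (X n t x) + c t *\<^sub>R X n t x)"
        unfolding h_eq by (rule component_le_norm_cart)
      also have "\<dots> \<le> norm (f n t (X n t x)) + c t * norm (X n t x)"
        using norm_triangle_ineq[of "f n t (X n t x)" "c t *\<^sub>R X n t x"] flow.c_nonneg[OF t] by simp
      also have "\<dots> \<le> E * (1 + norm x) * a t + c t * (E * (1 + norm x))"
        using flow.c_nonneg[OF t] by (intro add_mono X_speed[OF t] mult_left_mono X_bound[OF ts])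
      finally show "\<bar>h i n x\<bar> \<le> E * (1 + norm x) * a t + c t * (E * (1 + norm x))" .
    qed
    fix x :: "real^'d" and r :: real
    let ?y = "x + r *\<^sub>R diagonal"
    assume H: "x \<in> H" "?y \<in> H" and r: "0 < r"
    obtain \<xi> \<eta> where \<xi>: "(\<lambda>n. X n t x) \<longlonglongrightarrow> \<xi>" and \<eta>: "(\<lambda>n. X n t ?y) \<longlonglongrightarrow> \<eta>"
      using H unfolding H_def Xc_eq[OF ts] mem_Collect_eq Cauchy_convergent_iff convergent_def by blast
    have "x \<le> ?y" using r by (simp add: less_eq_vec_def)
    have "\<xi> $ j < \<eta> $ j" for j
    proof -
      have "\<kappa> * r \<le> \<eta> $ j - \<xi> $ j"
      proof (rule LIMSEQ_le_const)
        show "(\<lambda>n. X n t ?y $ j - X n t x $ j) \<longlonglongrightarrow> \<eta> $ j - \<xi> $ j"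
          by (intro tendsto_diff tendsto_vec_nth \<xi> \<eta>)
        show "\<exists>M. \<forall>n\<ge>M. \<kappa> * r \<le> X n t ?y $ j - X n t x $ j"
          using X_expanding[OF \<open>x \<le> ?y\<close> ts, where i = j] by simp
      qed
      moreover have "\<kappa> * r > 0" using kappa_pos r by simp
      ultimately show ?thesis by linarith
    qed
    then obtain z where z: "z \<in> D" "\<And>j. \<xi> $ j < z $ j" "\<And>j. z $ j < \<eta> $ j"
      using between_strict[OF D(3)] by metis
    define q where "q n = (f n t z + c t *\<^sub>R z) $ i" for n
    have "q \<longlonglongrightarrow> (b t z + c t *\<^sub>R z) $ i"
      unfolding q_def by (intro tendsto_vec_nth tendsto_add tendsto_const D(2)[OF z(1)])
    then have "convergent q" by (auto simp: convergent_def)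
    moreover have "\<forall>\<^sub>F n in sequentially. h i n x \<le> q n \<and> q n \<le> h i n ?y"
      using eventually_le_of_limit(1)[OF \<xi> z(2)] eventually_le_of_limit(2)[OF \<eta> z(3)]
    proof eventually_elim
      case (elim n)
      then show ?case
        using monoD[OF flow.mono[OF t, of n] elim(1)] monoD[OF flow.mono[OF t, of n] elim(2)]
        unfolding h_eq q_def less_eq_vec_def by blast
    qed
    ultimately show "\<exists>q. convergent q \<and> (\<forall>\<^sub>F n in sequentially. h i n x \<le> q n \<and> q n \<le> h i n ?y)" by blast
  qed
  then have "AE x in lborel. \<forall>i. x \<in> H \<longrightarrow> convergent (\<lambda>n. h i n x)" unfolding AE_all_countable by blast
  then show ?thesis
  proof (rule AE_mp, intro AE_I2 impI)
    fix x assume hx: "\<forall>i. x \<in> H \<longrightarrow> convergent (\<lambda>n. h i n x)" and "Cauchy (\<lambda>n. Xc n (t, x))"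
    then have "x \<in> H" by (simp add: H_def)
    obtain \<xi> where \<xi>: "(\<lambda>n. Xc n (t, x)) \<longlonglongrightarrow> \<xi>"
      using \<open>Cauchy (\<lambda>n. Xc n (t, x))\<close> unfolding Cauchy_convergent_iff convergent_def by blast
    have "\<exists>l. (\<lambda>n. speed n (t, x) $ i) \<longlonglongrightarrow> l" for i
    proof -
      obtain l where "(\<lambda>n. h i n x) \<longlonglongrightarrow> l" using hx \<open>x \<in> H\<close> unfolding convergent_def by blast
      then have "(\<lambda>n. h i n x - c t * Xc n (t, x) $ i) \<longlonglongrightarrow> l - c t * \<xi> $ i"
        by (intro tendsto_intros tendsto_vec_nth \<xi>)
      then show ?thesis by (auto simp: h_def)
    qed
    then obtain l where "\<And>i. (\<lambda>n. speed n (t, x) $ i) \<longlonglongrightarrow> l i" by metis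
    then have "(\<lambda>n. speed n (t, x)) \<longlonglongrightarrow> (\<chi> i. l i)" by (intro vec_tendstoI) simp
    then show "Cauchy (\<lambda>n. speed n (t, x))" by (rule LIMSEQ_imp_Cauchy)
  qed
qed

text \<open>The exceptional set is Borel, so that almost every time and almost every starting point can be exchanged.\<close>

lemma speeds_converge: "AE x in lborel. AE t in lborel. Cauchy (\<lambda>n. speed n (t, x))"
proof -
  define Z where "Z = {p. Cauchy (\<lambda>n. Xc n p) \<and> \<not> Cauchy (\<lambda>n. speed n p)}"
  have "{p. Cauchy (\<lambda>n. Xc n p)} \<in> sets borel" "{p. Cauchy (\<lambda>n. speed n p)} \<in> sets borel"
    using sets_Collect_Cauchy[of Xc borel] sets_Collect_Cauchy[of speed borel] Xc_borel speed_borel by simp_all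
  then have "{p. Cauchy (\<lambda>n. Xc n p)} - {p. Cauchy (\<lambda>n. speed n p)} \<in> sets borel" by (rule sets.Diff)
  then have Z: "- Z \<in> sets borel" by (simp add: Z_def set_diff_eq borel_comp)
  have "AE t in lborel. AE x in lborel. (t, x) \<notin> Z"
    using AE_not_N[unfolded AE_completion_iff]
  proof (rule AE_mp[OF _ AE_I2[OF impI]])
    fix t assume "t \<notin> N"
    show "AE x in lborel. (t, x) \<notin> Z"
    proof (cases "t \<in> {s..T}")
      case True
      then show ?thesis using speeds_converge_at_time[of t] \<open>t \<notin> N\<close>
        by (auto simp: Z_def elim!: AE_mp intro!: AE_I2)
    next
      case False
      then have "speed n (t, x) = 0" for n x by (auto simp: speed_def)
      then have "Cauchy (\<lambda>n. speed n (t, x))" for x by (simp add: convergent_Cauchy convergent_const)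
      then show ?thesis by (simp add: Z_def)
    qed
  qed
  moreover have "{p \<in> space (lborel \<Otimes>\<^sub>M lborel). (fst p, snd p) \<notin> Z} \<in> sets (lborel \<Otimes>\<^sub>M lborel)"
    unfolding lborel_prod using Z by (simp add: Compl_eq)
  ultimately have "AE x in lborel. AE t in lborel. (t, x) \<notin> Z"
    by (subst (asm) lborel_pair.AE_commute)
  then show ?thesis
    using X_conv
  proof eventually_elim
    case (elim x)
    have "Cauchy (\<lambda>n. Xc n (t, x))" for t
      using elim(2) flow.sT unfolding Xc_def Cauchy_convergent_iff by simp
    then show ?case using elim(1) by (auto simp: Z_def elim!: AE_mp intro!: AE_I2)
  qed
qed

definition limit_speed :: "real \<times> (real^'d) \<Rightarrow> real^'d" where
  "limit_speed p = lim (\<lambda>n. speed n p)"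

definition limit_flow :: "real \<Rightarrow> real^'d \<Rightarrow> real^'d" where
  "limit_flow t x = x + integral {s..t} (\<lambda>\<tau>. limit_speed (\<tau>, x))"

definition speed_error :: "nat \<Rightarrow> real^'d \<Rightarrow> ennreal" where
  "speed_error n x = (\<integral>\<^sup>+t\<in>{s..T}. ennreal (norm (speed n (t, x) - limit_speed (t, x))) \<partial>lebesgue)"

lemma limit_speed_borel: "limit_speed \<in> borel_measurable borel"
  unfolding limit_speed_def[abs_def] by (intro borel_measurable_lim_metric speed_borel)

lemma speed_error_borel: "speed_error n \<in> borel_measurable borel"
proof -
  have "(\<lambda>p. norm (speed n (snd p, fst p) - limit_speed (snd p, fst p))) \<in> borel_measurable (borel :: ((real^'d) \<times> real) measure)"
    using borel_measurable_sections(3)[OF speed_borel[of n]] borel_measurable_sections(3)[OF limit_speed_borel]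
    unfolding case_prod_beta' by (intro measurable_compose[OF borel_measurable_diff borel_measurable_norm])
  moreover have "(\<lambda>p. indicator {s..T} (snd p)) \<in> borel_measurable (borel :: ((real^'d) \<times> real) measure)"
    by (rule measurable_compose[OF borel_measurable_continuous_onI[of snd]]) (auto intro!: continuous_intros)
  ultimately have "(\<lambda>(x, t). ennreal (norm (speed n (t, x) - limit_speed (t, x))) * indicator {s..T} t)
      \<in> borel_measurable (lborel \<Otimes>\<^sub>M lborel)"
    unfolding lborel_prod case_prod_beta' by (intro borel_measurable_times_ennreal) auto
  then show ?thesis
    unfolding speed_error_def[abs_def] nn_integral_completion
    using lborel.borel_measurable_nn_integral by (simp add: case_prod_beta')
qed

context
  fixes x :: "real^'d"
  assumes flow_conv: "\<forall>t\<in>{s..T}. convergent (\<lambda>n. X n t x)"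
    and speed_conv: "AE t in lborel. Cauchy (\<lambda>n. speed n (t, x))"
begin

lemma speed_tendsto: "AE t in lebesgue. (\<lambda>n. speed n (t, x)) \<longlonglongrightarrow> limit_speed (t, x)"
  unfolding AE_completion_iff using speed_conv
  by (rule AE_mp) (auto intro!: AE_I2 simp: limit_speed_def Cauchy_convergent_iff convergent_LIMSEQ_iff)

lemma limit_speed_bound: "AE t in lebesgue. t \<in> {s..T} \<longrightarrow> norm (limit_speed (t, x)) \<le> E * (1 + norm x) * a t"
  using speed_tendsto AE_not_N
proof eventually_elim
  case (elim t)
  show ?case
  proof
    assume "t \<in> {s..T}"
    then have "norm (speed n (t, x)) \<le> E * (1 + norm x) * a t" for n using speed_bound[of t] elim(2) by simp
    then show "norm (limit_speed (t, x)) \<le> E * (1 + norm x) * a t"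
      by (intro LIMSEQ_le_const2[OF tendsto_norm[OF elim(1)]]) auto
  qed
qed

lemma dominating_integrable: "(\<lambda>t. E * (1 + norm x) * a t) absolutely_integrable_on {s..T}"
  using flow.a by (intro set_integrable_mult_right) auto

lemma limit_speed_integrable: "(\<lambda>t. limit_speed (t, x)) absolutely_integrable_on {s..T}"
  unfolding set_integrable_def
proof (rule Bochner_Integration.integrable_bound[OF dominating_integrable[unfolded set_integrable_def]])
  show "(\<lambda>t. indicator {s..T} t *\<^sub>R limit_speed (t, x)) \<in> borel_measurable lebesgue"
    using borel_measurable_sections(2)[OF limit_speed_borel, of x] by (intro measurable_completion borel_measurable_scaleR) auto
  show "AE t in lebesgue. norm (indicator {s..T} t *\<^sub>R limit_speed (t, x))
      \<le> norm (indicator {s..T} t *\<^sub>R (E * (1 + norm x) * a t))"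
    using limit_speed_bound by (rule AE_mp) (auto intro!: AE_I2 simp: indicator_def)
qed

lemma limit_primitive: "primitive_on s T (\<lambda>t. limit_flow t x) (\<lambda>t. limit_speed (t, x))"
  using limit_speed_integrable by (auto simp: primitive_on_def limit_flow_def)

lemma speed_error_tendsto: "(\<lambda>n. speed_error n x) \<longlonglongrightarrow> 0"
proof -
  have ind: "(indicator {s..T} :: real \<Rightarrow> real) \<in> borel_measurable lebesgue"
    by (rule borel_measurable_indicator) simp
  have "(\<lambda>n. \<integral>\<^sup>+t. ennreal (norm (indicator {s..T} t *\<^sub>R limit_speed (t, x) - indicator {s..T} t *\<^sub>R speed n (t, x))) \<partial>lebesgue) \<longlonglongrightarrow> 0"
  proof (rule nn_integral_dominated_convergence_norm)
    show "(\<lambda>t. indicator {s..T} t *\<^sub>R speed n (t, x)) \<in> borel_measurable lebesgue" for n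
      using borel_measurable_sections(2)[OF speed_borel, of n x] by (intro borel_measurable_scaleR ind) (simp add: measurable_completion)
    show "(\<lambda>t. indicator {s..T} t *\<^sub>R limit_speed (t, x)) \<in> borel_measurable lebesgue"
      using borel_measurable_sections(2)[OF limit_speed_borel, of x] by (intro borel_measurable_scaleR ind) (simp add: measurable_completion)
    show "(\<lambda>t. norm (indicator {s..T} t *\<^sub>R (E * (1 + norm x) * a t))) \<in> borel_measurable lebesgue"
      using integrable_norm[OF dominating_integrable[unfolded set_integrable_def]] by (rule borel_measurable_integrable)
    show "AE t in lebesgue. norm (indicator {s..T} t *\<^sub>R speed n (t, x)) \<le> norm (indicator {s..T} t *\<^sub>R (E * (1 + norm x) * a t))" for n
      using AE_not_N
    proof (rule AE_mp, intro AE_I2 impI)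
      fix t assume "t \<notin> N"
      then show "norm (indicator {s..T} t *\<^sub>R speed n (t, x)) \<le> norm (indicator {s..T} t *\<^sub>R (E * (1 + norm x) * a t))"
        using speed_bound[of t n x] by (auto simp: indicator_def)
    qed
    show "(\<integral>\<^sup>+t. ennreal (norm (indicator {s..T} t *\<^sub>R (E * (1 + norm x) * a t))) \<partial>lebesgue) < \<infinity>"
      using dominating_integrable unfolding set_integrable_def integrable_iff_bounded by blast
    show "AE t in lebesgue. (\<lambda>n. indicator {s..T} t *\<^sub>R speed n (t, x)) \<longlonglongrightarrow> indicator {s..T} t *\<^sub>R limit_speed (t, x)"
      using speed_tendsto by (rule AE_mp) (auto intro!: AE_I2 tendsto_intros)
  qed
  moreover have "ennreal (norm (indicator {s..T} t *\<^sub>R limit_speed (t, x) - indicator {s..T} t *\<^sub>R speed n (t, x)))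
      = ennreal (norm (speed n (t, x) - limit_speed (t, x))) * indicator {s..T} t" for n t
    by (simp add: indicator_def norm_minus_commute)
  ultimately show ?thesis unfolding speed_error_def by (simp only:)
qed

lemma X_dist_limit_flow:
  "t \<in> {s..T} \<Longrightarrow> ennreal (norm (X n t x - limit_flow t x)) \<le> speed_error n x"
  unfolding speed_error_def
  by (rule primitive_on_dist_le[OF X_primitive limit_primitive]) (simp_all add: flow.init limit_flow_def)

lemma X_tendsto_limit_flow:
  assumes t: "t \<in> {s..T}"
  shows "(\<lambda>n. X n t x) \<longlonglongrightarrow> limit_flow t x"
proof -
  have "(\<lambda>n. ennreal (norm (X n t x - limit_flow t x))) \<longlonglongrightarrow> 0"
    by (rule tendsto_sandwich[OF _ _ tendsto_const speed_error_tendsto]) (auto intro!: always_eventually X_dist_limit_flow t)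
  then have "(\<lambda>n. norm (X n t x - limit_flow t x)) \<longlonglongrightarrow> 0"
    by (simp add: tendsto_ennreal_iff[where x = 0, simplified])
  then show ?thesis by (simp add: LIM_zero_iff tendsto_norm_zero_iff)
qed

text \<open>At almost every time the limit speed is a limit of \<open>f n\<close> along a converging sequence of points, and
  monotonicity bounds such limits by the values of \<open>b\<close> at nearby points where the fields converge.\<close>

lemma limit_speed_envelope:
  assumes t: "t \<in> {s..T} - N" and lim: "(\<lambda>n. speed n (t, x)) \<longlonglongrightarrow> limit_speed (t, x)"
  shows "lower_envelope (\<lambda>y. b t y $ i) (limit_flow t x) \<le> ereal (limit_speed (t, x) $ i)"
    and "ereal (limit_speed (t, x) $ i) \<le> upper_envelope (\<lambda>y. b t y $ i) (limit_flow t x)"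
proof -
  let ?\<xi> = "limit_flow t x" and ?v = "limit_speed (t, x) $ i"
  obtain D where D: "countable D" "\<And>y. y \<in> D \<Longrightarrow> (\<lambda>n. f n t y) \<longlonglongrightarrow> b t y"
    "\<And>U. open U \<Longrightarrow> U \<noteq> {} \<Longrightarrow> \<exists>x\<in>D. x \<in> U"
    by (rule countable_dense_subset_AE[OF field_conv[OF t]]) blast
  have c0: "c t \<ge> 0" using flow.c_nonneg[OF t] .
  have \<xi>: "(\<lambda>n. X n t x) \<longlonglongrightarrow> ?\<xi>" using X_tendsto_limit_flow t by simp
  have lim': "(\<lambda>n. (f n t (X n t x) + c t *\<^sub>R X n t x) $ i) \<longlonglongrightarrow> ?v + c t * ?\<xi> $ i"
    using tendsto_vec_nth[OF tendsto_add[OF lim tendsto_scaleR[OF tendsto_const \<xi>, of "c t"]], of i]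
    by (simp add: speed_eq[OF t])
  have limz: "(\<lambda>n. (f n t z + c t *\<^sub>R z) $ i) \<longlonglongrightarrow> b t z $ i + c t * z $ i" if "z \<in> D" for z
    using tendsto_vec_nth[OF tendsto_add[OF D(2)[OF that] tendsto_const[of "c t *\<^sub>R z"]], of i] by simp
  have above: "?v + c t * ?\<xi> $ i \<le> b t z $ i + c t * z $ i" if "z \<in> D" "\<And>j. ?\<xi> $ j < z $ j" for z
  proof (rule tendsto_le[OF _ limz[OF that(1)] lim'])
    show "\<forall>\<^sub>F n in sequentially. (f n t (X n t x) + c t *\<^sub>R X n t x) $ i \<le> (f n t z + c t *\<^sub>R z) $ i"
      using eventually_le_of_limit(1)[OF \<xi> that(2)]
      by eventually_elim (use monoD[OF flow.mono[OF t]] in \<open>auto simp: less_eq_vec_def\<close>)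
  qed simp
  have below: "b t z $ i + c t * z $ i \<le> ?v + c t * ?\<xi> $ i" if "z \<in> D" "\<And>j. z $ j < ?\<xi> $ j" for z
  proof (rule tendsto_le[OF _ lim' limz[OF that(1)]])
    show "\<forall>\<^sub>F n in sequentially. (f n t z + c t *\<^sub>R z) $ i \<le> (f n t (X n t x) + c t *\<^sub>R X n t x) $ i"
      using eventually_le_of_limit(2)[OF \<xi> that(2)]
      by eventually_elim (use monoD[OF flow.mono[OF t]] in \<open>auto simp: less_eq_vec_def\<close>)
  qed simp
  have near: "\<exists>z\<in>D. P z \<and> (\<forall>j. ?\<xi> $ j < z $ j) \<and> z $ i \<le> ?\<xi> $ i + e" "\<exists>z\<in>D. P z \<and> (\<forall>j. z $ j < ?\<xi> $ j) \<and> ?\<xi> $ i \<le> z $ i + e"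
    if P: "eventually P (nhds ?\<xi>)" and e: "e > 0" for P e
  proof -
    obtain S where S: "open S" "?\<xi> \<in> S" "\<And>y. y \<in> S \<Longrightarrow> P y" using P unfolding eventually_nhds by blast
    obtain \<rho> where \<rho>: "\<rho> > 0" "ball ?\<xi> \<rho> \<subseteq> S" using S by (auto simp: open_contains_ball)
    define \<delta> where "\<delta> = min e (\<rho> / (2 * real CARD('d)))"
    have \<delta>: "\<delta> > 0" using e \<rho> by (simp add: \<delta>_def)
    have in_ball: "P z" if "\<And>j. \<bar>z $ j - ?\<xi> $ j\<bar> \<le> \<delta>" for z
    proof -
      have "norm (z - ?\<xi>) \<le> real CARD('d) * \<delta>" using that by (intro norm_le_card_times) simp
      also have "\<dots> \<le> real CARD('d) * (\<rho> / (2 * real CARD('d)))" unfolding \<delta>_def by (intro mult_left_mono) auto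
      also have "\<dots> < \<rho>" using \<rho>(1) by simp
      finally show ?thesis using \<rho>(2) by (intro S(3)) (auto simp: dist_norm norm_minus_commute)
    qed
    obtain z where z: "z \<in> D" "\<And>j. ?\<xi> $ j < z $ j" "\<And>j. z $ j < (?\<xi> + \<delta> *\<^sub>R diagonal) $ j"
      by (rule between_strict[OF D(3), of ?\<xi> "?\<xi> + \<delta> *\<^sub>R diagonal"]) (use \<delta> in auto)
    have "\<bar>z $ j - ?\<xi> $ j\<bar> \<le> \<delta>" for j using z(2)[of j] z(3)[of j] by simp
    moreover have "z $ i \<le> ?\<xi> $ i + e" using z(3)[of i] by (simp add: \<delta>_def)
    ultimately show "\<exists>z\<in>D. P z \<and> (\<forall>j. ?\<xi> $ j < z $ j) \<and> z $ i \<le> ?\<xi> $ i + e"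
      using z(1,2) in_ball by blast
    obtain w where w: "w \<in> D" "\<And>j. (?\<xi> - \<delta> *\<^sub>R diagonal) $ j < w $ j" "\<And>j. w $ j < ?\<xi> $ j"
      by (rule between_strict[OF D(3), of "?\<xi> - \<delta> *\<^sub>R diagonal" ?\<xi>]) (use \<delta> in auto)
    have "\<bar>w $ j - ?\<xi> $ j\<bar> \<le> \<delta>" for j using w(2)[of j] w(3)[of j] by simp
    moreover have "?\<xi> $ i \<le> w $ i + e" using w(2)[of i] by (simp add: \<delta>_def)
    ultimately show "\<exists>z\<in>D. P z \<and> (\<forall>j. z $ j < ?\<xi> $ j) \<and> ?\<xi> $ i \<le> z $ i + e"
      using w(1,3) in_ball by blast
  qed
  have ce: "c t * (e / (c t + 1)) \<le> e" if "e > 0" for e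
  proof -
    have "c t * (e / (c t + 1)) \<le> (c t + 1) * (e / (c t + 1))" using that c0 by (intro mult_right_mono) auto
    then show ?thesis using c0 by (simp add: add_nonneg_pos less_imp_neq[symmetric])
  qed
  show "ereal ?v \<le> upper_envelope (\<lambda>y. b t y $ i) ?\<xi>"
    unfolding upper_envelope_def Limsup_def
  proof (rule INF_greatest)
    fix P assume P: "P \<in> {P. eventually P (nhds ?\<xi>)}"
    show "ereal ?v \<le> (SUP y\<in>Collect P. ereal (b t y $ i))"
    proof (rule ereal_le_epsilon2)
      fix e :: real assume e: "0 < e"
      then have "e / (c t + 1) > 0" using c0 by simp
      with P near(1)[of P] obtain z where z: "z \<in> D" "P z" "\<And>j. ?\<xi> $ j < z $ j" "z $ i \<le> ?\<xi> $ i + e / (c t + 1)" by blast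
      have "?v \<le> b t z $ i + c t * (z $ i - ?\<xi> $ i)" using above[OF z(1,3)] by (simp add: algebra_simps)
      also have "\<dots> \<le> b t z $ i + c t * (e / (c t + 1))" using z(4) c0 by (intro add_left_mono mult_left_mono) auto
      also have "\<dots> \<le> b t z $ i + e" using ce[OF e] by simp
      finally have "ereal ?v \<le> ereal (b t z $ i) + ereal e" by simp
      also have "\<dots> \<le> (SUP y\<in>Collect P. ereal (b t y $ i)) + ereal e"
        using z(2) by (intro add_right_mono SUP_upper) simp
      finally show "ereal ?v \<le> (SUP y\<in>Collect P. ereal (b t y $ i)) + ereal e" .
    qed
  qed
  show "lower_envelope (\<lambda>y. b t y $ i) ?\<xi> \<le> ereal ?v"
    unfolding lower_envelope_def Liminf_def
  proof (rule SUP_least)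
    fix P assume P: "P \<in> {P. eventually P (nhds ?\<xi>)}"
    show "(INF y\<in>Collect P. ereal (b t y $ i)) \<le> ereal ?v"
    proof (rule ereal_le_epsilon2)
      fix e :: real assume e: "0 < e"
      then have "e / (c t + 1) > 0" using c0 by simp
      with P near(2)[of P] obtain z where z: "z \<in> D" "P z" "\<And>j. z $ j < ?\<xi> $ j" "?\<xi> $ i \<le> z $ i + e / (c t + 1)" by blast
      have "b t z $ i \<le> ?v + c t * (?\<xi> $ i - z $ i)" using below[OF z(1,3)] by (simp add: algebra_simps)
      also have "\<dots> \<le> ?v + c t * (e / (c t + 1))" using z(4) c0 by (intro add_left_mono mult_left_mono) auto
      also have "\<dots> \<le> ?v + e" using ce[OF e] by simp
      finally have "ereal (b t z $ i) \<le> ereal ?v + ereal e" by simp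
      moreover have "(INF y\<in>Collect P. ereal (b t y $ i)) \<le> ereal (b t z $ i)"
        using z(2) by (intro INF_lower) simp
      ultimately show "(INF y\<in>Collect P. ereal (b t y $ i)) \<le> ereal ?v + ereal e" by (rule order_trans[rotated])
    qed
  qed
qed

lemma limit_flow_solves_inclusion: "solves_inclusion T b s x (\<lambda>t. limit_flow t x)"
  unfolding solves_inclusion_def
proof (intro conjI)
  show "abs_continuous_on s T (\<lambda>t. limit_flow t x)" by (rule primitive_on_abs_continuous_on[OF limit_primitive])
  show "limit_flow s x = x" by (simp add: limit_flow_def)
  obtain M where M: "negligible M" "\<And>t. t \<in> {s..T} - M \<Longrightarrow>
      ((\<lambda>t. limit_flow t x) has_vector_derivative limit_speed (t, x)) (at t within {s..T})"
    by (rule primitive_on_has_vector_derivative_AE[OF limit_primitive]) blast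
  have "AE t in lebesgue. t \<notin> M" using M(1) by (intro AE_not_in) (simp add: negligible_iff_null_sets)
  then have "AE t in lebesgue. t \<in> {s..T} \<longrightarrow> (\<exists>v. ((\<lambda>t. limit_flow t x) has_vector_derivative v) (at t within {s..T}) \<and>
      (\<forall>i. lower_envelope (\<lambda>y. b t y $ i) (limit_flow t x) \<le> ereal (v $ i) \<and>
           ereal (v $ i) \<le> upper_envelope (\<lambda>y. b t y $ i) (limit_flow t x)))"
    using AE_not_N speed_tendsto
  proof eventually_elim
    case (elim t)
    show ?case
    proof
      assume t: "t \<in> {s..T}"
      show "\<exists>v. ((\<lambda>t. limit_flow t x) has_vector_derivative v) (at t within {s..T}) \<and>
        (\<forall>i. lower_envelope (\<lambda>y. b t y $ i) (limit_flow t x) \<le> ereal (v $ i) \<and>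
             ereal (v $ i) \<le> upper_envelope (\<lambda>y. b t y $ i) (limit_flow t x))"
        using M(2)[of t] limit_speed_envelope[of t] elim t by (intro exI[of _ "limit_speed (t, x)"]) auto
    qed
  qed
  then show "AE t in lebesgue_on {s..T}. \<exists>v. ((\<lambda>t. limit_flow t x) has_vector_derivative v) (at t within {s..T}) \<and>
        (\<forall>i. lower_envelope (\<lambda>y. b t y $ i) (limit_flow t x) \<le> ereal (v $ i) \<and>
             ereal (v $ i) \<le> upper_envelope (\<lambda>y. b t y $ i) (limit_flow t x))"
    by (subst AE_restrict_space_iff) auto
qed

end

end

section \<open>The norms of the conclusion\<close>

lemma absolutely_integrable_continuous_Icc:
  fixes u :: "real \<Rightarrow> 'b::euclidean_space"
  assumes "continuous_on {a..b} u"
  shows "u absolutely_integrable_on {a..b}"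
  using absolutely_integrable_continuous[of a b u] assms by simp

lemma primitive_on_test_function:
  assumes \<psi>: "test_function \<Omega> \<psi>"
  shows "primitive_on a b \<psi> (\<lambda>t. frechet_derivative \<psi> (at t) (1::real))"
proof -
  define d where "d t = frechet_derivative \<psi> (at t) 1" for t
  have cd: "continuous_on A d" for A
    using \<psi> unfolding test_function_def d_def by (blast intro: continuous_on_subset)
  have der: "(\<psi> has_vector_derivative d t) (at t within A)" for t A
  proof -
    have "\<psi> differentiable (at t)" using \<psi> by (simp add: test_function_def)
    then have D: "(\<psi> has_derivative frechet_derivative \<psi> (at t)) (at t)" by (rule frechet_derivative_works[THEN iffD1])
    moreover have "frechet_derivative \<psi> (at t) = (\<lambda>h. h *\<^sub>R d t)"
    proof
      fix h
      show "frechet_derivative \<psi> (at t) h = h *\<^sub>R d t"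
        using linear_simps(5)[OF has_derivative_bounded_linear[OF D], of h 1] by (simp add: d_def)
    qed
    ultimately show ?thesis unfolding has_vector_derivative_def by (metis has_derivative_at_withinI)
  qed
  show ?thesis
    unfolding primitive_on_def d_def[symmetric]
  proof (rule conjI, rule absolutely_integrable_continuous_Icc[OF cd], rule ballI)
    fix t assume "t \<in> {a..b}"
    then have "(d has_integral \<psi> t - \<psi> a) {a..t}"
      by (intro fundamental_theorem_of_calculus der) auto
    then show "\<psi> t = \<psi> a + integral {a..t} d" by (simp add: integral_unique)
  qed
qed

text \<open>The product with a test function is a primitive that vanishes at both ends of the interval.\<close>

lemma weak_derivative_primitive:
  fixes u :: "real \<Rightarrow> 'b::euclidean_space"
  assumes u: "primitive_on a b u g"
  shows "weak_derivative {a<..<b} 1 u g"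
  unfolding weak_derivative_def
proof (intro conjI allI impI)
  have cu: "continuous_on {a..b} u" by (rule primitive_on_continuous_on[OF u])
  have iu: "u absolutely_integrable_on {a..b}" by (rule absolutely_integrable_continuous_Icc[OF cu])
  have loc: "locally_integrable_on {a<..<b} h" if h: "h absolutely_integrable_on {a..b}" for h :: "real \<Rightarrow> 'b"
    unfolding locally_integrable_on_def
  proof (intro allI impI)
    fix K assume K: "K \<subseteq> {a<..<b}" "compact K"
    show "h absolutely_integrable_on K"
    proof (rule set_integrable_subset[OF h])
      show "K \<in> sets lebesgue" by (rule fmeasurableD[OF lmeasurable_compact[OF K(2)]])
      have "{a<..<b} \<subseteq> {a..b}" by auto
      with K(1) show "K \<subseteq> {a..b}" by (rule subset_trans)
    qed
  qed
  show "locally_integrable_on {a<..<b} u" by (rule loc[OF iu])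
  show "locally_integrable_on {a<..<b} g" by (rule loc[OF primitive_onD(1)[OF u]])
  fix \<psi> :: "real \<Rightarrow> real" assume \<psi>: "test_function {a<..<b} \<psi>"
  let ?d = "\<lambda>t. frechet_derivative \<psi> (at t) 1"
  show "(LINT x:{a<..<b}|lebesgue. ?d x *\<^sub>R u x) = - (LINT x:{a<..<b}|lebesgue. \<psi> x *\<^sub>R g x)"
  proof (cases "a \<le> b")
    case True
    note prim = primitive_on_scaleR[OF primitive_on_test_function[OF \<psi>, of a b] u]
    have c\<psi>: "continuous_on {a..b} \<psi>" by (rule primitive_on_continuous_on[OF primitive_on_test_function[OF \<psi>]])
    have cd: "continuous_on {a..b} ?d"
      using \<psi> unfolding test_function_def by (blast intro: continuous_on_subset)
    have i1: "(\<lambda>t. \<psi> t *\<^sub>R g t) absolutely_integrable_on {a..b}"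
      by (rule absolutely_integrable_continuous_scaleR[OF c\<psi> primitive_onD(1)[OF u]])
    have i2: "(\<lambda>t. ?d t *\<^sub>R u t) absolutely_integrable_on {a..b}"
      by (rule absolutely_integrable_continuous_scaleR[OF cd iu])
    have conv: "(LINT x:{a<..<b}|lebesgue. h x) = integral {a..b} h" if "h absolutely_integrable_on {a..b}" for h :: "real \<Rightarrow> 'b"
    proof -
      have "h absolutely_integrable_on {a<..<b}" by (rule set_integrable_subset[OF that]) auto
      from set_lebesgue_integral_eq_integral(2)[OF this] show ?thesis by (simp add: integral_open_interval_real)
    qed
    have "\<psi> a = 0" "\<psi> b = 0"
    proof -
      have "closure {x. \<psi> x \<noteq> 0} \<subseteq> {a<..<b}" using \<psi> unfolding test_function_def by (elim conjE)
      then have "{x. \<psi> x \<noteq> 0} \<subseteq> {a<..<b}" by (rule subset_trans[OF closure_subset])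
      then show "\<psi> a = 0" "\<psi> b = 0" by auto
    qed
    then have "0 = integral {a..b} (\<lambda>t. \<psi> t *\<^sub>R g t + ?d t *\<^sub>R u t)"
      using primitive_on_increment[OF prim order.refl True order.refl] by simp
    also have "\<dots> = integral {a..b} (\<lambda>t. \<psi> t *\<^sub>R g t) + integral {a..b} (\<lambda>t. ?d t *\<^sub>R u t)"
      using i1 i2 by (intro Henstock_Kurzweil_Integration.integral_add set_lebesgue_integral_eq_integral(1))
    finally show ?thesis unfolding conv[OF i1] conv[OF i2] by (simp add: eq_neg_iff_add_eq_0 add.commute)
  next
    case False
    then show ?thesis by (simp add: set_lebesgue_integral_def)
  qed
qed

lemma W11_norm_le:
  fixes u :: "real \<Rightarrow> 'b::euclidean_space"
  assumes u: "primitive_on a b u g" and ab: "a \<le> b"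
  shows "W11_norm a b u \<le> ennreal (b - a) * ennreal (norm (u a))
    + ennreal (b - a + 1) * (\<integral>\<^sup>+t\<in>{a..b}. ennreal (norm (g t)) \<partial>lebesgue)"
proof -
  define J where "J = (\<integral>\<^sup>+t\<in>{a..b}. ennreal (norm (g t)) \<partial>lebesgue)"
  have "W11_norm a b u \<le> (\<integral>\<^sup>+t\<in>{a<..<b}. ennreal (norm (u t)) \<partial>lebesgue) + (\<integral>\<^sup>+t\<in>{a<..<b}. ennreal (norm (g t)) \<partial>lebesgue)"
    unfolding W11_norm_def by (intro INF_lower) (simp add: weak_derivative_primitive[OF u])
  also have "\<dots> \<le> (\<integral>\<^sup>+t. (ennreal (norm (u a)) + J) * indicator {a..b} t \<partial>lebesgue) + J"
  proof (intro add_mono nn_integral_mono)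
    fix t
    show "ennreal (norm (u t)) * indicator {a<..<b} t \<le> (ennreal (norm (u a)) + J) * indicator {a..b} t"
    proof (cases "t \<in> {a<..<b}")
      case True
      then have t: "t \<in> {a..b}" by simp
      have "ennreal (norm (u t)) \<le> ennreal (norm (u a) + norm (u t - u a))"
        using norm_triangle_sub[of "u t" "u a"] by (intro ennreal_leI) simp
      also have "\<dots> = ennreal (norm (u a)) + ennreal (norm (u t - u a))" by (simp add: ennreal_plus)
      also have "ennreal (norm (u t - u a)) \<le> J"
        using primitive_on_dist_le[OF u primitive_on_const[of a b "u a"] _ t] by (simp add: J_def)
      finally show ?thesis using True t by (simp add: add_left_mono)
    qed simp
    show "(\<integral>\<^sup>+t\<in>{a<..<b}. ennreal (norm (g t)) \<partial>lebesgue) \<le> J"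
      unfolding J_def by (intro nn_integral_mono) (auto simp: indicator_def)
  qed
  also have "(\<integral>\<^sup>+t. (ennreal (norm (u a)) + J) * indicator {a..b} t \<partial>lebesgue) = (ennreal (norm (u a)) + J) * ennreal (b - a)"
    using ab by (subst nn_integral_cmult_indicator) auto
  also have "(ennreal (norm (u a)) + J) * ennreal (b - a) + J
      = ennreal (b - a) * ennreal (norm (u a)) + ennreal (b - a + 1) * J"
  proof -
    have "ennreal (b - a + 1) = ennreal (b - a) + 1" using ab ennreal_plus[of "b - a" 1] by simp
    then show ?thesis by (simp add: distrib_left distrib_right mult.commute add_ac)
  qed
  finally show ?thesis unfolding J_def .
qed

lemma ennreal_powr_mono: "x \<le> y \<Longrightarrow> 0 \<le> p \<Longrightarrow> ennreal_powr x p \<le> ennreal_powr y p"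
proof (cases "y = \<infinity>")
  case False
  assume *: "x \<le> y" "0 \<le> p"
  then have "x \<noteq> \<infinity>" using False by (auto simp: top_unique)
  moreover have "enn2real x powr p \<le> enn2real y powr p"
    using * False by (intro powr_mono2 enn2real_mono) (auto simp: less_top)
  ultimately show ?thesis using False by (simp add: ennreal_powr_def ennreal_leI)
qed (simp add: ennreal_powr_def)

lemma ennreal_powr_ennreal: "0 \<le> r \<Longrightarrow> ennreal_powr (ennreal r) p = ennreal (r powr p)"
  by (simp add: ennreal_powr_def)

lemma ennreal_powr_tendsto_0:
  assumes x: "(\<lambda>n. x n) \<longlonglongrightarrow> (0 :: ennreal)" and p: "p > 0"
  shows "(\<lambda>n. ennreal_powr (x n) p) \<longlonglongrightarrow> 0"
proof -
  have fin: "\<forall>\<^sub>F n in sequentially. x n < 1" using order_tendstoD(2)[OF x, of 1] by simp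
  have "x \<longlonglongrightarrow> ennreal 0" using x by simp
  then have "(\<lambda>n. enn2real (x n)) \<longlonglongrightarrow> 0" by (rule tendsto_enn2real) simp
  then have "(\<lambda>n. enn2real (x n) powr p) \<longlonglongrightarrow> 0" using p by (intro tendsto_zero_powrI[of _ _ "\<lambda>_. p" p]) auto
  then have "(\<lambda>n. ennreal (enn2real (x n) powr p)) \<longlonglongrightarrow> ennreal 0" by (rule tendsto_ennrealI)
  moreover have "\<forall>\<^sub>F n in sequentially. ennreal (enn2real (x n) powr p) = ennreal_powr (x n) p"
    using fin by eventually_elim (auto simp: ennreal_powr_def)
  ultimately show ?thesis by (simp add: tendsto_cong)
qed

lemma ennreal_powr_borel [measurable]: "(\<lambda>x. ennreal_powr x p) \<in> borel_measurable borel"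
  unfolding ennreal_powr_def[abs_def] by measurable

lemma Lp_norm_on_mono_AE:
  assumes "AE x in lebesgue. x \<in> K \<longrightarrow> h x \<le> h' x" and p: "p \<ge> 1"
  shows "Lp_norm_on K p h \<le> Lp_norm_on K p h'"
  unfolding Lp_norm_on_def
proof (intro ennreal_powr_mono nn_integral_mono_AE)
  show "AE x in lebesgue. ennreal_powr (h x) p * indicator K x \<le> ennreal_powr (h' x) p * indicator K x"
    using assms(1) by (rule AE_mp) (use p in \<open>auto intro!: AE_I2 ennreal_powr_mono simp: indicator_def\<close>)
qed (use p in auto)

lemma nn_integral_const_compact:
  fixes K :: "'a::euclidean_space set"
  assumes "compact K"
  shows "(\<integral>\<^sup>+x\<in>K. ennreal c \<partial>lebesgue) < \<infinity>"
proof -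
  have K: "K \<in> lmeasurable" using assms by (rule lmeasurable_compact)
  have "(\<integral>\<^sup>+x\<in>K. ennreal c \<partial>lebesgue) = ennreal c * emeasure lebesgue K"
    by (rule nn_integral_cmult_indicator[OF fmeasurableD[OF K]])
  also have "\<dots> < \<infinity>"
    using fmeasurableD2[OF K] by (simp add: ennreal_mult_less_top less_top del: emeasure_completion)
  finally show ?thesis .
qed

lemma Lp_norm_on_finite:
  fixes h :: "'a::euclidean_space \<Rightarrow> ennreal"
  assumes K: "compact K" and h: "AE x in lebesgue. x \<in> K \<longrightarrow> h x \<le> ennreal C" and p: "p \<ge> 1"
  shows "Lp_norm_on K p h < \<infinity>"
proof -
  have "Lp_norm_on K p h \<le> Lp_norm_on K p (\<lambda>_. ennreal (max 0 C))"
  proof (rule Lp_norm_on_mono_AE[OF _ p], rule AE_mp[OF h], rule AE_I2, intro impI)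
    fix x assume "x \<in> K \<longrightarrow> h x \<le> ennreal C" "x \<in> K"
    moreover have "ennreal C \<le> ennreal (max 0 C)" by (rule ennreal_leI) simp
    ultimately show "h x \<le> ennreal (max 0 C)" using order_trans by blast
  qed
  also have "\<dots> < \<infinity>"
    using nn_integral_const_compact[OF K, of "max 0 C powr p"]
    by (simp add: Lp_norm_on_def ennreal_powr_ennreal) (simp add: ennreal_powr_def)
  finally show ?thesis .
qed

lemma Lp_norm_on_tendsto_0:
  fixes h :: "nat \<Rightarrow> 'a::euclidean_space \<Rightarrow> ennreal"
  assumes K: "compact K" and meas: "\<And>n. h n \<in> borel_measurable lebesgue"
    and bound: "\<And>n. AE x in lebesgue. x \<in> K \<longrightarrow> h n x \<le> ennreal C"
    and lim: "AE x in lebesgue. (\<lambda>n. h n x) \<longlonglongrightarrow> 0" and p: "p \<ge> 1"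
  shows "(\<lambda>n. Lp_norm_on K p (h n)) \<longlonglongrightarrow> 0"
proof -
  have Ks: "K \<in> sets lebesgue" using lmeasurable_compact[OF K] by (simp add: fmeasurableD)
  have "(\<lambda>n. \<integral>\<^sup>+x\<in>K. ennreal_powr (h n x) p \<partial>lebesgue) \<longlonglongrightarrow> (\<integral>\<^sup>+x. 0 \<partial>(lebesgue :: 'a measure))"
  proof (rule nn_integral_dominated_convergence)
    show "(\<lambda>x. ennreal_powr (h n x) p * indicator K x) \<in> borel_measurable lebesgue" for n
      using measurable_compose[OF meas ennreal_powr_borel] Ks by (intro borel_measurable_times_ennreal) auto
    show "(\<lambda>x. ennreal (max 0 C powr p) * indicator K x) \<in> borel_measurable lebesgue"
      using Ks by (intro borel_measurable_times_ennreal) auto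
    show "AE x in lebesgue. ennreal_powr (h n x) p * indicator K x \<le> ennreal (max 0 C powr p) * indicator K x" for n
      using bound[of n]
    proof (rule AE_mp, intro AE_I2 impI)
      fix x assume "x \<in> K \<longrightarrow> h n x \<le> ennreal C"
      moreover have "ennreal C \<le> ennreal (max 0 C)" by (rule ennreal_leI) simp
      ultimately have "x \<in> K \<Longrightarrow> ennreal_powr (h n x) p \<le> ennreal_powr (ennreal (max 0 C)) p"
        using p by (intro ennreal_powr_mono) (auto intro: order_trans)
      then show "ennreal_powr (h n x) p * indicator K x \<le> ennreal (max 0 C powr p) * indicator K x"
        by (simp add: ennreal_powr_ennreal indicator_def)
    qed
    show "(\<integral>\<^sup>+x\<in>K. ennreal (max 0 C powr p) \<partial>lebesgue) < \<infinity>" by (rule nn_integral_const_compact[OF K])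
    show "AE x in lebesgue. (\<lambda>n. ennreal_powr (h n x) p * indicator K x) \<longlonglongrightarrow> 0"
      using lim
    proof (rule AE_mp, intro AE_I2 impI)
      fix x assume "(\<lambda>n. h n x) \<longlonglongrightarrow> 0"
      then have "(\<lambda>n. ennreal_powr (h n x) p) \<longlonglongrightarrow> 0" using p by (intro ennreal_powr_tendsto_0) auto
      then show "(\<lambda>n. ennreal_powr (h n x) p * indicator K x) \<longlonglongrightarrow> 0" by (cases "x \<in> K") simp_all
    qed
  qed simp_all
  then show ?thesis unfolding Lp_norm_on_def using p by (intro ennreal_powr_tendsto_0) auto
qed

lemma compact_norm_bound:
  fixes K :: "'a::euclidean_space set"
  assumes "compact K"
  obtains R where "R \<ge> 0" "\<And>x. x \<in> K \<Longrightarrow> norm x \<le> R"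
  using compact_imp_bounded[OF assms] unfolding bounded_pos by (meson less_imp_le)

section \<open>Families of paths with dominated speed\<close>

text \<open>\<open>w t x\<close> is the position at time \<open>t\<close> of the path started at \<open>x\<close>, and \<open>g (t, x)\<close> its speed.\<close>

locale path_family =
  fixes s T :: real and w :: "real \<Rightarrow> real^'d \<Rightarrow> real^'d" and g :: "real \<times> (real^'d) \<Rightarrow> real^'d"
    and E :: real and a :: "real \<Rightarrow> real"
  assumes sT: "s \<le> T" and E: "E \<ge> 1" and a: "a absolutely_integrable_on {s..T}"
    and paths: "AE x in lebesgue. w s x = x \<and> primitive_on s T (\<lambda>t. w t x) (\<lambda>t. g (t, x)) \<and>
      (AE t in lebesgue. t \<in> {s..T} \<longrightarrow> norm (g (t, x)) \<le> E * (1 + norm x) * a t)"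
    and w_measurable: "\<And>t. t \<in> {s..T} \<Longrightarrow> w t \<in> borel_measurable lebesgue"
begin

lemma abs_a: "(\<lambda>t. \<bar>a t\<bar>) absolutely_integrable_on {s..T}"
  by (rule absolutely_integrable_abs[OF a])

lemma speed_integral_bound:
  assumes bound: "AE t in lebesgue. t \<in> {s..T} \<longrightarrow> norm (g (t, x)) \<le> E * (1 + norm x) * a t"
    and prim: "primitive_on s T (\<lambda>t. w t x) (\<lambda>t. g (t, x))"
    and rt: "s \<le> r" "r \<le> t" "t \<le> T"
  shows "integral {r..t} (\<lambda>t. norm (g (t, x))) \<le> E * (1 + norm x) * integral {r..t} (\<lambda>t. \<bar>a t\<bar>)"
proof -
  have sub: "{r..t} \<subseteq> {s..T}" using rt by auto
  have "AE t in lebesgue. \<not> (t \<in> {s..T} \<and> \<not> norm (g (t, x)) \<le> E * (1 + norm x) * a t)"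
    using bound by (rule AE_mp) (auto intro!: AE_I2)
  then obtain N where N: "N \<in> null_sets lebesgue" "{t. t \<in> {s..T} \<and> \<not> norm (g (t, x)) \<le> E * (1 + norm x) * a t} \<subseteq> N"
    unfolding eventually_ae_filter by auto
  have ia: "(\<lambda>t. \<bar>a t\<bar>) integrable_on {r..t}"
    by (rule integrable_subinterval_real[OF set_lebesgue_integral_eq_integral(1)[OF abs_a] sub])
  have "integral {r..t} (\<lambda>t. norm (g (t, x))) \<le> integral {r..t} (\<lambda>t. E * (1 + norm x) * \<bar>a t\<bar>)"
  proof (rule integral_mono_negligible[of _ _ _ N])
    have "(\<lambda>t. g (t, x)) absolutely_integrable_on {r..t}"
      by (rule set_integrable_subset[OF primitive_onD(1)[OF prim] _ sub]) simp
    then show "(\<lambda>t. norm (g (t, x))) integrable_on {r..t}" by (simp add: absolutely_integrable_on_def)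
    show "(\<lambda>t. E * (1 + norm x) * \<bar>a t\<bar>) integrable_on {r..t}" by (rule integrable_on_mult_right[OF ia])
    show "negligible N" using N(1) by (simp add: negligible_iff_null_sets)
    fix \<tau> assume "\<tau> \<in> {r..t} - N"
    then have "norm (g (\<tau>, x)) \<le> E * (1 + norm x) * a \<tau>" using N(2) sub by blast
    also have "\<dots> \<le> E * (1 + norm x) * \<bar>a \<tau>\<bar>" using E by (intro mult_left_mono) auto
    finally show "norm (g (\<tau>, x)) \<le> E * (1 + norm x) * \<bar>a \<tau>\<bar>" .
  qed
  then show ?thesis by simp
qed

definition total :: real where "total = integral {s..T} (\<lambda>t. \<bar>a t\<bar>)"

lemma total_nonneg: "total \<ge> 0"
  unfolding total_def by (intro integral_nonneg set_lebesgue_integral_eq_integral(1)[OF abs_a]) auto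

lemma nn_speed_bound:
  assumes bound: "AE t in lebesgue. t \<in> {s..T} \<longrightarrow> norm (g (t, x)) \<le> E * (1 + norm x) * a t"
    and prim: "primitive_on s T (\<lambda>t. w t x) (\<lambda>t. g (t, x))"
  shows "(\<integral>\<^sup>+t\<in>{s..T}. ennreal (norm (g (t, x))) \<partial>lebesgue) \<le> ennreal (E * (1 + norm x) * total)"
proof -
  have "(\<lambda>t. norm (g (t, x))) absolutely_integrable_on {s..T}"
    using absolutely_integrable_norm[OF primitive_onD(1)[OF prim]] by (simp add: o_def)
  then show ?thesis
    using speed_integral_bound[OF bound prim order.refl sT order.refl]
    by (subst nn_set_integral_eq_integral) (auto intro!: ennreal_leI simp: total_def)
qed

lemma path_increments:
  "AE x in lebesgue. w s x = x \<and> (\<forall>t\<in>{s..T}. \<forall>r\<in>{s..T}. norm (w r x - w t x) \<le> E * (1 + norm x)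
     * \<bar>integral {s..r} (\<lambda>t. \<bar>a t\<bar>) - integral {s..t} (\<lambda>t. \<bar>a t\<bar>)\<bar>)"
  using paths
proof (rule AE_mp, intro AE_I2 impI conjI ballI)
  define I where "I t = integral {s..t} (\<lambda>t. \<bar>a t\<bar>)" for t
  fix x assume *: "w s x = x \<and> primitive_on s T (\<lambda>t. w t x) (\<lambda>t. g (t, x)) \<and>
    (AE t in lebesgue. t \<in> {s..T} \<longrightarrow> norm (g (t, x)) \<le> E * (1 + norm x) * a t)"
  then show "w s x = x" by simp
  have le: "norm (w r x - w t x) \<le> E * (1 + norm x) * \<bar>I r - I t\<bar>" if "s \<le> t" "t \<le> r" "r \<le> T" for r t
  proof -
    have "integral {t..r} (\<lambda>t. \<bar>a t\<bar>) \<le> \<bar>I r - I t\<bar>"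
      unfolding I_def integral_adjacent[OF set_lebesgue_integral_eq_integral(1)[OF abs_a] that] by (rule abs_ge_self)
    then have "E * (1 + norm x) * integral {t..r} (\<lambda>t. \<bar>a t\<bar>) \<le> E * (1 + norm x) * \<bar>I r - I t\<bar>"
      using E by (intro mult_left_mono) auto
    moreover have "norm (w r x - w t x) \<le> integral {t..r} (\<lambda>t. norm (g (t, x)))"
      using * by (intro primitive_on_increment_le[OF _ that, of "\<lambda>t. w t x"]) simp
    moreover have "integral {t..r} (\<lambda>t. norm (g (t, x))) \<le> E * (1 + norm x) * integral {t..r} (\<lambda>t. \<bar>a t\<bar>)"
      using * that by (intro speed_integral_bound) simp_all
    ultimately show ?thesis by linarith
  qed
  fix t r assume tr: "t \<in> {s..T}" "r \<in> {s..T}"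
  show "norm (w r x - w t x) \<le> E * (1 + norm x) * \<bar>integral {s..r} (\<lambda>t. \<bar>a t\<bar>) - integral {s..t} (\<lambda>t. \<bar>a t\<bar>)\<bar>"
    unfolding I_def[symmetric]
  proof (cases "t \<le> r")
    case True
    then show "norm (w r x - w t x) \<le> E * (1 + norm x) * \<bar>I r - I t\<bar>" using le[of t r] tr by simp
  next
    case False
    then show "norm (w r x - w t x) \<le> E * (1 + norm x) * \<bar>I r - I t\<bar>"
      using le[of r t] tr by (simp add: norm_minus_commute abs_minus_commute)
  qed
qed

text \<open>On a compact set the increments in time are bounded uniformly over almost every starting point.\<close>

lemma in_C_Lp_loc:
  assumes p: "p \<ge> 1"
  shows "in_C_Lp_loc s T p w"
proof -
  define I where "I t = integral {s..t} (\<lambda>t. \<bar>a t\<bar>)" for t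
  have cI: "continuous_on {s..T} I"
    unfolding I_def by (rule indefinite_integral_continuous_1[OF set_lebesgue_integral_eq_integral(1)[OF abs_a]])
  note inc = path_increments[folded I_def]
  have loc: "in_Lp_loc p (w t)" if t: "t \<in> {s..T}" for t
    unfolding in_Lp_loc_def
  proof (intro conjI allI impI w_measurable[OF t])
    fix K :: "(real^'d) set" assume K: "compact K"
    obtain R where R: "R \<ge> 0" "\<And>x. x \<in> K \<Longrightarrow> norm x \<le> R" using compact_norm_bound[OF K] by metis
    show "Lp_norm_on K p (\<lambda>x. ennreal (norm (w t x))) < \<infinity>"
    proof (rule Lp_norm_on_finite[OF K _ p], rule AE_mp[OF inc], rule AE_I2, intro impI)
      fix x assume *: "w s x = x \<and> (\<forall>t\<in>{s..T}. \<forall>r\<in>{s..T}. norm (w r x - w t x) \<le> E * (1 + norm x) * \<bar>I r - I t\<bar>)"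
        and "x \<in> K"
      then have x: "norm x \<le> R" using R(2) by blast
      have "norm (w t x - w s x) \<le> E * (1 + norm x) * \<bar>I t - I s\<bar>"
        using *[THEN conjunct2, rule_format, of s t] t sT by simp
      then have "norm (w t x) \<le> R + E * (1 + norm x) * \<bar>I t - I s\<bar>"
        using norm_triangle_sub[of "w t x" "w s x"] * x by simp
      also have "\<dots> \<le> R + E * (1 + R) * \<bar>I t - I s\<bar>"
        using x E by (intro add_left_mono mult_right_mono mult_left_mono) auto
      finally show "ennreal (norm (w t x)) \<le> ennreal (R + E * (1 + R) * \<bar>I t - I s\<bar>)" by (rule ennreal_leI)
    qed
  qed
  have cont: "((\<lambda>r. Lp_norm_on K p (\<lambda>x. ennreal (norm (w r x - w t x)))) \<longlongrightarrow> 0) (at t within {s..T})"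
    if K: "compact K" and t: "t \<in> {s..T}" for K t
    unfolding tendsto_at_iff_sequentially o_def
  proof (intro allI impI)
    fix r :: "nat \<Rightarrow> real" assume r: "\<forall>i. r i \<in> {s..T} - {t}" "r \<longlonglongrightarrow> t"
    obtain R where R: "R \<ge> 0" "\<And>x. x \<in> K \<Longrightarrow> norm x \<le> R" using compact_norm_bound[OF K] by metis
    define \<delta> where "\<delta> n = E * (1 + R) * \<bar>I (r n) - I t\<bar>" for n
    have "(\<lambda>n. I (r n)) \<longlonglongrightarrow> I t"
      by (rule continuous_on_tendsto_compose[OF cI r(2) t]) (use r(1) in auto)
    then have "\<delta> \<longlonglongrightarrow> E * (1 + R) * \<bar>I t - I t\<bar>" unfolding \<delta>_def by (intro tendsto_intros)
    then have \<delta>0: "\<delta> \<longlonglongrightarrow> 0" by simp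
    then obtain C where C: "\<And>n. \<bar>\<delta> n\<bar> \<le> C"
      using convergent_imp_Bseq[of \<delta>] unfolding convergent_def Bseq_def real_norm_def by blast
    have lim: "(\<lambda>n. Lp_norm_on K p (\<lambda>x. ennreal (\<delta> n))) \<longlonglongrightarrow> 0"
    proof (rule Lp_norm_on_tendsto_0[OF K _ _ _ p])
      show "AE x in lebesgue. x \<in> K \<longrightarrow> ennreal (\<delta> n) \<le> ennreal C" for n
        using C[of n] by (auto intro!: AE_I2 ennreal_leI)
      show "AE x in lebesgue. (\<lambda>n. ennreal (\<delta> n)) \<longlonglongrightarrow> 0"
        using tendsto_ennrealI[OF \<delta>0] by (auto intro!: AE_I2)
    qed simp
    have le: "Lp_norm_on K p (\<lambda>x. ennreal (norm (w (r n) x - w t x))) \<le> Lp_norm_on K p (\<lambda>x. ennreal (\<delta> n))" for n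
    proof (rule Lp_norm_on_mono_AE[OF _ p], rule AE_mp[OF inc], rule AE_I2, intro impI ennreal_leI)
      fix x assume *: "w s x = x \<and> (\<forall>t\<in>{s..T}. \<forall>r\<in>{s..T}. norm (w r x - w t x) \<le> E * (1 + norm x) * \<bar>I r - I t\<bar>)"
        and "x \<in> K"
      then have x: "norm x \<le> R" using R(2) by blast
      have "r n \<in> {s..T}" using r(1) by blast
      then have "norm (w (r n) x - w t x) \<le> E * (1 + norm x) * \<bar>I (r n) - I t\<bar>" using * t by blast
      also have "\<dots> \<le> \<delta> n" unfolding \<delta>_def using x E by (intro mult_right_mono mult_left_mono) auto
      finally show "norm (w (r n) x - w t x) \<le> \<delta> n" .
    qed
    show "(\<lambda>n. Lp_norm_on K p (\<lambda>x. ennreal (norm (w (r n) x - w t x)))) \<longlonglongrightarrow> 0"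
      by (rule tendsto_sandwich[OF _ _ tendsto_const lim]) (auto intro!: always_eventually le)
  qed
  show ?thesis unfolding in_C_Lp_loc_def using loc cont by blast
qed

lemma W11_finite:
  assumes p: "p \<ge> 1" and K: "compact K"
  shows "Lp_norm_on K p (\<lambda>x. W11_norm s T (\<lambda>t. w t x)) < \<infinity>"
proof -
  obtain R where R: "R \<ge> 0" "\<And>x. x \<in> K \<Longrightarrow> norm x \<le> R" using compact_norm_bound[OF K] by metis
  show ?thesis
  proof (rule Lp_norm_on_finite[OF K _ p], rule AE_mp[OF paths], rule AE_I2, intro impI)
    fix x assume *: "w s x = x \<and> primitive_on s T (\<lambda>t. w t x) (\<lambda>t. g (t, x)) \<and>
      (AE t in lebesgue. t \<in> {s..T} \<longrightarrow> norm (g (t, x)) \<le> E * (1 + norm x) * a t)" and "x \<in> K"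
    then have x: "norm x \<le> R" using R(2) by blast
    have "W11_norm s T (\<lambda>t. w t x) \<le> ennreal (T - s) * ennreal (norm (w s x))
        + ennreal (T - s + 1) * (\<integral>\<^sup>+t\<in>{s..T}. ennreal (norm (g (t, x))) \<partial>lebesgue)"
      using * by (intro W11_norm_le sT) simp
    also have "\<dots> \<le> ennreal (T - s) * ennreal R + ennreal (T - s + 1) * ennreal (E * (1 + R) * total)"
    proof (intro add_mono mult_left_mono)
      show "ennreal (norm (w s x)) \<le> ennreal R" using * x by (simp add: ennreal_leI)
      have "(\<integral>\<^sup>+t\<in>{s..T}. ennreal (norm (g (t, x))) \<partial>lebesgue) \<le> ennreal (E * (1 + norm x) * total)"
        using * by (intro nn_speed_bound) simp_all
      also have "\<dots> \<le> ennreal (E * (1 + R) * total)"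
        using x E total_nonneg by (intro ennreal_leI mult_right_mono mult_left_mono) auto
      finally show "(\<integral>\<^sup>+t\<in>{s..T}. ennreal (norm (g (t, x))) \<partial>lebesgue) \<le> ennreal (E * (1 + R) * total)" .
    qed auto
    also have "\<dots> = ennreal ((T - s) * R + (T - s + 1) * (E * (1 + R) * total))"
      using sT R E total_nonneg by (simp add: ennreal_plus ennreal_mult)
    finally show "W11_norm s T (\<lambda>t. w t x) \<le> ennreal ((T - s) * R + (T - s + 1) * (E * (1 + R) * total))" .
  qed
qed

end

section \<open>Strong measurability of families of paths\<close>

text \<open>Every coordinate is clamped to \<open>[-m, m]\<close> and rounded down to a multiple of \<open>\<delta>\<close>, so that there are only finitely many
  values.\<close>

definition grid_point :: "real \<Rightarrow> real \<Rightarrow> real^'d \<Rightarrow> real^'d" where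
  "grid_point m \<delta> x = (\<chi> i. \<delta> * of_int \<lfloor>max (- m) (min m (x $ i)) / \<delta>\<rfloor>)"

lemma grid_point_simple:
  assumes "\<delta> > 0"
  shows "simple_function lebesgue (grid_point m \<delta> :: real^'d \<Rightarrow> real^'d)"
proof (rule simple_function_borel_measurable)
  have "(\<lambda>x::real^'d. x $ i) \<in> borel_measurable borel" for i by (intro borel_measurable_continuous_onI continuous_intros)
  note [measurable] = this
  have "grid_point m \<delta> \<in> borel_measurable (borel :: (real^'d) measure)"
    unfolding grid_point_def[abs_def]
    by (rule borel_measurable_vecI) (simp, measurable)
  then show "(grid_point m \<delta> :: real^'d \<Rightarrow> real^'d) \<in> borel_measurable lebesgue" by (simp add: measurable_completion)
  define V where "V = (\<lambda>z::int. \<delta> * of_int z) ` {\<lfloor>- \<bar>m\<bar> / \<delta>\<rfloor>..\<lfloor>\<bar>m\<bar> / \<delta>\<rfloor>}"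
  have "finite V" by (simp add: V_def)
  have "range (grid_point m \<delta> :: real^'d \<Rightarrow> real^'d) \<subseteq> {v. \<forall>i. v $ i \<in> V}"
  proof safe
    fix x :: "real^'d" and i
    have "\<bar>max (- m) (min m (x $ i))\<bar> \<le> \<bar>m\<bar>" by (auto simp: max_def min_def)
    then have "- \<bar>m\<bar> \<le> max (- m) (min m (x $ i))" "max (- m) (min m (x $ i)) \<le> \<bar>m\<bar>" by linarith+
    then have "- \<bar>m\<bar> / \<delta> \<le> max (- m) (min m (x $ i)) / \<delta>" "max (- m) (min m (x $ i)) / \<delta> \<le> \<bar>m\<bar> / \<delta>"
      using assms by (intro divide_right_mono; simp)+
    then have "\<lfloor>max (- m) (min m (x $ i)) / \<delta>\<rfloor> \<in> {\<lfloor>- \<bar>m\<bar> / \<delta>\<rfloor>..\<lfloor>\<bar>m\<bar> / \<delta>\<rfloor>}"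
      unfolding atLeastAtMost_iff by (intro conjI floor_mono)
    then show "grid_point m \<delta> x $ i \<in> V" unfolding V_def grid_point_def by auto
  qed
  moreover have "finite {v :: real^'d. \<forall>i. v $ i \<in> V}"
  proof -
    have "finite {h :: 'd \<Rightarrow> real. \<forall>i. h i \<in> V}"
      using finite_PiE[of "UNIV :: 'd set" "\<lambda>_. V"] \<open>finite V\<close> by (simp add: PiE_def Pi_def extensional_def)
    then have "finite (vec_lambda ` {h :: 'd \<Rightarrow> real. \<forall>i. h i \<in> V})" by (rule finite_imageI)
    moreover have "{v :: real^'d. \<forall>i. v $ i \<in> V} \<subseteq> vec_lambda ` {h :: 'd \<Rightarrow> real. \<forall>i. h i \<in> V}"
    proof
      fix v :: "real^'d" assume "v \<in> {v. \<forall>i. v $ i \<in> V}"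
      then show "v \<in> vec_lambda ` {h :: 'd \<Rightarrow> real. \<forall>i. h i \<in> V}"
        by (intro image_eqI[of _ _ "\<lambda>i. v $ i"]) auto
    qed
    ultimately show ?thesis by (rule finite_subset[rotated])
  qed
  ultimately show "finite (grid_point m \<delta> ` space (lebesgue :: (real^'d) measure))" by (simp add: finite_subset)
qed

lemma grid_point_close:
  fixes x :: "real^'d"
  assumes "\<delta> > 0" and "norm x \<le> m"
  shows "norm (x - grid_point m \<delta> x) \<le> real CARD('d) * \<delta>"
proof (rule norm_le_card_times)
  fix i
  have "\<bar>x $ i\<bar> \<le> m" using component_le_norm_cart[of x i] assms(2) by linarith
  then have c: "max (- m) (min m (x $ i)) = x $ i" by linarith
  have "of_int \<lfloor>x $ i / \<delta>\<rfloor> \<le> x $ i / \<delta>" "x $ i / \<delta> < of_int \<lfloor>x $ i / \<delta>\<rfloor> + 1" by linarith+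
  then have "\<delta> * of_int \<lfloor>x $ i / \<delta>\<rfloor> \<le> \<delta> * (x $ i / \<delta>)" "\<delta> * (x $ i / \<delta>) < \<delta> * (of_int \<lfloor>x $ i / \<delta>\<rfloor> + 1)"
    using assms(1) by (intro mult_left_mono mult_strict_left_mono; simp)+
  then have "\<delta> * of_int \<lfloor>x $ i / \<delta>\<rfloor> \<le> x $ i" "x $ i < \<delta> * of_int \<lfloor>x $ i / \<delta>\<rfloor> + \<delta>"
    using assms(1) by (simp_all add: distrib_left)
  then show "\<bar>(x - grid_point m \<delta> x) $ i\<bar> \<le> \<delta>" by (simp add: grid_point_def c)
qed

text \<open>The \<open>n\<close>-th simple function follows the \<open>n\<close>-th approximating family from the points of a grid that is
  fine enough for the Lipschitz constant of that family.\<close>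

lemma W11_strongly_measurable_limit:
  fixes w :: "nat \<Rightarrow> real \<Rightarrow> real^'d \<Rightarrow> real^'d" and g :: "nat \<Rightarrow> real \<times> (real^'d) \<Rightarrow> real^'d"
  assumes sT: "s \<le> T" and w: "\<And>n x. primitive_on s T (\<lambda>t. w n t x) (\<lambda>t. g n (t, x))" "\<And>n x. w n s x = x"
    and M: "\<And>n. M n \<ge> 0" and lip: "\<And>n x y. (\<integral>\<^sup>+t\<in>{s..T}. ennreal (norm (g n (t, x) - g n (t, y))) \<partial>lebesgue)
      \<le> ennreal (M n * norm (x - y))"
    and v: "AE x in lebesgue. v s x = x \<and> primitive_on s T (\<lambda>t. v t x) (\<lambda>t. h (t, x)) \<and>
      (\<lambda>n. \<integral>\<^sup>+t\<in>{s..T}. ennreal (norm (g n (t, x) - h (t, x))) \<partial>lebesgue) \<longlonglongrightarrow> 0"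
  shows "W11_strongly_measurable s T (\<lambda>x t. v t x)"
  unfolding W11_strongly_measurable_def
proof (intro exI conjI allI)
  \<comment> \<open>This mesh makes both the distance to the grid and its product with \<open>M n\<close> at most \<open>1 / Suc n\<close>.\<close>
  define \<delta> where "\<delta> n = 1 / (real CARD('d) * (1 + M n) * real (Suc n))" for n
  have \<delta>: "\<delta> n > 0" for n using M[of n] by (simp add: \<delta>_def add_pos_nonneg)
  define \<rho> :: "nat \<Rightarrow> real^'d \<Rightarrow> real^'d" where "\<rho> n = grid_point (real n) (\<delta> n)" for n
  let ?S = "\<lambda>n x t. w n t (\<rho> n x)"
  show "simple_function lebesgue (?S n)" for n
    using simple_function_compose[OF grid_point_simple[OF \<delta>], of "\<lambda>y t. w n t y"] by (simp add: \<rho>_def o_def)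
  show "W11_norm s T (?S n x) < \<infinity>" for n x
  proof -
    have "(\<lambda>t. norm (g n (t, \<rho> n x))) absolutely_integrable_on {s..T}"
      using absolutely_integrable_norm[OF primitive_onD(1)[OF w(1)]] by (simp add: o_def)
    then have "(\<integral>\<^sup>+t\<in>{s..T}. ennreal (norm (g n (t, \<rho> n x))) \<partial>lebesgue) < \<infinity>"
      by (subst nn_set_integral_eq_integral) auto
    then have "ennreal (T - s) * ennreal (norm (w n s (\<rho> n x)))
        + ennreal (T - s + 1) * (\<integral>\<^sup>+t\<in>{s..T}. ennreal (norm (g n (t, \<rho> n x))) \<partial>lebesgue) < \<infinity>"
      by (simp add: ennreal_mult_less_top)
    then show ?thesis by (rule order.strict_trans1[OF W11_norm_le[OF w(1) sT]])
  qed
  show "AE x in lebesgue. (\<lambda>n. W11_norm s T (\<lambda>t. v t x - ?S n x t)) \<longlonglongrightarrow> 0"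
    using v
  proof (rule AE_mp, intro AE_I2 impI)
    fix x :: "real^'d"
    define err where "err n = (\<integral>\<^sup>+t\<in>{s..T}. ennreal (norm (g n (t, x) - h (t, x))) \<partial>lebesgue)" for n
    assume "v s x = x \<and> primitive_on s T (\<lambda>t. v t x) (\<lambda>t. h (t, x)) \<and>
      (\<lambda>n. \<integral>\<^sup>+t\<in>{s..T}. ennreal (norm (g n (t, x) - h (t, x))) \<partial>lebesgue) \<longlonglongrightarrow> 0"
    then have vx: "v s x = x" and prim: "primitive_on s T (\<lambda>t. v t x) (\<lambda>t. h (t, x))" and err: "err \<longlonglongrightarrow> 0"
      by (auto simp: err_def[abs_def])
    obtain m :: nat where m: "norm x \<le> real m" using real_arch_simple by blast
    define B where "B n = ennreal (T - s) * ennreal (1 / real (Suc n)) + ennreal (T - s + 1) * (err n + ennreal (1 / real (Suc n)))" for n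
    have "B \<longlonglongrightarrow> ennreal (T - s) * ennreal 0 + ennreal (T - s + 1) * (0 + ennreal 0)"
      unfolding B_def using LIMSEQ_inverse_real_of_nat
      by (intro tendsto_add ennreal_tendsto_cmult err tendsto_ennrealI) (simp_all add: divide_inverse)
    then have B0: "B \<longlonglongrightarrow> 0" by simp
    have le: "W11_norm s T (\<lambda>t. v t x - ?S n x t) \<le> B n" if n: "n \<ge> m" for n
    proof -
      have c: "norm (x - \<rho> n x) \<le> 1 / ((1 + M n) * real (Suc n))"
        using grid_point_close[OF \<delta>[of n], of x "real n"] m n by (simp add: \<rho>_def \<delta>_def)
      have c1: "norm (x - \<rho> n x) \<le> 1 / real (Suc n)"
        using c M[of n] by (rule_tac order_trans[OF c]) (auto intro!: divide_left_mono mult_pos_pos simp: add_pos_nonneg mult_le_cancel_right1)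
      have c2: "M n * norm (x - \<rho> n x) \<le> 1 / real (Suc n)"
      proof -
        have "M n * norm (x - \<rho> n x) \<le> (1 + M n) * (1 / ((1 + M n) * real (Suc n)))"
          using c M[of n] by (intro mult_mono) auto
        also have "\<dots> = 1 / real (Suc n)" using M[of n] by (simp add: add_pos_nonneg less_imp_neq[symmetric])
        finally show ?thesis .
      qed
      have meas: "(\<lambda>t. ennreal (norm (k t)) * indicator {s..T} t) \<in> borel_measurable lebesgue"
        if "k absolutely_integrable_on {s..T}" for k :: "real \<Rightarrow> real^'d"
      proof -
        have "(\<lambda>t. ennreal (norm (indicator {s..T} t *\<^sub>R k t))) \<in> borel_measurable lebesgue"
          using borel_measurable_integrable[OF that[unfolded set_integrable_def]] by measurable
        then show ?thesis by (rule measurable_cong[THEN iffD1, rotated]) (simp add: indicator_def)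
      qed
      have "W11_norm s T (\<lambda>t. v t x - ?S n x t) \<le> ennreal (T - s) * ennreal (norm (v s x - w n s (\<rho> n x)))
          + ennreal (T - s + 1) * (\<integral>\<^sup>+t\<in>{s..T}. ennreal (norm (h (t, x) - g n (t, \<rho> n x))) \<partial>lebesgue)"
        by (rule W11_norm_le[OF primitive_on_diff[OF prim w(1)] sT])
      also have "\<dots> \<le> B n"
        unfolding B_def
      proof (intro add_mono mult_left_mono)
        show "ennreal (norm (v s x - w n s (\<rho> n x))) \<le> ennreal (1 / real (Suc n))"
          using c1 by (intro ennreal_leI) (simp add: vx w(2))
        have "(\<integral>\<^sup>+t\<in>{s..T}. ennreal (norm (h (t, x) - g n (t, \<rho> n x))) \<partial>lebesgue)
            \<le> (\<integral>\<^sup>+t. ennreal (norm (g n (t, x) - h (t, x))) * indicator {s..T} t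
                + ennreal (norm (g n (t, x) - g n (t, \<rho> n x))) * indicator {s..T} t \<partial>lebesgue)"
        proof (rule nn_integral_mono)
          fix t
          have "norm (h (t, x) - g n (t, \<rho> n x)) \<le> norm (g n (t, x) - h (t, x)) + norm (g n (t, x) - g n (t, \<rho> n x))"
            using norm_triangle_ineq[of "h (t, x) - g n (t, x)" "g n (t, x) - g n (t, \<rho> n x)"] by (simp add: norm_minus_commute)
          then have "ennreal (norm (h (t, x) - g n (t, \<rho> n x))) \<le> ennreal (norm (g n (t, x) - h (t, x))) + ennreal (norm (g n (t, x) - g n (t, \<rho> n x)))"
            by (simp add: ennreal_plus[symmetric] ennreal_leI del: ennreal_plus)
          then show "ennreal (norm (h (t, x) - g n (t, \<rho> n x))) * indicator {s..T} t
            \<le> ennreal (norm (g n (t, x) - h (t, x))) * indicator {s..T} t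
                + ennreal (norm (g n (t, x) - g n (t, \<rho> n x))) * indicator {s..T} t"
            by (simp add: indicator_def)
        qed
        also have "\<dots> = err n + (\<integral>\<^sup>+t\<in>{s..T}. ennreal (norm (g n (t, x) - g n (t, \<rho> n x))) \<partial>lebesgue)"
          unfolding err_def
          by (intro nn_integral_add meas primitive_onD(1)[OF primitive_on_diff[OF w(1) prim]] primitive_onD(1)[OF primitive_on_diff[OF w(1) w(1)]])
        also have "\<dots> \<le> err n + ennreal (1 / real (Suc n))"
          using c2 by (intro add_left_mono order_trans[OF lip] ennreal_leI)
        finally show "(\<integral>\<^sup>+t\<in>{s..T}. ennreal (norm (h (t, x) - g n (t, \<rho> n x))) \<partial>lebesgue) \<le> err n + ennreal (1 / real (Suc n))" .
      qed auto
      finally show ?thesis .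
    qed
    show "(\<lambda>n. W11_norm s T (\<lambda>t. v t x - ?S n x t)) \<longlonglongrightarrow> 0"
      by (rule tendsto_sandwich[OF _ _ tendsto_const B0])
        (auto intro!: always_eventually eventually_sequentiallyI[of m] le)
  qed
qed

section \<open>The limit of a sequence of flows\<close>

context flow_sequence
begin

lemma subsequence:
  assumes "strict_mono k"
  shows "flow_sequence s T (\<lambda>n. f (k n)) b a c (\<lambda>n. L (k n)) N (\<lambda>n. X (k n)) (\<lambda>n. B (k n))"
proof (rule flow_sequence.intro)
  show "monotone_lipschitz_flow s T (f (k n)) a c (L (k n)) N (X (k n))" for n by (rule flow)
  show "B (k n) \<in> borel_measurable borel" for n by (rule B_borel)
  show "B (k n) (t, y) = f (k n) t y" if "t \<in> {s..T} - N" for n t y using that by (rule B_eq)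
  show "AE y in lborel. (\<lambda>n. f (k n) t y) \<longlonglongrightarrow> b t y" if "t \<in> {s..T} - N" for t
    using field_conv[OF that]
    by (rule AE_mp) (auto intro!: AE_I2 dest: LIMSEQ_subseq_LIMSEQ[OF _ assms] simp: o_def)
qed

definition speed_lipschitz_const :: "nat \<Rightarrow> real" where
  "speed_lipschitz_const n = exp (integral {s..T} (L n)) * integral {s..T} (\<lambda>t. \<bar>L n t\<bar>)"

lemmas abs_L = absolutely_integrable_abs[OF flow.L]

lemma speed_lipschitz_const_nonneg: "speed_lipschitz_const n \<ge> 0"
  unfolding speed_lipschitz_const_def
  by (intro mult_nonneg_nonneg integral_nonneg set_lebesgue_integral_eq_integral(1)[OF abs_L]) auto

lemma speed_lipschitz:
  "(\<integral>\<^sup>+t\<in>{s..T}. ennreal (norm (speed n (t, x) - speed n (t, y))) \<partial>lebesgue)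
    \<le> ennreal (speed_lipschitz_const n * norm (x - y))"
proof -
  define C where "C = exp (integral {s..T} (L n)) * norm (x - y)"
  have int: "(\<lambda>t. C * \<bar>L n t\<bar>) absolutely_integrable_on {s..T}" using abs_L[of n] by (intro set_integrable_mult_right) simp
  have "(\<integral>\<^sup>+t\<in>{s..T}. ennreal (norm (speed n (t, x) - speed n (t, y))) \<partial>lebesgue)
      \<le> (\<integral>\<^sup>+t\<in>{s..T}. ennreal (C * \<bar>L n t\<bar>) \<partial>lebesgue)"
  proof (rule nn_integral_mono_AE, rule AE_mp[OF AE_not_N], rule AE_I2, rule impI)
    fix t assume "t \<notin> N"
    show "ennreal (norm (speed n (t, x) - speed n (t, y))) * indicator {s..T} t \<le> ennreal (C * \<bar>L n t\<bar>) * indicator {s..T} t"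
    proof (cases "t \<in> {s..T}")
      case True
      then have t: "t \<in> {s..T} - N" using \<open>t \<notin> N\<close> by simp
      have "norm (speed n (t, x) - speed n (t, y)) \<le> L n t * norm (X n t x - X n t y)"
        unfolding speed_eq[OF t] by (rule flow.lipschitz[OF t])
      also have "\<dots> \<le> L n t * C"
        unfolding C_def using flow.L_nonneg[OF t] flow.space_lipschitz[OF True] by (intro mult_left_mono)
      finally have "norm (speed n (t, x) - speed n (t, y)) \<le> C * \<bar>L n t\<bar>"
        using flow.L_nonneg[OF t, of n] by (simp add: mult.commute)
      then show ?thesis using True by (simp add: ennreal_leI)
    qed simp
  qed
  also have "\<dots> = ennreal (integral {s..T} (\<lambda>t. C * \<bar>L n t\<bar>))"
    by (rule nn_set_integral_eq_integral[OF int]) (simp add: C_def)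
  finally show ?thesis by (simp add: C_def speed_lipschitz_const_def mult_ac)
qed

lemma X_measurable:
  assumes t: "t \<in> {s..T}"
  shows "X n t \<in> borel_measurable lebesgue"
proof -
  show ?thesis
    using borel_measurable_sections(1)[OF Xc_borel, of n t] t by (simp add: Xc_eq measurable_completion)
qed

lemma path_family: "path_family s T (X n) (speed n) E a"
proof
  show "AE x in lebesgue. X n s x = x \<and> primitive_on s T (\<lambda>t. X n t x) (\<lambda>t. speed n (t, x)) \<and>
      (AE t in lebesgue. t \<in> {s..T} \<longrightarrow> norm (speed n (t, x)) \<le> E * (1 + norm x) * a t)"
  proof (rule AE_I2, intro conjI flow.init X_primitive)
    fix x
    show "AE t in lebesgue. t \<in> {s..T} \<longrightarrow> norm (speed n (t, x)) \<le> E * (1 + norm x) * a t"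
      using AE_not_N by (rule AE_mp) (auto intro!: AE_I2 speed_bound)
  qed
qed (rule flow.sT E_ge_1 flow.a X_measurable; assumption?)+

lemma W11_strongly_measurable: "W11_strongly_measurable s T (\<lambda>x t. X n t x)"
  by (rule W11_strongly_measurable_limit[where w = "\<lambda>_. X n" and g = "\<lambda>_. speed n" and h = "speed n"
        and M = "\<lambda>_. speed_lipschitz_const n"])
    (auto intro: flow.sT X_primitive flow.init speed_lipschitz_const_nonneg speed_lipschitz)

end

context convergent_flow_sequence
begin

lemma AE_limits_exist:
  "AE x in lebesgue. (\<forall>t\<in>{s..T}. convergent (\<lambda>n. X n t x)) \<and> (AE t in lborel. Cauchy (\<lambda>n. speed n (t, x)))"
  unfolding AE_completion_iff using X_conv speeds_converge by eventually_elim simp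

context
  fixes \<psi> :: "real \<Rightarrow> real^'d \<Rightarrow> real^'d"
  assumes unique: "AE x in lebesgue. \<forall>\<gamma>. solves_inclusion T b s x \<gamma> \<longrightarrow> (\<forall>t\<in>{s..T}. \<gamma> t = \<psi> t x)"
begin

text \<open>The limit solves the inclusion, and \<open>\<psi>\<close> is its only solution.\<close>

lemma AE_limit_flow_eq:
  "AE x in lebesgue. (\<forall>t\<in>{s..T}. \<psi> t x = limit_flow t x) \<and>
    (\<forall>t\<in>{s..T}. convergent (\<lambda>n. X n t x)) \<and> (AE t in lborel. Cauchy (\<lambda>n. speed n (t, x)))"
  using AE_limits_exist unique
proof eventually_elim
  case (elim x)
  then have "solves_inclusion T b s x (\<lambda>t. limit_flow t x)" by (intro limit_flow_solves_inclusion) simp_all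
  with elim(2) have "\<forall>t\<in>{s..T}. limit_flow t x = \<psi> t x" by blast
  then show ?case using elim(1) by simp
qed

lemma limit_paths:
  "AE x in lebesgue. \<psi> s x = x \<and> primitive_on s T (\<lambda>t. \<psi> t x) (\<lambda>t. limit_speed (t, x)) \<and>
    (AE t in lebesgue. t \<in> {s..T} \<longrightarrow> norm (limit_speed (t, x)) \<le> E * (1 + norm x) * a t)"
  using AE_limit_flow_eq
proof eventually_elim
  case (elim x)
  then have "primitive_on s T (\<lambda>t. \<psi> t x) (\<lambda>t. limit_speed (t, x))"
    by (intro primitive_on_cong[OF limit_primitive]) simp_all
  moreover have "\<psi> s x = x" using elim flow.sT by (simp add: limit_flow_def)
  ultimately show ?case using elim limit_speed_bound[of x] by blast
qed

lemma limit_path_family: "path_family s T \<psi> limit_speed E a"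
proof
  fix t assume t: "t \<in> {s..T}"
  note sec = borel_measurable_sections(1)[OF Xc_borel]
  have "(\<lambda>x. lim (\<lambda>n. Xc n (t, x))) \<in> borel_measurable lebesgue"
    using borel_measurable_lim_metric[OF sec] by (simp add: measurable_completion)
  moreover have "AE x in lebesgue. lim (\<lambda>n. Xc n (t, x)) = \<psi> t x"
    using AE_limit_flow_eq
  proof eventually_elim
    case (elim x)
    then have "(\<lambda>n. X n t x) \<longlonglongrightarrow> limit_flow t x" using t by (intro X_tendsto_limit_flow) simp_all
    then show ?case using elim t by (simp add: limI Xc_eq)
  qed
  ultimately show "\<psi> t \<in> borel_measurable lebesgue" by (rule borel_measurable_AE)
qed (rule flow.sT E_ge_1 flow.a limit_paths)+

lemma limit_W11_strongly_measurable: "W11_strongly_measurable s T (\<lambda>x t. \<psi> t x)"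
proof (rule W11_strongly_measurable_limit[where w = X and g = speed and h = limit_speed and M = speed_lipschitz_const])
  show "AE x in lebesgue. \<psi> s x = x \<and> primitive_on s T (\<lambda>t. \<psi> t x) (\<lambda>t. limit_speed (t, x)) \<and>
      (\<lambda>n. \<integral>\<^sup>+t\<in>{s..T}. ennreal (norm (speed n (t, x) - limit_speed (t, x))) \<partial>lebesgue) \<longlonglongrightarrow> 0"
    using AE_limit_flow_eq limit_paths
    by eventually_elim (use speed_error_tendsto in \<open>simp add: speed_error_def\<close>)
qed (rule flow.sT X_primitive flow.init speed_lipschitz_const_nonneg speed_lipschitz)+

lemma speed_error_bound:
  "AE x in lebesgue. speed_error n x \<le> ennreal (2 * (E * (1 + norm x) * integral {s..T} (\<lambda>t. \<bar>a t\<bar>)))"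
  using limit_paths
proof (rule AE_mp, intro AE_I2 impI)
  fix x assume "\<psi> s x = x \<and> primitive_on s T (\<lambda>t. \<psi> t x) (\<lambda>t. limit_speed (t, x)) \<and>
    (AE t in lebesgue. t \<in> {s..T} \<longrightarrow> norm (limit_speed (t, x)) \<le> E * (1 + norm x) * a t)"
  then have lim: "AE t in lebesgue. t \<in> {s..T} \<longrightarrow> norm (limit_speed (t, x)) \<le> E * (1 + norm x) * a t" by simp
  define C where "C = 2 * (E * (1 + norm x))"
  have int: "(\<lambda>t. C * \<bar>a t\<bar>) absolutely_integrable_on {s..T}"
    using absolutely_integrable_abs[OF flow.a] by (intro set_integrable_mult_right) simp
  have C: "C \<ge> 0" using E_ge_1 by (simp add: C_def)
  have "speed_error n x \<le> (\<integral>\<^sup>+t\<in>{s..T}. ennreal (C * \<bar>a t\<bar>) \<partial>lebesgue)"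
    unfolding speed_error_def
  proof (rule nn_integral_mono_AE)
    show "AE t in lebesgue. ennreal (norm (speed n (t, x) - limit_speed (t, x))) * indicator {s..T} t
        \<le> ennreal (C * \<bar>a t\<bar>) * indicator {s..T} t"
      using AE_not_N lim
    proof eventually_elim
      case (elim t)
      show ?case
      proof (cases "t \<in> {s..T}")
        case True
        have "norm (speed n (t, x) - limit_speed (t, x)) \<le> norm (speed n (t, x)) + norm (limit_speed (t, x))"
          by (rule norm_triangle_ineq4)
        also have "\<dots> \<le> E * (1 + norm x) * a t + E * (1 + norm x) * a t"
          using speed_bound[of t n x] elim True by (intro add_mono) simp_all
        also have "\<dots> = C * a t" by (simp add: C_def)
        also have "\<dots> \<le> C * \<bar>a t\<bar>" using C by (intro mult_left_mono) auto
        finally show ?thesis using True by (simp add: ennreal_leI)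
      qed simp
    qed
  qed
  also have "\<dots> = ennreal (integral {s..T} (\<lambda>t. C * \<bar>a t\<bar>))"
    by (rule nn_set_integral_eq_integral[OF int]) (simp add: C)
  finally show "speed_error n x \<le> ennreal (2 * (E * (1 + norm x) * integral {s..T} (\<lambda>t. \<bar>a t\<bar>)))"
    by (simp add: C_def mult_ac)
qed

lemma AE_speed_error_tendsto: "AE x in lebesgue. (\<lambda>n. speed_error n x) \<longlonglongrightarrow> 0"
  using AE_limit_flow_eq by eventually_elim (use speed_error_tendsto in simp)

lemma dist_le_speed_error:
  assumes t: "t \<in> {s..T}"
  shows "AE x in lebesgue. ennreal (norm (X n t x - \<psi> t x)) \<le> speed_error n x"
  using AE_limit_flow_eq by eventually_elim (use X_dist_limit_flow t in simp)

lemma W11_dist_le_speed_error: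
  "AE x in lebesgue. W11_norm s T (\<lambda>t. X n t x - \<psi> t x) \<le> ennreal (T - s + 1) * speed_error n x"
  using limit_paths
proof eventually_elim
  case (elim x)
  have "W11_norm s T (\<lambda>t. X n t x - \<psi> t x) \<le> ennreal (T - s) * ennreal (norm (X n s x - \<psi> s x))
      + ennreal (T - s + 1) * speed_error n x"
    unfolding speed_error_def using elim
    by (intro W11_norm_le primitive_on_diff[OF X_primitive] flow.sT) simp
  then show ?case using elim by (simp add: flow.init)
qed

text \<open>All distances of the conclusion are controlled by the \<open>L\<^sup>1\<close> distance in time of the speeds.\<close>

lemma Lp_convergence:
  assumes K: "compact K" and p: "p \<ge> 1"
  shows "(\<lambda>n. SUP t\<in>{s..T}. Lp_norm_on K p (\<lambda>x. ennreal (norm (X n t x - \<psi> t x)))) \<longlonglongrightarrow> 0"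
    and "(\<lambda>n. Lp_norm_on K p (\<lambda>x. W11_norm s T (\<lambda>t. X n t x - \<psi> t x))) \<longlonglongrightarrow> 0"
proof -
  obtain R where R: "R \<ge> 0" "\<And>x. x \<in> K \<Longrightarrow> norm x \<le> R" using compact_norm_bound[OF K] by metis
  define A where "A = integral {s..T} (\<lambda>t. \<bar>a t\<bar>)"
  have A: "A \<ge> 0" unfolding A_def using path_family.total_nonneg[OF limit_path_family] path_family.total_def[OF limit_path_family] by simp
  have meas: "speed_error n \<in> borel_measurable lebesgue" for n using speed_error_borel by (simp add: measurable_completion)
  have err: "AE x in lebesgue. x \<in> K \<longrightarrow> speed_error n x \<le> ennreal (2 * (E * (1 + R) * A))" for n
    using speed_error_bound[of n]
  proof (rule AE_mp, intro AE_I2 impI)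
    fix x assume *: "speed_error n x \<le> ennreal (2 * (E * (1 + norm x) * integral {s..T} (\<lambda>t. \<bar>a t\<bar>)))" and "x \<in> K"
    have "E * (1 + norm x) * A \<le> E * (1 + R) * A"
      using R(2)[OF \<open>x \<in> K\<close>] A E_ge_1 by (intro mult_right_mono mult_left_mono) auto
    then have "ennreal (2 * (E * (1 + norm x) * A)) \<le> ennreal (2 * (E * (1 + R) * A))" by (intro ennreal_leI) simp
    with * show "speed_error n x \<le> ennreal (2 * (E * (1 + R) * A))" unfolding A_def[symmetric] by (rule order_trans)
  qed
  have lim1: "(\<lambda>n. Lp_norm_on K p (speed_error n)) \<longlonglongrightarrow> 0"
    by (rule Lp_norm_on_tendsto_0[OF K meas err AE_speed_error_tendsto p])
  have le1: "(SUP t\<in>{s..T}. Lp_norm_on K p (\<lambda>x. ennreal (norm (X n t x - \<psi> t x)))) \<le> Lp_norm_on K p (speed_error n)" for n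
  proof (rule SUP_least, rule Lp_norm_on_mono_AE[OF _ p])
    fix t assume "t \<in> {s..T}"
    from dist_le_speed_error[OF this, of n]
    show "AE x in lebesgue. x \<in> K \<longrightarrow> ennreal (norm (X n t x - \<psi> t x)) \<le> speed_error n x" by eventually_elim simp
  qed
  show "(\<lambda>n. SUP t\<in>{s..T}. Lp_norm_on K p (\<lambda>x. ennreal (norm (X n t x - \<psi> t x)))) \<longlonglongrightarrow> 0"
    by (rule tendsto_sandwich[OF _ _ tendsto_const lim1]) (simp_all add: le1)
  have lim2: "(\<lambda>n. Lp_norm_on K p (\<lambda>x. ennreal (T - s + 1) * speed_error n x)) \<longlonglongrightarrow> 0"
  proof (rule Lp_norm_on_tendsto_0[OF K _ _ _ p])
    show "(\<lambda>x. ennreal (T - s + 1) * speed_error n x) \<in> borel_measurable lebesgue" for n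
      using meas by (intro borel_measurable_times_ennreal) auto
    show "AE x in lebesgue. x \<in> K \<longrightarrow> ennreal (T - s + 1) * speed_error n x \<le> ennreal ((T - s + 1) * (2 * (E * (1 + R) * A)))" for n
      using err[of n]
    proof (rule AE_mp, intro AE_I2 impI)
      fix x assume "x \<in> K \<longrightarrow> speed_error n x \<le> ennreal (2 * (E * (1 + R) * A))" "x \<in> K"
      then have "ennreal (T - s + 1) * speed_error n x \<le> ennreal (T - s + 1) * ennreal (2 * (E * (1 + R) * A))"
        by (intro mult_left_mono) simp_all
      then show "ennreal (T - s + 1) * speed_error n x \<le> ennreal ((T - s + 1) * (2 * (E * (1 + R) * A)))"
        using flow.sT E_ge_1 R A by (simp add: ennreal_mult)
    qed
    show "AE x in lebesgue. (\<lambda>n. ennreal (T - s + 1) * speed_error n x) \<longlonglongrightarrow> 0"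
      using AE_speed_error_tendsto
    proof eventually_elim
      case (elim x)
      have "(\<lambda>n. ennreal (T - s + 1) * speed_error n x) \<longlonglongrightarrow> ennreal (T - s + 1) * 0"
        by (rule ennreal_tendsto_cmult[OF _ elim]) simp
      then show ?case by simp
    qed
  qed
  have le2: "Lp_norm_on K p (\<lambda>x. W11_norm s T (\<lambda>t. X n t x - \<psi> t x)) \<le> Lp_norm_on K p (\<lambda>x. ennreal (T - s + 1) * speed_error n x)" for n
  proof (rule Lp_norm_on_mono_AE[OF _ p])
    show "AE x in lebesgue. x \<in> K \<longrightarrow> W11_norm s T (\<lambda>t. X n t x - \<psi> t x) \<le> ennreal (T - s + 1) * speed_error n x"
      using W11_dist_le_speed_error[of n] by eventually_elim simp
  qed
  show "(\<lambda>n. Lp_norm_on K p (\<lambda>x. W11_norm s T (\<lambda>t. X n t x - \<psi> t x))) \<longlonglongrightarrow> 0"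
    by (rule tendsto_sandwich[OF _ _ tendsto_const lim2]) (simp_all add: le2)
qed

end

end

section \<open>Stability of the regular Lagrangian flow\<close>

lemma tendsto_0_at_right_subsequences:
  fixes F :: "real \<Rightarrow> ennreal"
  assumes "\<And>e. (\<And>n. e n > 0) \<Longrightarrow> e \<longlonglongrightarrow> 0 \<Longrightarrow> \<exists>k. strict_mono k \<and> (\<lambda>n. F (e (k n))) \<longlonglongrightarrow> 0"
  shows "(F \<longlongrightarrow> 0) (at_right 0)"
  unfolding tendsto_at_iff_sequentially o_def
proof (intro allI impI)
  fix e :: "nat \<Rightarrow> real" assume e: "\<forall>i. e i \<in> {0<..} - {0}" "e \<longlonglongrightarrow> 0"
  show "(\<lambda>n. F (e n)) \<longlonglongrightarrow> 0"
  proof (rule order_tendstoI)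
    fix \<eta> :: ennreal assume "\<eta> > 0"
    show "\<forall>\<^sub>F n in sequentially. F (e n) < \<eta>"
    proof (rule ccontr)
      assume "\<not> (\<forall>\<^sub>F n in sequentially. F (e n) < \<eta>)"
      then have "\<exists>r :: nat \<Rightarrow> nat. strict_mono r \<and> (\<forall>n. \<not> F (e (r n)) < \<eta>)" by (rule not_eventually_sequentiallyD)
      then obtain r :: "nat \<Rightarrow> nat" where r: "strict_mono r" "\<forall>n. \<not> F (e (r n)) < \<eta>" by (elim exE conjE)
      have "\<exists>k. strict_mono k \<and> (\<lambda>n. F (e (r (k n)))) \<longlonglongrightarrow> 0"
      proof (rule assms)
        show "e (r n) > 0" for n using e(1) by auto
        show "(\<lambda>n. e (r n)) \<longlonglongrightarrow> 0" using LIMSEQ_subseq_LIMSEQ[OF e(2) r(1)] by (simp add: o_def)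
      qed
      then obtain k where "(\<lambda>n. F (e (r (k n)))) \<longlonglongrightarrow> 0" by blast
      then have "\<forall>\<^sub>F n in sequentially. F (e (r (k n))) < \<eta>" using \<open>\<eta> > 0\<close> by (rule order_tendstoD)
      then show False using r(2) by (auto dest: eventually_happens)
    qed
  qed simp
qed

locale regularized_flows =
  fixes T :: real
    and C\<^sub>0 C\<^sub>1 :: "real \<Rightarrow> real"
    and b :: "real \<Rightarrow> real^'d \<Rightarrow> real^'d"
    and b\<epsilon> :: "real \<Rightarrow> real \<Rightarrow> real^'d \<Rightarrow> real^'d"
    and \<phi>\<epsilon> :: "real \<Rightarrow> real \<Rightarrow> real \<Rightarrow> real^'d \<Rightarrow> real^'d"
  assumes C0: "integrable (lebesgue_on {0..T}) C\<^sub>0" and C0_nonneg: "AE t in lebesgue_on {0..T}. 0 \<le> C\<^sub>0 t"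
    and C1: "integrable (lebesgue_on {0..T}) C\<^sub>1" and C1_nonneg: "AE t in lebesgue_on {0..T}. 0 \<le> C\<^sub>1 t"
    and fields: "\<And>\<epsilon>. \<epsilon> > 0 \<Longrightarrow> admissible_field T C\<^sub>0 C\<^sub>1 (b\<epsilon> \<epsilon>)"
    and fields_conv: "AE (t, x) in lebesgue_on ({0..T} \<times> UNIV). ((\<lambda>\<epsilon>. b\<epsilon> \<epsilon> t x) \<longlongrightarrow> b t x) (at_right 0)"
    and gradients: "\<And>\<epsilon>. \<epsilon> > 0 \<Longrightarrow> (\<integral>\<^sup>+ t\<in>{0..T}. gradient_sup_norm (b\<epsilon> \<epsilon> t) \<partial>lebesgue) < \<infinity>"
    and flows: "\<And>\<epsilon>. \<epsilon> > 0 \<Longrightarrow> flow_of T (b\<epsilon> \<epsilon>) (\<phi>\<epsilon> \<epsilon>)"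
begin

lemma field_data:
  assumes "\<epsilon> > 0"
  obtains L B where "L absolutely_integrable_on {0..T}" "\<And>t. 0 \<le> L t" "B \<in> borel_measurable borel"
    "AE t in lborel. t \<in> {0..T} \<longrightarrow> 0 \<le> C\<^sub>0 t \<and> 0 \<le> C\<^sub>1 t \<and> mono (\<lambda>x. b\<epsilon> \<epsilon> t x + C\<^sub>1 t *\<^sub>R x) \<and>
      (\<forall>y. norm (b\<epsilon> \<epsilon> t y) \<le> real CARD('d) * C\<^sub>0 t * (1 + norm y)) \<and>
      (\<forall>x y. norm (b\<epsilon> \<epsilon> t x - b\<epsilon> \<epsilon> t y) \<le> L t * norm (x - y)) \<and> (\<forall>y. B (t, y) = b\<epsilon> \<epsilon> t y)"
proof -
  note adm = fields[OF assms, unfolded admissible_field_def]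
  have m: "AE t in lborel. t \<in> {0..T} \<longrightarrow> mono (\<lambda>x. b\<epsilon> \<epsilon> t x + C\<^sub>1 t *\<^sub>R x)" using adm by (intro AE_lborel_Icc) simp
  note c0 = AE_lborel_Icc[OF C0_nonneg] and c1 = AE_lborel_Icc[OF C1_nonneg]
  have gr: "AE t in lborel. t \<in> {0..T} \<longrightarrow> (AE y in lborel. norm (b\<epsilon> \<epsilon> t y) \<le> C\<^sub>0 t * (1 + norm y))"
    using adm by (intro AE_strip_sections) simp
  obtain L B where LB: "L absolutely_integrable_on {0..T}" "\<And>t. 0 \<le> L t" "B \<in> borel_measurable borel"
    "AE t in lborel. t \<in> {0..T} \<longrightarrow>
      (\<forall>x y. norm (b\<epsilon> \<epsilon> t x - b\<epsilon> \<epsilon> t y) \<le> L t * norm (x - y)) \<and> (\<forall>y. B (t, y) = b\<epsilon> \<epsilon> t y)"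
    using integrable_lipschitz_constant_and_borel_version[OF _ m c1 gradients[OF assms]] adm by blast
  show ?thesis
  proof (rule that[OF LB(1-3)])
    show "AE t in lborel. t \<in> {0..T} \<longrightarrow> 0 \<le> C\<^sub>0 t \<and> 0 \<le> C\<^sub>1 t \<and> mono (\<lambda>x. b\<epsilon> \<epsilon> t x + C\<^sub>1 t *\<^sub>R x) \<and>
      (\<forall>y. norm (b\<epsilon> \<epsilon> t y) \<le> real CARD('d) * C\<^sub>0 t * (1 + norm y)) \<and>
      (\<forall>x y. norm (b\<epsilon> \<epsilon> t x - b\<epsilon> \<epsilon> t y) \<le> L t * norm (x - y)) \<and> (\<forall>y. B (t, y) = b\<epsilon> \<epsilon> t y)"
      using LB(4) m c0 c1 gr by eventually_elim (auto simp: mult.assoc intro: mono_growth_everywhere)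
  qed
qed

text \<open>The exceptional null sets of times of countably many fields are merged into one.  A constant sequence is allowed
  and gives the properties of a single flow.\<close>

lemma flow_sequence_along:
  fixes e :: "nat \<Rightarrow> real" and \<beta> :: "real \<Rightarrow> real^'d \<Rightarrow> real^'d"
  assumes e: "\<And>n. e n > 0" and s: "s \<in> {0..T}"
    and conv: "AE t in lborel. t \<in> {0..T} \<longrightarrow> (AE y in lborel. (\<lambda>n. b\<epsilon> (e n) t y) \<longlonglongrightarrow> \<beta> t y)"
  obtains L N B where "flow_sequence s T (\<lambda>n. b\<epsilon> (e n)) \<beta> (\<lambda>t. real CARD('d) * C\<^sub>0 t) C\<^sub>1 L N (\<lambda>n t x. \<phi>\<epsilon> (e n) t s x) B"
proof -
  define good where "good L B n t \<longleftrightarrow> 0 \<le> C\<^sub>0 t \<and> 0 \<le> C\<^sub>1 t \<and> mono (\<lambda>x. b\<epsilon> (e n) t x + C\<^sub>1 t *\<^sub>R x) \<and>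
      (\<forall>y. norm (b\<epsilon> (e n) t y) \<le> real CARD('d) * C\<^sub>0 t * (1 + norm y)) \<and>
      (\<forall>x y. norm (b\<epsilon> (e n) t x - b\<epsilon> (e n) t y) \<le> L t * norm (x - y)) \<and> (\<forall>y. B (t, y) = b\<epsilon> (e n) t y)"
    for L :: "real \<Rightarrow> real" and B :: "real \<times> (real^'d) \<Rightarrow> real^'d" and n t
  define ok where "ok L B n \<longleftrightarrow> L absolutely_integrable_on {0..T} \<and> (\<forall>t. 0 \<le> L t) \<and> B \<in> borel_measurable borel \<and>
      (AE t in lborel. t \<in> {0..T} \<longrightarrow> good L B n t)" for L B n
  have "\<exists>L B. ok L B n" for n
    unfolding ok_def good_def by (rule field_data[OF e[of n]]) blast
  then obtain L B where "\<And>n. ok (L n) (B n) n" by metis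
  then have LB: "\<And>n. L n absolutely_integrable_on {0..T}" "\<And>n t. 0 \<le> L n t" "\<And>n. B n \<in> borel_measurable borel"
    "\<And>n. AE t in lborel. t \<in> {0..T} \<longrightarrow> good (L n) (B n) n t" unfolding ok_def by blast+
  have "AE t in lborel. \<forall>n. t \<in> {0..T} \<longrightarrow> good (L n) (B n) n t" using LB(4) unfolding AE_all_countable by blast
  then have "AE t in lborel. t \<in> {0..T} \<longrightarrow> (\<forall>n. good (L n) (B n) n t) \<and> (AE y in lborel. (\<lambda>n. b\<epsilon> (e n) t y) \<longlonglongrightarrow> \<beta> t y)"
    using conv by eventually_elim blast
  then obtain N where N: "negligible N" "\<And>t. t \<notin> N \<Longrightarrow> t \<in> {0..T} \<longrightarrow> (\<forall>n. good (L n) (B n) n t) \<and> (AE y in lborel. (\<lambda>n. b\<epsilon> (e n) t y) \<longlonglongrightarrow> \<beta> t y)"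
    by (rule AE_lborel_negligible) blast
  have sub: "{s..T} \<subseteq> {0..T}" using s by auto
  have good: "good (L n) (B n) n t" if "t \<in> {s..T} - N" for n t using N(2)[of t] that sub by blast
  have restrict: "h absolutely_integrable_on {s..T}" if "h absolutely_integrable_on {0..T}" for h :: "real \<Rightarrow> real"
    by (rule set_integrable_subset[OF that _ sub]) simp
  have abs0: "C absolutely_integrable_on {0..T}" if "integrable (lebesgue_on {0..T}) C" for C :: "real \<Rightarrow> real"
    using that unfolding set_integrable_def by (subst (asm) integrable_restrict_space) auto
  have "flow_sequence s T (\<lambda>n. b\<epsilon> (e n)) \<beta> (\<lambda>t. real CARD('d) * C\<^sub>0 t) C\<^sub>1 L N (\<lambda>n t x. \<phi>\<epsilon> (e n) t s x) B"
  proof (rule flow_sequence.intro)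
    show "B n \<in> borel_measurable borel" for n by (rule LB(3))
    show "B n (t, y) = b\<epsilon> (e n) t y" if "t \<in> {s..T} - N" for n t y using good[OF that] unfolding good_def by blast
    show "AE y in lborel. (\<lambda>n. b\<epsilon> (e n) t y) \<longlonglongrightarrow> \<beta> t y" if "t \<in> {s..T} - N" for t
      using N(2)[of t] that sub by blast
    show "monotone_lipschitz_flow s T (b\<epsilon> (e n)) (\<lambda>t. real CARD('d) * C\<^sub>0 t) C\<^sub>1 (L n) N (\<lambda>t x. \<phi>\<epsilon> (e n) t s x)" for n
    proof
      show "s \<le> T" using s by simp
      show "negligible N" by (rule N(1))
      show "(\<lambda>t. real CARD('d) * C\<^sub>0 t) absolutely_integrable_on {s..T}"
        using restrict[OF abs0[OF C0]] by (intro set_integrable_mult_right) simp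
      show "C\<^sub>1 absolutely_integrable_on {s..T}" by (rule restrict[OF abs0[OF C1]])
      show "L n absolutely_integrable_on {s..T}" by (rule restrict[OF LB(1)])
      note fl = flows[OF e[of n], unfolded flow_of_def, rule_format, OF s]
      show "abs_continuous_on s T (\<lambda>t. \<phi>\<epsilon> (e n) t s x)" "\<phi>\<epsilon> (e n) s s x = x" for x using fl by blast+
      fix x
      have "AE t in lborel. t \<in> {s..T} \<longrightarrow>
          ((\<lambda>t. \<phi>\<epsilon> (e n) t s x) has_vector_derivative b\<epsilon> (e n) t (\<phi>\<epsilon> (e n) t s x)) (at t within {s..T})"
        using fl by (intro AE_lborel_Icc) blast
      then show "\<exists>M. negligible M \<and> (\<forall>t\<in>{s..T} - M.
          ((\<lambda>t. \<phi>\<epsilon> (e n) t s x) has_vector_derivative b\<epsilon> (e n) t (\<phi>\<epsilon> (e n) t s x)) (at t within {s..T}))"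
        by (rule AE_lborel_negligible) blast
    next
      fix t x y assume t: "t \<in> {s..T} - N"
      show "0 \<le> real CARD('d) * C\<^sub>0 t" "0 \<le> C\<^sub>1 t" "0 \<le> L n t" using good[OF t, of n] LB(2) by (auto simp: good_def)
      show "norm (b\<epsilon> (e n) t y) \<le> real CARD('d) * C\<^sub>0 t * (1 + norm y)"
        "mono (\<lambda>x. b\<epsilon> (e n) t x + C\<^sub>1 t *\<^sub>R x)"
        "norm (b\<epsilon> (e n) t x - b\<epsilon> (e n) t y) \<le> L n t * norm (x - y)"
        using good[OF t, of n] unfolding good_def by blast+
    qed
  qed
  then show ?thesis by (rule that)
qed

lemma regularized_flow_memberships:
  assumes "\<epsilon> > 0" and s: "s \<in> {0..T}" and p: "p \<ge> 1"
  shows "in_C_Lp_loc s T p (\<lambda>t x. \<phi>\<epsilon> \<epsilon> t s x)" "in_Lp_loc_W11 s T p (\<lambda>x t. \<phi>\<epsilon> \<epsilon> t s x)"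
proof -
  obtain L N B where fs: "flow_sequence s T (\<lambda>_. b\<epsilon> \<epsilon>) (b\<epsilon> \<epsilon>) (\<lambda>t. real CARD('d) * C\<^sub>0 t) C\<^sub>1 L N (\<lambda>_ t x. \<phi>\<epsilon> \<epsilon> t s x) B"
    by (rule flow_sequence_along[OF assms(1) s, of "b\<epsilon> \<epsilon>"]) auto
  note fam = flow_sequence.path_family[OF fs, of 0]
  show "in_C_Lp_loc s T p (\<lambda>t x. \<phi>\<epsilon> \<epsilon> t s x)" by (rule path_family.in_C_Lp_loc[OF fam p])
  show "in_Lp_loc_W11 s T p (\<lambda>x t. \<phi>\<epsilon> \<epsilon> t s x)"
    unfolding in_Lp_loc_W11_def
    by (intro conjI allI impI flow_sequence.W11_strongly_measurable[OF fs] path_family.W11_finite[OF fam p])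
qed

lemma convergent_flow_sequence_along:
  fixes e :: "nat \<Rightarrow> real"
  assumes e: "\<And>n. e n > 0" "e \<longlonglongrightarrow> 0" and s: "s \<in> {0..T}"
  obtains k L N B where "strict_mono k"
    "convergent_flow_sequence s T (\<lambda>n. b\<epsilon> (e (k n))) b (\<lambda>t. real CARD('d) * C\<^sub>0 t) C\<^sub>1 L N (\<lambda>n t x. \<phi>\<epsilon> (e (k n)) t s x) B"
proof -
  have lim: "filterlim e (at_right 0) sequentially"
    using e(2) by (auto simp: filterlim_at e(1) less_imp_neq[OF e(1), symmetric] intro!: always_eventually)
  have "AE t in lborel. t \<in> {0..T} \<longrightarrow> (AE y in lborel. (\<lambda>n. b\<epsilon> (e n) t y) \<longlonglongrightarrow> b t y)"
    using AE_strip_sections[OF fields_conv]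
  proof eventually_elim
    case (elim t)
    show ?case
    proof
      assume "t \<in> {0..T}"
      with elim have "AE y in lborel. ((\<lambda>\<epsilon>. b\<epsilon> \<epsilon> t y) \<longlongrightarrow> b t y) (at_right 0)" by blast
      then show "AE y in lborel. (\<lambda>n. b\<epsilon> (e n) t y) \<longlonglongrightarrow> b t y"
        by eventually_elim (rule filterlim_compose[OF _ lim])
    qed
  qed
  then obtain L N B where fs: "flow_sequence s T (\<lambda>n. b\<epsilon> (e n)) b (\<lambda>t. real CARD('d) * C\<^sub>0 t) C\<^sub>1 L N (\<lambda>n t x. \<phi>\<epsilon> (e n) t s x) B"
    by (rule flow_sequence_along[OF e(1) s])
  obtain k where k: "strict_mono k" "AE x in lborel. \<forall>t\<in>{s..T}. convergent (\<lambda>n. \<phi>\<epsilon> (e (k n)) t s x)"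
    by (rule flow_sequence.convergent_subsequence[OF fs])
  have "convergent_flow_sequence s T (\<lambda>n. b\<epsilon> (e (k n))) b (\<lambda>t. real CARD('d) * C\<^sub>0 t) C\<^sub>1 (\<lambda>n. L (k n)) N
      (\<lambda>n t x. \<phi>\<epsilon> (e (k n)) t s x) (\<lambda>n. B (k n))"
    by (intro convergent_flow_sequence.intro flow_sequence.subsequence[OF fs k(1)] convergent_flow_sequence_axioms.intro k(2))
  with k(1) show ?thesis by (rule that)
qed

end

theorem theorem3p2:
  fixes T :: real
    and C\<^sub>0 C\<^sub>1 :: "real \<Rightarrow> real"
    and b :: "real \<Rightarrow> real^'d \<Rightarrow> real^'d"
    and b\<epsilon> :: "real \<Rightarrow> real \<Rightarrow> real^'d \<Rightarrow> real^'d"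
    and \<phi> :: "real \<Rightarrow> real \<Rightarrow> real^'d \<Rightarrow> real^'d"
    and \<phi>\<epsilon> :: "real \<Rightarrow> real \<Rightarrow> real \<Rightarrow> real^'d \<Rightarrow> real^'d"
  assumes "T > 0"
    and "integrable (lebesgue_on {0..T}) C\<^sub>0" and "AE t in lebesgue_on {0..T}. 0 \<le> C\<^sub>0 t"
    and "integrable (lebesgue_on {0..T}) C\<^sub>1" and "AE t in lebesgue_on {0..T}. 0 \<le> C\<^sub>1 t"
    and "admissible_field T C\<^sub>0 C\<^sub>1 b"
    and "regular_Lagrangian_flow T b \<phi>"
    and "\<And>\<epsilon>. \<epsilon> > 0 \<Longrightarrow> admissible_field T C\<^sub>0 C\<^sub>1 (b\<epsilon> \<epsilon>)"
    and "AE (t, x) in lebesgue_on ({0..T} \<times> UNIV). ((\<lambda>\<epsilon>. b\<epsilon> \<epsilon> t x) \<longlongrightarrow> b t x) (at_right 0)"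
    and "\<And>\<epsilon>. \<epsilon> > 0 \<Longrightarrow> (\<integral>\<^sup>+ t\<in>{0..T}. gradient_sup_norm (b\<epsilon> \<epsilon> t) \<partial>lebesgue) < \<infinity>"
    and "\<And>\<epsilon>. \<epsilon> > 0 \<Longrightarrow> flow_of T (b\<epsilon> \<epsilon>) (\<phi>\<epsilon> \<epsilon>)"
  shows "\<forall>s\<in>{0..T}. \<forall>p\<ge>1.
     converges_C_Lp_loc s T p (\<lambda>\<epsilon> t x. \<phi>\<epsilon> \<epsilon> t s x) (\<lambda>t x. \<phi> t s x) \<and>
     converges_Lp_loc_W11 s T p (\<lambda>\<epsilon> x t. \<phi>\<epsilon> \<epsilon> t s x) (\<lambda>x t. \<phi> t s x)"
proof (intro ballI allI impI)
  fix s p :: real assume s: "s \<in> {0..T}" and p: "p \<ge> 1"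
  interpret regularized_flows T C\<^sub>0 C\<^sub>1 b b\<epsilon> \<phi>\<epsilon>
    by unfold_locales (use assms in auto)
  have unique: "AE x in lebesgue. \<forall>\<gamma>. solves_inclusion T b s x \<gamma> \<longrightarrow> (\<forall>t\<in>{s..T}. \<gamma> t = \<phi> t s x)"
    using assms(7) s unfolding regular_Lagrangian_flow_def by (auto elim!: AE_mp intro!: AE_I2)
  have limit: "\<exists>k. strict_mono k \<and>
      (\<forall>K. compact K \<longrightarrow>
        (\<lambda>n. SUP t\<in>{s..T}. Lp_norm_on K p (\<lambda>x. ennreal (norm (\<phi>\<epsilon> (e (k n)) t s x - \<phi> t s x)))) \<longlonglongrightarrow> 0 \<and>
        (\<lambda>n. Lp_norm_on K p (\<lambda>x. W11_norm s T (\<lambda>t. \<phi>\<epsilon> (e (k n)) t s x - \<phi> t s x))) \<longlonglongrightarrow> 0) \<and>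
      in_C_Lp_loc s T p (\<lambda>t x. \<phi> t s x) \<and> in_Lp_loc_W11 s T p (\<lambda>x t. \<phi> t s x)"
    if e: "\<And>n. e n > 0" "e \<longlonglongrightarrow> 0" for e :: "nat \<Rightarrow> real"
  proof -
    obtain k L N B where k: "strict_mono k" and cfs: "convergent_flow_sequence s T (\<lambda>n. b\<epsilon> (e (k n))) b
        (\<lambda>t. real CARD('d) * C\<^sub>0 t) C\<^sub>1 L N (\<lambda>n t x. \<phi>\<epsilon> (e (k n)) t s x) B"
      by (rule convergent_flow_sequence_along[OF e s])
    note fam = convergent_flow_sequence.limit_path_family[OF cfs unique]
    have "in_Lp_loc_W11 s T p (\<lambda>x t. \<phi> t s x)"
      unfolding in_Lp_loc_W11_def
      by (intro conjI allI impI convergent_flow_sequence.limit_W11_strongly_measurable[OF cfs unique]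
          path_family.W11_finite[OF fam p])
    then show ?thesis
      by (intro exI[of _ k] conjI allI impI k convergent_flow_sequence.Lp_convergence[OF cfs unique _ p]
          path_family.in_C_Lp_loc[OF fam p])
  qed
  have seq: "(\<lambda>n. 1 / real (Suc n)) \<longlonglongrightarrow> 0" using LIMSEQ_inverse_real_of_nat by (simp add: divide_inverse)
  have members: "in_C_Lp_loc s T p (\<lambda>t x. \<phi> t s x)" "in_Lp_loc_W11 s T p (\<lambda>x t. \<phi> t s x)"
    using limit[OF _ seq] by auto
  show "converges_C_Lp_loc s T p (\<lambda>\<epsilon> t x. \<phi>\<epsilon> \<epsilon> t s x) (\<lambda>t x. \<phi> t s x) \<and>
     converges_Lp_loc_W11 s T p (\<lambda>\<epsilon> x t. \<phi>\<epsilon> \<epsilon> t s x) (\<lambda>x t. \<phi> t s x)"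
    unfolding converges_C_Lp_loc_def converges_Lp_loc_W11_def
  proof (intro conjI allI impI members)
    show "in_C_Lp_loc s T p (\<lambda>t x. \<phi>\<epsilon> \<epsilon> t s x)" "in_Lp_loc_W11 s T p (\<lambda>x t. \<phi>\<epsilon> \<epsilon> t s x)" if "\<epsilon> > 0" for \<epsilon>
      using regularized_flow_memberships[OF that s p] .
    fix K :: "(real^'d) set" assume K: "compact K"
    show "((\<lambda>\<epsilon>. SUP t\<in>{s..T}. Lp_norm_on K p (\<lambda>x. ennreal (norm (\<phi>\<epsilon> \<epsilon> t s x - \<phi> t s x)))) \<longlongrightarrow> 0) (at_right 0)"
      by (rule tendsto_0_at_right_subsequences) (use limit K in blast)
    show "((\<lambda>\<epsilon>. Lp_norm_on K p (\<lambda>x. W11_norm s T (\<lambda>t. \<phi>\<epsilon> \<epsilon> t s x - \<phi> t s x))) \<longlongrightarrow> 0) (at_right 0)"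
      by (rule tendsto_0_at_right_subsequences) (use limit K in blast)
  qed
qed

end
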